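(* Let $\Gamma=R_{2m}(2b,r)$ be a Rose Window graph, where $b^2\equiv\pm1\pmod m$ and either $r=1$, or $r=m-1$ with $m$ even, and suppose $\Gamma$ is not of the form $R_n(2,1)$ nor of the form $R_{2k}(k-2,k-1)$. Then $\Gamma$ is the underlying graph of a map of class $2_{\{0,1\}}$ if and only if $b^2\equiv1\pmod m$, in which case there are exactly three pairwise nonisomorphic such maps.
   Context: For $n\ge3$, $1\le r\le n-1$ with $r\ne n/2$, and $0\le a\le n-1$, the Rose Window graph $R_n(a,r)$ has vertex set $\{x_i,y_i: i\in\mathbb Z_n\}$ and edges $x_ix_{i+1}$, $y_iy_{i+r}$, $x_iy_i$, $x_iy_{i-a}$ for $i\in\mathbb Z_n$ (indices mod $n$). A map is a $2$-cell embedding of a connected simple graph (its underlying graph) in a closed surface; the components of the complement are the faces. All maps considered are polytopal: flags correspond bijectively to incident triples (vertex, edge, face). For a flag $\Phi$ and $i\in\{0,1,2\}$, $\Phi^i$ is the unique flag differing from $\Phi$ exactly in its vertex ($i=0$), edge ($i=1$) or face ($i=2$). $\mathrm{Aut}(\mathcal M)$ is the group of automorphisms of the underlying graph preserving the set of faces. A map is in class $2_{\{0,1\}}$ if $\mathrm{Aut}(\mathcal M)$ has exactly two orbits on flags and for every flag $\Phi$, the flags $\Phi^0,\Phi^1$ lie in the orbit of $\Phi$ while $\Phi^2$ does not. *)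

theory Defs
  imports Main
begin

section \<open>Simple graphs (vertex set + set of 2-element edges)\<close>

definition simple_graph :: "'v set \<Rightarrow> 'v set set \<Rightarrow> bool" where
  "simple_graph V E \<longleftrightarrow> finite V \<and>
     (\<forall>e\<in>E. \<exists>u v. e = {u, v} \<and> u \<noteq> v \<and> u \<in> V \<and> v \<in> V)"

definition connected_graph :: "'v set \<Rightarrow> 'v set set \<Rightarrow> bool" where
  "connected_graph V E \<longleftrightarrow> V \<noteq> {} \<and>
     (\<forall>u\<in>V. \<forall>v\<in>V. (u, v) \<in> {(x, y). {x, y} \<in> E}\<^sup>*)"

definition graph_iso :: "'v set \<Rightarrow> 'v set set \<Rightarrow> 'w set \<Rightarrow> 'w set set \<Rightarrow> bool" where
  "graph_iso V1 E1 V2 E2 \<longleftrightarrow> (\<exists>f. bij_betw f V1 V2 \<and>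
     (\<forall>u\<in>V1. \<forall>v\<in>V1. {u, v} \<in> E1 \<longleftrightarrow> {f u, f v} \<in> E2))"

definition graph_aut :: "'v set \<Rightarrow> 'v set set \<Rightarrow> ('v \<Rightarrow> 'v) \<Rightarrow> bool" where
  "graph_aut V E \<sigma> \<longleftrightarrow> bij_betw \<sigma> V V \<and>
     (\<forall>u\<in>V. \<forall>v\<in>V. {u, v} \<in> E \<longleftrightarrow> {\<sigma> u, \<sigma> v} \<in> E)"

section \<open>Rose Window graphs\<close>

text \<open>Vertex x_i is (False, i), vertex y_i is (True, i), for i < n.\<close>

definition rw_V :: "nat \<Rightarrow> (bool \<times> nat) set" where
  "rw_V n = {(s, i). i < n}"

definition rw_E :: "nat \<Rightarrow> nat \<Rightarrow> nat \<Rightarrow> (bool \<times> nat) set set" where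
  "rw_E n a r = (\<Union>i\<in>{..<n}.
     {{(False, i), (False, (i + 1) mod n)},
      {(True, i), (True, (i + r) mod n)},
      {(False, i), (True, i)},
      {(False, i), (True, (i + n - a) mod n)}})"

section \<open>Polytopal maps, described combinatorially by their set of faces\<close>

text \<open>In a polytopal map every face boundary is a cycle of the graph; a face is
  identified with the edge set of its boundary cycle.\<close>

definition is_cycle :: "'v set set \<Rightarrow> 'v set set \<Rightarrow> bool" where
  "is_cycle E C \<longleftrightarrow> finite C \<and> C \<subseteq> E \<and> 3 \<le> card C \<and>
     (\<forall>v\<in>\<Union>C. card {e\<in>C. v \<in> e} = 2) \<and>
     (\<forall>e\<in>C. \<forall>e'\<in>C. (e, e') \<in> {(x, y). x \<in> C \<and> y \<in> C \<and> x \<inter> y \<noteq> {}}\<^sup>*)"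

definition polytopal_map :: "'v set \<Rightarrow> 'v set set \<Rightarrow> 'v set set set \<Rightarrow> bool" where
  "polytopal_map V E F \<longleftrightarrow> simple_graph V E \<and> connected_graph V E \<and>
     (\<forall>f\<in>F. is_cycle E f) \<and>
     (\<forall>e\<in>E. card {f\<in>F. e \<in> f} = 2) \<and>
     (\<forall>v\<in>V. \<forall>e\<in>E. \<forall>e'\<in>E. v \<in> e \<longrightarrow> v \<in> e' \<longrightarrow>
        (e, e') \<in> {(x, y). x \<in> E \<and> y \<in> E \<and> v \<in> x \<and> v \<in> y \<and> x \<noteq> y \<and>
                          (\<exists>f\<in>F. x \<in> f \<and> y \<in> f)}\<^sup>*)"

type_synonym 'v flag = "'v \<times> 'v set \<times> 'v set set"

definition flags :: "'v set set set \<Rightarrow> 'v flag set" where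
  "flags F = {(v, e, f). f \<in> F \<and> e \<in> f \<and> v \<in> e}"

definition differs_exactly :: "nat \<Rightarrow> 'v flag \<Rightarrow> 'v flag \<Rightarrow> bool" where
  "differs_exactly i \<Phi> \<Psi> \<longleftrightarrow>
     (case (\<Phi>, \<Psi>) of ((v, e, f), (v', e', f')) \<Rightarrow>
        (if i = 0 then v \<noteq> v' \<and> e = e' \<and> f = f'
         else if i = 1 then v = v' \<and> e \<noteq> e' \<and> f = f'
         else v = v' \<and> e = e' \<and> f \<noteq> f'))"

text \<open>The flag \<Phi>^i.\<close>
definition flag_adj :: "'v set set set \<Rightarrow> nat \<Rightarrow> 'v flag \<Rightarrow> 'v flag" where
  "flag_adj F i \<Phi> = (THE \<Psi>. \<Psi> \<in> flags F \<and> differs_exactly i \<Phi> \<Psi>)"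

definition map_aut :: "'v set \<Rightarrow> 'v set set \<Rightarrow> 'v set set set \<Rightarrow> ('v \<Rightarrow> 'v) \<Rightarrow> bool" where
  "map_aut V E F \<sigma> \<longleftrightarrow> graph_aut V E \<sigma> \<and> (\<lambda>f. (\<lambda>e. \<sigma> ` e) ` f) ` F = F"

definition flag_act :: "('v \<Rightarrow> 'v) \<Rightarrow> 'v flag \<Rightarrow> 'v flag" where
  "flag_act \<sigma> \<Phi> = (case \<Phi> of (v, e, f) \<Rightarrow> (\<sigma> v, \<sigma> ` e, (\<lambda>e. \<sigma> ` e) ` f))"

definition same_orbit :: "'v set \<Rightarrow> 'v set set \<Rightarrow> 'v set set set \<Rightarrow> 'v flag \<Rightarrow> 'v flag \<Rightarrow> bool" where
  "same_orbit V E F \<Phi> \<Psi> \<longleftrightarrow> (\<exists>\<sigma>. map_aut V E F \<sigma> \<and> flag_act \<sigma> \<Phi> = \<Psi>)"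

definition flag_orbits :: "'v set \<Rightarrow> 'v set set \<Rightarrow> 'v set set set \<Rightarrow> 'v flag set set" where
  "flag_orbits V E F = (\<lambda>\<Phi>. {\<Psi> \<in> flags F. same_orbit V E F \<Phi> \<Psi>}) ` flags F"

text \<open>Map (with underlying graph (V,E) and face set F) of class 2_{0,1}.\<close>
definition class_2_01 :: "'v set \<Rightarrow> 'v set set \<Rightarrow> 'v set set set \<Rightarrow> bool" where
  "class_2_01 V E F \<longleftrightarrow> polytopal_map V E F \<and> card (flag_orbits V E F) = 2 \<and>
     (\<forall>\<Phi>\<in>flags F. same_orbit V E F \<Phi> (flag_adj F 0 \<Phi>) \<and>
                   same_orbit V E F \<Phi> (flag_adj F 1 \<Phi>) \<and>
                   \<not> same_orbit V E F \<Phi> (flag_adj F 2 \<Phi>))"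

text \<open>Isomorphism of two maps with the same underlying graph (V,E).\<close>
definition map_iso :: "'v set \<Rightarrow> 'v set set \<Rightarrow> 'v set set set \<Rightarrow> 'v set set set \<Rightarrow> bool" where
  "map_iso V E F1 F2 \<longleftrightarrow> (\<exists>\<sigma>. graph_aut V E \<sigma> \<and> (\<lambda>f. (\<lambda>e. \<sigma> ` e) ` f) ` F1 = F2)"

end

theory Submission
  imports Defs "HOL-Library.Function_Algebras"
begin

text \<open>
  The graph is bipartite and carries a proper 4-edge-colouring which every automorphism preserves up
  to one global permutation of the colours. For $r = 1$ it is a quotient of the square grid; the colour
  of an edge is its compass direction seen from its even end. For $r = m - 1$ the same colours work on a
  double cover of such a quotient in which going once around a unit square changes the sheet. In
  both cases the vertices are integer vectors counting the (signed) colours along a walk, modulo a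
  lattice, and the colouring is recovered from the short cycles, that is, from the short vectors
  of the lattice.

  If $b^2 \equiv 1$, the colour permutations that occur are exactly the four elements of the Klein
  four-group. In a map of class $2_{\{0,1\}}$ the automorphism carrying $\Phi$ to $\Phi^0$ fixes
  a colour, hence all colours, so the two colours at a corner of a face persist along
  the face: every face is a two-coloured cycle. Four of the six colour pairs occur at each
  vertex and the omitted two form a perfect matching of the colours. The three matchings yield the
  three maps; they are not isomorphic as the Klein group fixes every matching.

  If $b^2 \equiv -1$, a map of class $2_{\{0,1\}}$ would make some vertex stabiliser contain a
  reflection of the grid in a diagonal direction, which does not preserve the lattice.
\<close>

section \<open>Colours and four-edge-coloured graphs\<close>

text \<open>What has to be excluded is that an automorphism permutes the colours differently at
  different vertices. If \<open>r = 1\<close>, or if \<open>b\<close> is 1 or -1 modulo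
  \<open>m\<close>, the lattice has vectors of length 4, and the resulting 4-cycles carry colours
  across an edge. Otherwise the lattice has in general no nonzero vector of length at most 6; the
  6-cycles then all come from commuting translations, \<open>j - i + k = k - i + j\<close>, and they
  tell \<open>j = k\<close> from \<open>j \<noteq> k\<close>. The exception is \<open>m = 10\<close>
  with \<open>b = 3\<close> or \<open>b = 7\<close>, caused by 1 + 4 = 5 = m/2. There b^2 is -1, so
  only nonexistence is at stake, and an explicit holonomy computation settles it.

  A colour permutation is forced into the Klein group by orders: for a matching \<open>d\<close>,
  the alternating word \<open>a\<close>, \<open>b\<close>, \<open>d \<oplus> a\<close>,
  \<open>d \<oplus> b\<close> has an order in the quotient that depends on \<open>d\<close> alone.
  For b^2 = 1 modulo \<open>m\<close> the three orders are distinct, so each of the three matchings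
  is preserved, and a permutation preserving all three is a translation.\<close>

datatype colour = East | North | West | South

lemma all_colour: "(\<forall>i. P i) \<longleftrightarrow> P East \<and> P North \<and> P West \<and> P South"
  by (metis colour.exhaust)

lemma ex_colour: "(\<exists>i. P i) \<longleftrightarrow> P East \<or> P North \<or> P West \<or> P South"
  by (metis colour.exhaust)

lemma UNIV_colour: "UNIV = {East, North, West, South}"
  using colour.exhaust by auto

instance colour :: finite
  by standard (simp add: UNIV_colour)

text \<open>The colours form a Klein four-group with neutral element \<open>East\<close>. An element \<open>d\<close> other than
  \<open>East\<close> encodes the perfect matching that pairs each colour \<open>i\<close> with \<open>d \<oplus> i\<close>.\<close>

fun kadd :: "colour \<Rightarrow> colour \<Rightarrow> colour" (infixl "\<oplus>" 65) where
  "East \<oplus> j = j"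
| "i \<oplus> East = i"
| "North \<oplus> North = East"
| "North \<oplus> West = South"
| "North \<oplus> South = West"
| "West \<oplus> North = South"
| "West \<oplus> West = East"
| "West \<oplus> South = North"
| "South \<oplus> North = West"
| "South \<oplus> West = North"
| "South \<oplus> South = East"

lemma kadd_assoc: "i \<oplus> j \<oplus> k = i \<oplus> (j \<oplus> k)"
  by (cases i; cases j; cases k) simp_all

lemma kadd_commute: "i \<oplus> j = j \<oplus> i"
  by (cases i; cases j) simp_all

lemma kadd_East [simp]: "i \<oplus> East = i"
  by (cases i) simp_all

lemma kadd_self [simp]: "i \<oplus> i = East"
  by (cases i) simp_all

lemma kadd_self_left [simp]: "i \<oplus> (i \<oplus> j) = j"
  by (simp flip: kadd_assoc)

lemma kadd_left_cancel [simp]: "i \<oplus> j = i \<oplus> k \<longleftrightarrow> j = k"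
  by (metis kadd_self_left)

lemma kadd_eq_right [simp]: "i \<oplus> j = j \<longleftrightarrow> i = East"
  by (cases i; cases j) simp_all

lemma kadd_eq_left [simp]: "i \<oplus> j = i \<longleftrightarrow> j = East"
  by (cases i; cases j) simp_all

lemma kadd_eq_right' [simp]: "j = i \<oplus> j \<longleftrightarrow> i = East"
  by (metis kadd_eq_right)

lemma kadd_eq_left' [simp]: "i = i \<oplus> j \<longleftrightarrow> j = East"
  by (metis kadd_eq_left)

lemma kadd_eq_East [simp]: "i \<oplus> j = East \<longleftrightarrow> i = j"
  by (cases i; cases j) simp_all

lemma East_eq_kadd [simp]: "East = i \<oplus> j \<longleftrightarrow> i = j"
  by (metis kadd_eq_East)

lemma bij_kadd: "bij ((\<oplus>) d)"
  by (rule involuntory_imp_bij) simp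

section \<open>Proper 4-edge-colourings, given by four fixed-point-free involutions\<close>

definition colour_edges :: "'v set \<Rightarrow> (colour \<Rightarrow> 'v \<Rightarrow> 'v) \<Rightarrow> 'v set set" where
  "colour_edges V s = {{v, s i v} | v i. v \<in> V}"

locale four_coloured =
  fixes V :: "'v set" and s :: "colour \<Rightarrow> 'v \<Rightarrow> 'v"
  assumes finV: "finite V"
    and s_in [simp]: "v \<in> V \<Longrightarrow> s i v \<in> V"
    and s_s [simp]: "v \<in> V \<Longrightarrow> s i (s i v) = v"
    and s_neq [simp]: "v \<in> V \<Longrightarrow> s i v \<noteq> v"
    and s_inj [simp]: "v \<in> V \<Longrightarrow> s i v = s j v \<longleftrightarrow> i = j"
    and conn: "connected_graph V (colour_edges V s)"
begin

lemma s_neq' [simp]: "v \<in> V \<Longrightarrow> v \<noteq> s i v"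
  using s_neq by metis

lemma s_s_eq [simp]: "v \<in> V \<Longrightarrow> s j (s i v) = v \<longleftrightarrow> i = j"
  by (metis s_in s_inj s_s)

lemma s_s_eq' [simp]: "v \<in> V \<Longrightarrow> v = s j (s i v) \<longleftrightarrow> i = j"
  by (metis s_s_eq)

abbreviation E :: "'v set set" where "E \<equiv> colour_edges V s"

definition ed :: "'v \<Rightarrow> colour \<Rightarrow> 'v set" where "ed v i = {v, s i v}"

lemma E_eq: "E = {ed v i | v i. v \<in> V}"
  by (simp add: colour_edges_def ed_def)

lemma ed_in [simp]: "v \<in> V \<Longrightarrow> ed v i \<in> E"
  by (auto simp: E_eq)

lemma ed_s [simp]: "v \<in> V \<Longrightarrow> ed (s i v) i = ed v i"
  by (auto simp: ed_def)

lemma in_ed [simp]: "v \<in> ed v i" "s i v \<in> ed v i"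
  by (auto simp: ed_def)

lemma ed_inj [simp]: "v \<in> V \<Longrightarrow> ed v i = ed v j \<longleftrightarrow> i = j"
  by (auto simp: ed_def doubleton_eq_iff)

lemma edge_at:
  assumes "e \<in> E" "v \<in> e"
  obtains i where "v \<in> V" "e = ed v i"
proof -
  from assms(1) obtain u i where ui: "u \<in> V" "e = ed u i" by (auto simp: E_eq)
  with assms(2) have "v = u \<or> v = s i u" by (auto simp: ed_def)
  then have "v \<in> V \<and> e = ed v i" using ui by auto
  with that show thesis by blast
qed

lemma ed_at: "\<lbrakk>u \<in> V; v \<in> ed u i\<rbrakk> \<Longrightarrow> v \<in> V \<and> ed u i = ed v i \<and> (v = u \<or> v = s i u)"
  by (auto simp: ed_def)

lemma ed_eq_iff: "\<lbrakk>u \<in> V; v \<in> V\<rbrakk> \<Longrightarrow> ed u i = ed v j \<longleftrightarrow> i = j \<and> (u = v \<or> u = s i v)"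
  by (metis ed_at ed_inj ed_s in_ed(1))

lemma nbr_iff: "{u, v} \<in> E \<longleftrightarrow> u \<in> V \<and> (\<exists>i. v = s i u)"
proof
  assume "{u, v} \<in> E"
  then obtain i where i: "u \<in> V" "{u, v} = ed u i" using edge_at by (metis insertI1)
  then show "u \<in> V \<and> (\<exists>i. v = s i u)" by (auto simp: ed_def doubleton_eq_iff)
qed (auto simp: E_eq ed_def)

lemma simpleE: "simple_graph V E"
  unfolding simple_graph_def
proof (intro conjI ballI)
  fix e assume "e \<in> E"
  then obtain u i where "u \<in> V" "e = ed u i" by (auto simp: E_eq)
  then show "\<exists>u v. e = {u, v} \<and> u \<noteq> v \<and> u \<in> V \<and> v \<in> V"
    by (metis ed_def s_in s_neq)
qed (rule finV)

lemma conn_induct [consumes 2, case_names base step]: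
  assumes "u \<in> V" "v \<in> V" and "Q u" and step: "\<And>x i. \<lbrakk>x \<in> V; Q x\<rbrakk> \<Longrightarrow> Q (s i x)"
  shows "Q v"
proof -
  have "(u, v) \<in> {(x, y). {x, y} \<in> E}\<^sup>*"
    using conn assms(1,2) by (simp add: connected_graph_def)
  then show ?thesis
  proof (induction rule: rtrancl_induct)
    case (step y z)
    then show ?case using assms(4) by (auto simp: nbr_iff)
  qed (rule assms)
qed

lemma V_ne: "V \<noteq> {}"
  using conn by (simp add: connected_graph_def)

lemma graph_aut_in: "\<lbrakk>graph_aut V E \<sigma>; v \<in> V\<rbrakk> \<Longrightarrow> \<sigma> v \<in> V"
  by (auto simp: graph_aut_def bij_betw_def)

lemma graph_aut_inj: "\<lbrakk>graph_aut V E \<sigma>; u \<in> V; v \<in> V\<rbrakk> \<Longrightarrow> \<sigma> u = \<sigma> v \<longleftrightarrow> u = v"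
  by (auto simp: graph_aut_def bij_betw_def inj_on_def)

lemma graph_aut_edge:
  "\<lbrakk>graph_aut V E \<sigma>; u \<in> V; v \<in> V\<rbrakk> \<Longrightarrow> {\<sigma> u, \<sigma> v} \<in> E \<longleftrightarrow> {u, v} \<in> E"
  by (auto simp: graph_aut_def)

text \<open>Here the permutation may depend on the vertex; \<open>colour_aut\<close> below asks for
  one that serves all vertices.\<close>

lemma graph_aut_local:
  assumes "graph_aut V E \<sigma>" "v \<in> V"
  obtains \<pi> where "bij \<pi>" "\<And>i. \<sigma> (s i v) = s (\<pi> i) (\<sigma> v)"
proof -
  have "\<exists>j. \<sigma> (s i v) = s j (\<sigma> v)" for i
  proof -
    have "{v, s i v} \<in> E" using assms(2) by (auto simp: nbr_iff)
    then have "{\<sigma> v, \<sigma> (s i v)} \<in> E"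
      using assms by (auto simp: graph_aut_edge)
    then show ?thesis by (auto simp: nbr_iff)
  qed
  then obtain \<pi> where \<pi>: "\<And>i. \<sigma> (s i v) = s (\<pi> i) (\<sigma> v)" by metis
  have "inj \<pi>"
  proof (rule injI)
    fix i j assume "\<pi> i = \<pi> j"
    then have "\<sigma> (s i v) = \<sigma> (s j v)" by (simp add: \<pi>)
    then show "i = j" using assms by (simp add: graph_aut_inj)
  qed
  then have "bij \<pi>" by (simp add: bij_def finite_UNIV_inj_surj)
  with \<pi> that show thesis by blast
qed

definition colour_aut :: "(colour \<Rightarrow> colour) \<Rightarrow> ('v \<Rightarrow> 'v) \<Rightarrow> bool" where
  "colour_aut \<pi> \<sigma> \<longleftrightarrow> bij \<pi> \<and> bij_betw \<sigma> V V \<and> (\<forall>v\<in>V. \<forall>i. \<sigma> (s i v) = s (\<pi> i) (\<sigma> v))"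

lemma colour_aut_in: "\<lbrakk>colour_aut \<pi> \<sigma>; v \<in> V\<rbrakk> \<Longrightarrow> \<sigma> v \<in> V"
  by (auto simp: colour_aut_def bij_betw_def)

lemma colour_aut_s: "\<lbrakk>colour_aut \<pi> \<sigma>; v \<in> V\<rbrakk> \<Longrightarrow> \<sigma> (s i v) = s (\<pi> i) (\<sigma> v)"
  by (auto simp: colour_aut_def)

lemma colour_aut_graph_aut:
  assumes "colour_aut \<pi> \<sigma>"
  shows "graph_aut V E \<sigma>"
  unfolding graph_aut_def
proof (intro conjI ballI)
  show bij: "bij_betw \<sigma> V V" using assms by (simp add: colour_aut_def)
  fix u v assume uv: "u \<in> V" "v \<in> V"
  show "{u, v} \<in> E \<longleftrightarrow> {\<sigma> u, \<sigma> v} \<in> E"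
  proof
    assume "{u, v} \<in> E"
    then show "{\<sigma> u, \<sigma> v} \<in> E"
      using assms uv by (auto simp: nbr_iff colour_aut_s colour_aut_in)
  next
    assume "{\<sigma> u, \<sigma> v} \<in> E"
    then obtain j where j: "\<sigma> v = s j (\<sigma> u)" by (auto simp: nbr_iff)
    obtain i where "j = \<pi> i" using assms by (metis bij_pointE colour_aut_def)
    with j have "\<sigma> v = \<sigma> (s i u)" using assms uv by (simp add: colour_aut_s)
    then have "v = s i u" using bij uv by (auto simp: bij_betw_def inj_on_def)
    then show "{u, v} \<in> E" using uv by (auto simp: nbr_iff)
  qed
qed

lemma colour_aut_comp:
  assumes "colour_aut \<pi> \<sigma>" "colour_aut \<rho> \<tau>"
  shows "colour_aut (\<pi> \<circ> \<rho>) (\<sigma> \<circ> \<tau>)"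
  using assms by (auto simp: colour_aut_def intro: bij_comp bij_betw_trans)
    (metis bij_betw_apply)

section \<open>Two-coloured cycles and the maps they form\<close>

inductive_set orb :: "colour \<Rightarrow> colour \<Rightarrow> 'v \<Rightarrow> 'v set" for i j v where
  base: "v \<in> orb i j v"
| left: "u \<in> orb i j v \<Longrightarrow> s i u \<in> orb i j v"
| right: "u \<in> orb i j v \<Longrightarrow> s j u \<in> orb i j v"

text \<open>The edge set of the component of \<open>v\<close> in the subgraph of the colours
  \<open>i\<close> and \<open>j\<close>. Taking a component instead of a sequence of edges avoids
  fixing a length or a starting point.\<close>

definition bicycle :: "colour \<Rightarrow> colour \<Rightarrow> 'v \<Rightarrow> 'v set set" where
  "bicycle i j v = {ed u k | u k. u \<in> orb i j v \<and> k \<in> {i, j}}"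

lemma orb_in: "\<lbrakk>u \<in> orb i j v; v \<in> V\<rbrakk> \<Longrightarrow> u \<in> V"
  by (induction rule: orb.induct) auto

lemma orb_commute: "orb i j v = orb j i v"
proof -
  have "u \<in> orb j i v" if "u \<in> orb i j v" for i j u
    using that by (induction rule: orb.induct) (auto intro: orb.intros)
  then show ?thesis by blast
qed

lemma orb_trans: "\<lbrakk>w \<in> orb i j u; u \<in> orb i j v\<rbrakk> \<Longrightarrow> w \<in> orb i j v"
  by (induction rule: orb.induct) (auto intro: orb.intros)

lemma orb_sym: "\<lbrakk>u \<in> orb i j v; v \<in> V\<rbrakk> \<Longrightarrow> v \<in> orb i j u"
proof (induction rule: orb.induct)
  case (left u)
  have "s i (s i u) \<in> orb i j (s i u)" by (intro orb.intros)
  then have "u \<in> orb i j (s i u)" using s_s[OF orb_in[OF left.hyps left.prems]] by simp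
  then show ?case using left.IH[OF left.prems] by (rule orb_trans[rotated])
next
  case (right u)
  have "s j (s j u) \<in> orb i j (s j u)" by (intro orb.intros)
  then have "u \<in> orb i j (s j u)" using s_s[OF orb_in[OF right.hyps right.prems]] by simp
  then show ?case using right.IH[OF right.prems] by (rule orb_trans[rotated])
qed (rule orb.base)

lemma orb_eq: "\<lbrakk>u \<in> orb i j v; v \<in> V\<rbrakk> \<Longrightarrow> orb i j u = orb i j v"
  using orb_sym orb_trans by blast

lemma bicycle_commute: "bicycle i j v = bicycle j i v"
  by (simp add: bicycle_def orb_commute insert_commute)

lemma bicycle_eq: "\<lbrakk>u \<in> orb i j v; v \<in> V\<rbrakk> \<Longrightarrow> bicycle i j u = bicycle i j v"
  by (simp add: bicycle_def orb_eq)

lemma ed_bicycle_iff: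
  assumes "u \<in> V" "v \<in> V"
  shows "ed u k \<in> bicycle i j v \<longleftrightarrow> u \<in> orb i j v \<and> k \<in> {i, j}"
proof
  assume "ed u k \<in> bicycle i j v"
  then obtain w l where w: "ed u k = ed w l" "w \<in> orb i j v" "l \<in> {i, j}"
    by (auto simp: bicycle_def)
  with assms orb_in have "k = l" "u = w \<or> u = s k w" by (auto simp: ed_eq_iff)
  with w show "u \<in> orb i j v \<and> k \<in> {i, j}" by (auto intro: orb.intros)
qed (auto simp: bicycle_def)

lemma bicycle_subset: "v \<in> V \<Longrightarrow> bicycle i j v \<subseteq> E"
  using orb_in by (auto simp: bicycle_def)

text \<open>Each vertex of the component lies on one edge of either colour. The bound 3 comes from
  \<open>ed v i\<close>, \<open>ed v j\<close> and \<open>ed (s i v) j\<close>; the last two differ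
  because \<open>s i v\<close> is neither \<open>v\<close> nor \<open>s j v\<close>.\<close>

lemma is_cycle_bicycle:
  assumes v: "v \<in> V" and ij: "i \<noteq> j"
  shows "is_cycle E (bicycle i j v)"
  unfolding is_cycle_def
proof (intro conjI ballI)
  let ?C = "bicycle i j v"
  show "?C \<subseteq> E" by (rule bicycle_subset[OF v])
  have "finite E" using simpleE finV
    by (auto simp: simple_graph_def intro!: finite_subset[of E "Pow V"])
  with \<open>?C \<subseteq> E\<close> show fin: "finite ?C" by (rule finite_subset)
  have "ed v i \<in> ?C" "ed v j \<in> ?C" "ed (s i v) j \<in> ?C"
    by (auto simp: bicycle_def intro: orb.intros)
  moreover have "ed v i \<noteq> ed (s i v) j" "ed v j \<noteq> ed (s i v) j"
    using v ij by (auto simp: ed_eq_iff)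
  ultimately have "card {ed v i, ed v j, ed (s i v) j} \<le> card ?C"
    by (intro card_mono fin) auto
  moreover have "card {ed v i, ed v j, ed (s i v) j} = 3"
    using \<open>ed v i \<noteq> ed (s i v) j\<close> \<open>ed v j \<noteq> ed (s i v) j\<close> v ij by simp
  ultimately show "3 \<le> card ?C" by simp
next
  fix u assume "u \<in> \<Union> (bicycle i j v)"
  then obtain w k where w: "u \<in> ed w k" "w \<in> orb i j v" "k \<in> {i, j}"
    by (auto simp: bicycle_def)
  have u: "u \<in> V" "u \<in> orb i j v"
    using ed_at[of w u k] w orb_in[OF w(2) v] by (auto intro: orb.intros)
  have "{e \<in> bicycle i j v. u \<in> e} = {ed u i, ed u j}"
  proof (intro subset_antisym subsetI)
    fix e assume e: "e \<in> {e \<in> bicycle i j v. u \<in> e}"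
    then obtain k where "e = ed u k" using bicycle_subset[OF v, of i j] edge_at by blast
    with e show "e \<in> {ed u i, ed u j}" using u v by (auto simp: ed_bicycle_iff)
  qed (use u v in \<open>auto simp: ed_bicycle_iff\<close>)
  then show "card {e \<in> bicycle i j v. u \<in> e} = 2" using u ij by simp
next
  fix e e' assume e: "e \<in> bicycle i j v" "e' \<in> bicycle i j v"
  let ?R = "{(x, y). x \<in> bicycle i j v \<and> y \<in> bicycle i j v \<and> x \<inter> y \<noteq> {}}"
  have symR: "sym ?R" by (auto simp: sym_def)
  have step: "(ed u k, ed u l) \<in> ?R" if "u \<in> orb i j v" "k \<in> {i, j}" "l \<in> {i, j}" for u k l
  proof -
    have "ed u k \<in> bicycle i j v" "ed u l \<in> bicycle i j v"
      using that unfolding bicycle_def by blast+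
    moreover have "u \<in> ed u k \<inter> ed u l" by simp
    ultimately show ?thesis by blast
  qed
  have reach: "\<forall>k\<in>{i, j}. (ed v i, ed u k) \<in> ?R\<^sup>*" if "u \<in> orb i j v" for u
    using that
  proof (induction rule: orb.induct)
    case base
    show ?case using step[OF orb.base] by blast
  next
    case (left u)
    then have "ed (s i u) i = ed u i" using orb_in[OF left.hyps v] by simp
    with left.IH have 1: "(ed v i, ed (s i u) i) \<in> ?R\<^sup>*" by (simp only: ball_simps)
    have 2: "(ed (s i u) i, ed (s i u) j) \<in> ?R"
      by (rule step) (auto intro: orb.intros left.hyps)
    show ?case using 1 rtrancl_into_rtrancl[OF 1 2] by (simp only: ball_simps)
  next
    case (right u)
    then have "ed (s j u) j = ed u j" using orb_in[OF right.hyps v] by simp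
    with right.IH have 1: "(ed v i, ed (s j u) j) \<in> ?R\<^sup>*" by (simp only: ball_simps)
    have 2: "(ed (s j u) j, ed (s j u) i) \<in> ?R"
      by (rule step) (auto intro: orb.intros right.hyps)
    show ?case using 1 rtrancl_into_rtrancl[OF 1 2] by (simp only: ball_simps)
  qed
  have "(ed v i, e) \<in> ?R\<^sup>*" "(ed v i, e') \<in> ?R\<^sup>*"
    using e reach by (auto simp: bicycle_def)
  then show "(e, e') \<in> ?R\<^sup>*"
    using sym_rtrancl[OF symR] by (meson rtrancl_trans symD)
qed

text \<open>The omitted colour pairs are those of the matching \<open>d\<close>.\<close>

definition bimap :: "colour \<Rightarrow> 'v set set set" where
  "bimap d = {bicycle i j v | i j v. v \<in> V \<and> i \<noteq> j \<and> j \<noteq> d \<oplus> i}"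

abbreviation fim :: "('v \<Rightarrow> 'v) \<Rightarrow> 'v set set \<Rightarrow> 'v set set" where
  "fim \<sigma> f \<equiv> (\<lambda>e. \<sigma> ` e) ` f"

lemma image_ed: "\<lbrakk>colour_aut \<pi> \<sigma>; v \<in> V\<rbrakk> \<Longrightarrow> \<sigma> ` ed v i = ed (\<sigma> v) (\<pi> i)"
  by (simp add: ed_def colour_aut_s)

lemma image_orb:
  assumes a: "colour_aut \<pi> \<sigma>" and v: "v \<in> V"
  shows "\<sigma> ` orb i j v = orb (\<pi> i) (\<pi> j) (\<sigma> v)"
proof (intro subset_antisym subsetI)
  fix w assume "w \<in> \<sigma> ` orb i j v"
  then obtain u where "u \<in> orb i j v" "w = \<sigma> u" by blast
  moreover from this(1) have "\<sigma> u \<in> orb (\<pi> i) (\<pi> j) (\<sigma> v)"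
  proof (induction rule: orb.induct)
    case base
    show ?case by (rule orb.base)
  next
    case (left u)
    then show ?case
      using colour_aut_s[OF a orb_in[OF left.hyps v], of i] orb.left by fastforce
  next
    case (right u)
    then show ?case
      using colour_aut_s[OF a orb_in[OF right.hyps v], of j] orb.right by fastforce
  qed
  ultimately show "w \<in> orb (\<pi> i) (\<pi> j) (\<sigma> v)" by simp
next
  fix w assume "w \<in> orb (\<pi> i) (\<pi> j) (\<sigma> v)"
  then show "w \<in> \<sigma> ` orb i j v"
  proof (induction rule: orb.induct)
    case base
    show ?case by (blast intro: orb.base)
  next
    case (left w)
    then obtain u where u: "u \<in> orb i j v" "w = \<sigma> u" by blast
    then have "s (\<pi> i) w = \<sigma> (s i u)" using colour_aut_s[OF a orb_in[OF u(1) v]] by simp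
    with u(1) show ?case by (blast intro: orb.left)
  next
    case (right w)
    then obtain u where u: "u \<in> orb i j v" "w = \<sigma> u" by blast
    then have "s (\<pi> j) w = \<sigma> (s j u)" using colour_aut_s[OF a orb_in[OF u(1) v]] by simp
    with u(1) show ?case by (blast intro: orb.right)
  qed
qed

lemma image_bicycle:
  assumes a: "colour_aut \<pi> \<sigma>" and v: "v \<in> V"
  shows "fim \<sigma> (bicycle i j v) = bicycle (\<pi> i) (\<pi> j) (\<sigma> v)"
proof -
  have "bicycle i j v = (\<Union>u\<in>orb i j v. ed u ` {i, j})" for i j v
    by (auto simp: bicycle_def)
  then have "fim \<sigma> (bicycle i j v) = (\<Union>u\<in>orb i j v. (\<lambda>k. \<sigma> ` ed u k) ` {i, j})"
    by (simp add: image_UN image_image)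
  also have "\<dots> = (\<Union>u\<in>orb i j v. ed (\<sigma> u) ` {\<pi> i, \<pi> j})"
    using image_ed[OF a orb_in[OF _ v]] by (intro SUP_cong) auto
  also have "\<dots> = (\<Union>u\<in>\<sigma> ` orb i j v. ed u ` {\<pi> i, \<pi> j})" by simp
  also have "\<dots> = bicycle (\<pi> i) (\<pi> j) (\<sigma> v)"
    unfolding image_orb[OF assms] by (auto simp: bicycle_def)
  finally show ?thesis .
qed

text \<open>The condition \<open>j \<noteq> d \<oplus> i\<close> means
  \<open>i \<oplus> j \<noteq> d\<close>, and a translation does not change
  \<open>i \<oplus> j\<close>.\<close>

lemma image_bimap:
  assumes a: "colour_aut ((\<oplus>) c) \<sigma>"
  shows "fim \<sigma> ` bimap d = bimap d"
proof (intro subset_antisym subsetI)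
  fix f assume "f \<in> fim \<sigma> ` bimap d"
  then obtain i j v where f: "f = fim \<sigma> (bicycle i j v)" "v \<in> V" "i \<noteq> j" "j \<noteq> d \<oplus> i"
    by (auto simp: bimap_def)
  have "f = bicycle (c \<oplus> i) (c \<oplus> j) (\<sigma> v)" using f(1) image_bicycle[OF a f(2)] by simp
  moreover have "c \<oplus> j \<noteq> d \<oplus> (c \<oplus> i)" using f(4) by (metis kadd_assoc kadd_commute kadd_left_cancel)
  ultimately show "f \<in> bimap d" using f colour_aut_in[OF a f(2)] unfolding bimap_def
    by (auto intro!: exI)
next
  fix f assume "f \<in> bimap d"
  then obtain i j v where f: "f = bicycle i j v" "v \<in> V" "i \<noteq> j" "j \<noteq> d \<oplus> i"
    by (auto simp: bimap_def)
  obtain u where u: "u \<in> V" "v = \<sigma> u"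
    using a f(2) unfolding colour_aut_def bij_betw_def by blast
  have "f = fim \<sigma> (bicycle (c \<oplus> i) (c \<oplus> j) u)"
    using f(1) image_bicycle[OF a u(1)] u(2) by simp
  moreover have "c \<oplus> j \<noteq> d \<oplus> (c \<oplus> i)" using f(4) by (metis kadd_assoc kadd_commute kadd_left_cancel)
  then have "bicycle (c \<oplus> i) (c \<oplus> j) u \<in> bimap d"
    using f u unfolding bimap_def by (auto intro!: exI)
  ultimately show "f \<in> fim \<sigma> ` bimap d" by blast
qed

lemma map_aut_bimap: "colour_aut ((\<oplus>) c) \<sigma> \<Longrightarrow> map_aut V E (bimap d) \<sigma>"
  by (simp add: map_aut_def colour_aut_graph_aut image_bimap)

lemma bimap_face_at:
  assumes "f \<in> bimap d" "ed v i \<in> f" "v \<in> V"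
  obtains j where "f = bicycle i j v" "i \<noteq> j" "j \<noteq> d \<oplus> i"
proof -
  obtain a b u where f: "f = bicycle a b u" "u \<in> V" "a \<noteq> b" "b \<noteq> d \<oplus> a"
    using assms(1) by (auto simp: bimap_def)
  with assms have *: "v \<in> orb a b u" "i \<in> {a, b}" by (auto simp: ed_bicycle_iff)
  have "a \<noteq> d \<oplus> b" using f(4) by auto
  have ab: "f = bicycle a b v" using f(1) bicycle_eq[OF *(1) f(2)] by simp
  show thesis
  proof (cases "i = a")
    case True
    with that[of b] ab f show thesis by simp
  next
    case False
    with * have "i = b" by simp
    with that[of a] ab f(3) \<open>a \<noteq> d \<oplus> b\<close> show thesis by (metis bicycle_commute)
  qed
qed

lemma bicycle_in_bimap: "\<lbrakk>v \<in> V; i \<noteq> j; j \<noteq> d \<oplus> i\<rbrakk> \<Longrightarrow> bicycle i j v \<in> bimap d"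
  by (auto simp: bimap_def)

lemma ed_bicycle [simp]: "v \<in> V \<Longrightarrow> ed v k \<in> bicycle i j v \<longleftrightarrow> k \<in> {i, j}"
  using orb.base by (simp add: ed_bicycle_iff)

lemma bicycle_inj: "\<lbrakk>v \<in> V; i \<noteq> j; bicycle i j v = bicycle i k v\<rbrakk> \<Longrightarrow> j = k"
  using ed_bicycle[of v j i k] ed_bicycle[of v j i j] by auto

text \<open>The matching can be read off from the map: the pair of \<open>East\<close> and
  \<open>d'\<close> bounds no face of \<open>bimap d'\<close>, but it bounds one of
  \<open>bimap d\<close> for every other \<open>d\<close>.\<close>

lemma bimap_inj:
  assumes "bimap d = bimap d'" "d' \<noteq> East"
  shows "d = d'"
proof (rule ccontr)
  assume "d \<noteq> d'"
  obtain v where v: "v \<in> V" using V_ne by blast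
  have "bicycle East d' v \<in> bimap d" using \<open>d \<noteq> d'\<close> assms(2) v by (intro bicycle_in_bimap) auto
  with assms(1) have "bicycle East d' v \<in> bimap d'" by simp
  then obtain j where j: "bicycle East d' v = bicycle East j v" "j \<noteq> d' \<oplus> East"
    using bimap_face_at v ed_bicycle by (metis insertI1)
  then show False using bicycle_inj[of v East d' j] v assms(2) by auto
qed

lemma other_colours:
  fixes i d :: colour
  assumes "d \<noteq> East"
  obtains j k where "j \<noteq> k" "\<And>l. (l \<noteq> i \<and> l \<noteq> d \<oplus> i) \<longleftrightarrow> l = j \<or> l = k"
proof -
  have "\<exists>j k. j \<noteq> k \<and> (\<forall>l. (l \<noteq> i \<and> l \<noteq> d \<oplus> i) \<longleftrightarrow> l = j \<or> l = k)"
    using assms by (cases i; cases d) (simp_all add: all_colour ex_colour)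
  with that show thesis by blast
qed

lemma bimap_faces_at:
  assumes "v \<in> V"
  shows "{f \<in> bimap d. ed v i \<in> f} = {bicycle i j v | j. j \<noteq> i \<and> j \<noteq> d \<oplus> i}"
proof (intro subset_antisym subsetI)
  fix f assume "f \<in> {f \<in> bimap d. ed v i \<in> f}"
  then obtain j where "f = bicycle i j v" "i \<noteq> j" "j \<noteq> d \<oplus> i"
    using bimap_face_at assms by (metis (mono_tags, lifting) mem_Collect_eq)
  then show "f \<in> {bicycle i j v | j. j \<noteq> i \<and> j \<noteq> d \<oplus> i}" by auto
next
  fix f assume "f \<in> {bicycle i j v | j. j \<noteq> i \<and> j \<noteq> d \<oplus> i}"
  then show "f \<in> {f \<in> bimap d. ed v i \<in> f}" using assms bicycle_in_bimap by auto
qed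

text \<open>The colour pairs outside a matching form a 4-cycle on the colours. This is what makes
  the faces around a vertex close up into a single cycle.\<close>

lemma corner_connected:
  fixes d :: colour
  assumes "d \<noteq> East"
  shows "(i, k) \<in> {(i, j). i \<noteq> j \<and> j \<noteq> d \<oplus> i}\<^sup>*" (is "_ \<in> ?R\<^sup>*")
proof -
  consider "k = i" | "k = d \<oplus> i" | "k \<noteq> i" "k \<noteq> d \<oplus> i" by blast
  then show ?thesis
  proof cases
    case 2
    obtain j l where "j \<noteq> l" and jl: "\<And>m. (m \<noteq> i \<and> m \<noteq> d \<oplus> i) \<longleftrightarrow> m = j \<or> m = l"
      using that by (rule other_colours[OF assms, of i])
    then have "j \<noteq> i" "j \<noteq> d \<oplus> i" by blast+
    then have "(i, j) \<in> ?R" "(j, d \<oplus> i) \<in> ?R" by auto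
    then show ?thesis using 2 by (meson converse_rtrancl_into_rtrancl r_into_rtrancl)
  qed auto
qed

lemma polytopal_bimap:
  assumes d: "d \<noteq> East"
  shows "polytopal_map V E (bimap d)"
  unfolding polytopal_map_def
proof (intro conjI ballI impI)
  show "simple_graph V E" by (rule simpleE)
  show "connected_graph V E" by (rule conn)
  show "is_cycle E f" if "f \<in> bimap d" for f
    using that by (auto simp: bimap_def is_cycle_bicycle)
  show "card {f \<in> bimap d. e \<in> f} = 2" if "e \<in> E" for e
  proof -
    obtain v i where v: "v \<in> V" "e = ed v i" using \<open>e \<in> E\<close> unfolding E_eq by blast
    obtain j k where jk: "j \<noteq> k" "\<And>l. (l \<noteq> i \<and> l \<noteq> d \<oplus> i) \<longleftrightarrow> l = j \<or> l = k"
      using that by (rule other_colours[OF d, of i])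
    have "{f \<in> bimap d. e \<in> f} = {bicycle i j v, bicycle i k v}"
      unfolding v(2) bimap_faces_at[OF v(1)] jk(2) by auto
    moreover have "i \<noteq> j" using jk(2) by blast
    then have "bicycle i j v \<noteq> bicycle i k v" using bicycle_inj v jk(1) by metis
    ultimately show ?thesis by simp
  qed
  show "(e, e') \<in> {(x, y). x \<in> E \<and> y \<in> E \<and> v \<in> x \<and> v \<in> y \<and> x \<noteq> y \<and>
                          (\<exists>f\<in>bimap d. x \<in> f \<and> y \<in> f)}\<^sup>*" (is "_ \<in> ?R\<^sup>*")
    if e: "v \<in> V" "e \<in> E" "e' \<in> E" "v \<in> e" "v \<in> e'" for v e e'
  proof -
    obtain i k where ik: "e = ed v i" "e' = ed v k" using e edge_at by metis
    have "(ed v i, ed v k) \<in> ?R\<^sup>*" using corner_connected[OF d, of i k]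
    proof (induction rule: rtrancl_induct)
      case (step j k)
      have jk: "j \<noteq> k" "k \<noteq> d \<oplus> j" using step.hyps(2) by auto
      have "\<exists>f\<in>bimap d. ed v j \<in> f \<and> ed v k \<in> f"
        by (rule bexI[OF _ bicycle_in_bimap[OF e(1) jk]]) (simp add: e(1))
      then have "(ed v j, ed v k) \<in> ?R" using e(1) jk(1) by simp
      with step.IH show ?case by (rule rtrancl_into_rtrancl)
    qed simp
    then show ?thesis by (simp add: ik)
  qed
qed

section \<open>Flags of the two-coloured maps and their orbits\<close>

definition bflag :: "colour \<Rightarrow> colour \<Rightarrow> 'v \<Rightarrow> 'v flag" where
  "bflag i j v = (v, ed v i, bicycle i j v)"

lemma flags_bimap: "flags (bimap d) = {bflag i j v | i j v. v \<in> V \<and> i \<noteq> j \<and> j \<noteq> d \<oplus> i}"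
proof (intro subset_antisym subsetI)
  fix \<Phi> assume "\<Phi> \<in> flags (bimap d)"
  then obtain v e f where vef: "\<Phi> = (v, e, f)" "f \<in> bimap d" "e \<in> f" "v \<in> e"
    by (auto simp: flags_def)
  then have "e \<in> E" using bicycle_subset by (auto simp: bimap_def)
  then obtain i where i: "v \<in> V" "e = ed v i" using edge_at vef(4) by metis
  then obtain j where "f = bicycle i j v" "i \<noteq> j" "j \<noteq> d \<oplus> i"
    using bimap_face_at vef(2,3) by metis
  with vef i show "\<Phi> \<in> {bflag i j v | i j v. v \<in> V \<and> i \<noteq> j \<and> j \<noteq> d \<oplus> i}"
    by (auto simp: bflag_def)
qed (auto simp: flags_def bflag_def bicycle_in_bimap)

lemma bflag_inj:
  assumes "v \<in> V" "i \<noteq> j" "bflag i j v = bflag i' j' v'"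
  shows "v' = v \<and> i' = i \<and> j' = j"
proof -
  have 1: "v' = v" using assms by (simp add: bflag_def)
  with assms have 2: "i' = i" by (simp add: bflag_def)
  with 1 assms bicycle_inj[of v i j j'] show ?thesis by (auto simp: bflag_def)
qed

lemma flag_act_bflag:
  "\<lbrakk>colour_aut \<pi> \<sigma>; v \<in> V\<rbrakk> \<Longrightarrow> flag_act \<sigma> (bflag i j v) = bflag (\<pi> i) (\<pi> j) (\<sigma> v)"
  by (simp add: flag_act_def bflag_def image_ed image_bicycle)

lemma flag_adj_eqI:
  assumes "\<Psi> \<in> flags F" "differs_exactly i \<Phi> \<Psi>"
    and "\<And>\<Theta>. \<lbrakk>\<Theta> \<in> flags F; differs_exactly i \<Phi> \<Theta>\<rbrakk> \<Longrightarrow> \<Theta> = \<Psi>"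
  shows "flag_adj F i \<Phi> = \<Psi>"
  unfolding flag_adj_def using assms(1,2) by (intro the_equality assms(3) conjI) ((erule conjE)?, assumption)+

lemma polytopal_corner:
  assumes P: "polytopal_map V E F" and f: "f \<in> F" "ed v i \<in> f" and v: "v \<in> V"
  obtains j where "j \<noteq> i" "\<And>k. ed v k \<in> f \<longleftrightarrow> k = i \<or> k = j"
proof -
  have cyc: "is_cycle E f" using P f by (simp add: polytopal_map_def)
  then have fE: "f \<subseteq> E" by (simp add: is_cycle_def)
  have "v \<in> \<Union> f" using f(2) in_ed(1) by blast
  moreover have "\<forall>v\<in>\<Union> f. card {e \<in> f. v \<in> e} = 2" using cyc unfolding is_cycle_def by blast
  ultimately have "card {e \<in> f. v \<in> e} = 2" by blast
  then obtain a b where ab: "{e \<in> f. v \<in> e} = {a, b}" "a \<noteq> b" by (meson card_2_iff)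
  have "a \<in> E" "b \<in> E" "v \<in> a" "v \<in> b" using ab fE by blast+
  then obtain k l where kl: "a = ed v k" "b = ed v l" using edge_at by metis
  have mem: "ed v m \<in> f \<longleftrightarrow> m = k \<or> m = l" for m
  proof -
    have "ed v m \<in> f \<longleftrightarrow> ed v m \<in> {e \<in> f. v \<in> e}" by simp
    then show ?thesis unfolding ab(1) kl using v by simp
  qed
  with f(2) have "i = k \<or> i = l" by simp
  then show thesis using that[of k] that[of l] mem ab(2) kl by blast
qed

lemma face_subset: "\<lbrakk>polytopal_map V E F; f \<in> F\<rbrakk> \<Longrightarrow> f \<subseteq> E"
  by (simp add: polytopal_map_def is_cycle_def)

lemma flag_adj_0:
  assumes P: "polytopal_map V E F" and f: "f \<in> F" "ed v i \<in> f" and v: "v \<in> V"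
  shows "flag_adj F 0 (v, ed v i, f) = (s i v, ed v i, f)"
  by (rule flag_adj_eqI) (use f v in \<open>auto simp: flags_def differs_exactly_def ed_def\<close>)

lemma flag_adj_1:
  assumes P: "polytopal_map V E F" and f: "f \<in> F" "ed v i \<in> f" "ed v j \<in> f" "i \<noteq> j"
    and v: "v \<in> V"
  shows "flag_adj F 1 (v, ed v i, f) = (v, ed v j, f)"
proof (rule flag_adj_eqI)
  fix \<Theta> assume "\<Theta> \<in> flags F" "differs_exactly 1 (v, ed v i, f) \<Theta>"
  then obtain e where e: "\<Theta> = (v, e, f)" "e \<in> f" "v \<in> e" "e \<noteq> ed v i"
    by (auto simp: flags_def differs_exactly_def)
  then obtain k where k: "e = ed v k" using face_subset[OF P f(1)] edge_at by blast
  obtain l where "\<And>k. ed v k \<in> f \<longleftrightarrow> k = i \<or> k = l" using polytopal_corner[OF P f(1,2) v] by metis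
  with e k f(3,4) have "k = j" by metis
  with e k show "\<Theta> = (v, ed v j, f)" by simp
qed (use f v in \<open>auto simp: flags_def differs_exactly_def\<close>)

text \<open>The colours outside \<open>{i, d \<oplus> i}\<close> are \<open>j\<close> and
  \<open>d \<oplus> j\<close>, so these belong to the two faces at the edge of colour
  \<open>i\<close>.\<close>

lemma flag_adj_2_bimap:
  assumes d: "d \<noteq> East" and v: "v \<in> V" and ij: "i \<noteq> j" "j \<noteq> d \<oplus> i"
  shows "flag_adj (bimap d) 2 (bflag i j v) = bflag i (d \<oplus> j) v"
proof (rule flag_adj_eqI)
  have k: "d \<oplus> j \<noteq> i" "d \<oplus> j \<noteq> d \<oplus> i" "d \<oplus> j \<noteq> j"
    using ij d by (auto simp flip: kadd_assoc)
  have all: "l \<noteq> i \<Longrightarrow> l \<noteq> d \<oplus> i \<Longrightarrow> l = j \<or> l = d \<oplus> j" for l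
    using d ij by (cases l; cases i; cases j; cases d) simp_all
  show "bflag i (d \<oplus> j) v \<in> flags (bimap d)" unfolding flags_bimap using k v by blast
  show "differs_exactly 2 (bflag i j v) (bflag i (d \<oplus> j) v)"
    using k v ij bicycle_inj[of v i j "d \<oplus> j"] by (auto simp: differs_exactly_def bflag_def)
  fix \<Theta> assume "\<Theta> \<in> flags (bimap d)" and diff: "differs_exactly 2 (bflag i j v) \<Theta>"
  then obtain a b u where t: "\<Theta> = bflag a b u" "u \<in> V" "a \<noteq> b" "b \<noteq> d \<oplus> a"
    by (auto simp: flags_bimap)
  with diff v have "u = v" "a = i" "b \<noteq> j" by (auto simp: differs_exactly_def bflag_def)
  with t all[of b] show "\<Theta> = bflag i (d \<oplus> j) v" by simp
qed

text \<open>Translations preserve the sum \<open>i \<oplus> j\<close> of the two face colours.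
  Conversely, the translation by \<open>i \<oplus> i'\<close> matches the first colours, and
  equality of the sums makes it match the second ones.\<close>

lemma same_orbit_bimap_iff:
  assumes H1: "\<forall>\<sigma>. graph_aut V E \<sigma> \<longrightarrow> (\<exists>c. colour_aut ((\<oplus>) c) \<sigma>)"
    and H2: "\<forall>u\<in>V. \<forall>v\<in>V. \<forall>c. \<exists>\<sigma>. colour_aut ((\<oplus>) c) \<sigma> \<and> \<sigma> u = v"
    and v: "u \<in> V" "v \<in> V" and ij: "i \<noteq> j" "i' \<noteq> j'"
  shows "same_orbit V E (bimap d) (bflag i j u) (bflag i' j' v) \<longleftrightarrow> i \<oplus> j = i' \<oplus> j'"
proof
  assume "same_orbit V E (bimap d) (bflag i j u) (bflag i' j' v)"
  then obtain \<sigma> where \<sigma>: "graph_aut V E \<sigma>" "flag_act \<sigma> (bflag i j u) = bflag i' j' v"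
    by (auto simp: same_orbit_def map_aut_def)
  obtain c where c: "colour_aut ((\<oplus>) c) \<sigma>" using H1 \<sigma>(1) by blast
  have *: "bflag (c \<oplus> i) (c \<oplus> j) (\<sigma> u) = bflag i' j' v"
    using \<sigma>(2) flag_act_bflag[OF c v(1)] by simp
  have "v = \<sigma> u \<and> i' = c \<oplus> i \<and> j' = c \<oplus> j"
    by (rule bflag_inj[OF colour_aut_in[OF c v(1)] _ *]) (use ij in simp)
  then show "i \<oplus> j = i' \<oplus> j'" by (metis kadd_assoc kadd_commute kadd_self_left)
next
  assume eq: "i \<oplus> j = i' \<oplus> j'"
  obtain \<sigma> where \<sigma>: "colour_aut ((\<oplus>) (i \<oplus> i')) \<sigma>" "\<sigma> u = v" using H2 v by blast
  have "i \<oplus> i' \<oplus> i = i'" "i \<oplus> i' \<oplus> j = j'"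
    using eq by (metis kadd_assoc kadd_commute kadd_self_left)+
  then have "flag_act \<sigma> (bflag i j u) = bflag i' j' v"
    using flag_act_bflag[OF \<sigma>(1) v(1)] \<sigma>(2) by simp
  then show "same_orbit V E (bimap d) (bflag i j u) (bflag i' j' v)"
    using map_aut_bimap[OF \<sigma>(1)] by (auto simp: same_orbit_def)
qed

text \<open>With the sum of the two face colours as orbit invariant: passing to the 0-adjacent flag
  keeps the pair, the 1-adjacent flag exchanges its members, and the 2-adjacent flag replaces
  \<open>j\<close> by \<open>d \<oplus> j\<close>, which changes the sum. Only the two sums other
  than \<open>East\<close> and \<open>d\<close> occur.\<close>

lemma class_bimap:
  assumes H1: "\<forall>\<sigma>. graph_aut V E \<sigma> \<longrightarrow> (\<exists>c. colour_aut ((\<oplus>) c) \<sigma>)"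
    and H2: "\<forall>u\<in>V. \<forall>v\<in>V. \<forall>c. \<exists>\<sigma>. colour_aut ((\<oplus>) c) \<sigma> \<and> \<sigma> u = v"
    and d: "d \<noteq> East"
  shows "class_2_01 V E (bimap d)"
  unfolding class_2_01_def
proof (intro conjI ballI)
  show P: "polytopal_map V E (bimap d)" by (rule polytopal_bimap[OF d])
  note iff = same_orbit_bimap_iff[OF H1 H2]
  define O' where "O' x = {bflag i (i \<oplus> x) v | i v. v \<in> V}" for x
  have O': "{\<Psi> \<in> flags (bimap d). same_orbit V E (bimap d) (bflag i j v) \<Psi>} = O' (i \<oplus> j)"
    if v: "v \<in> V" and ij: "i \<noteq> j" "j \<noteq> d \<oplus> i" for i j v
  proof (intro subset_antisym subsetI)
    fix \<Psi> assume "\<Psi> \<in> {\<Psi> \<in> flags (bimap d). same_orbit V E (bimap d) (bflag i j v) \<Psi>}"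
    then obtain a b u where t: "\<Psi> = bflag a b u" "u \<in> V" "a \<noteq> b"
        "same_orbit V E (bimap d) (bflag i j v) \<Psi>"
      by (auto simp: flags_bimap)
    then have "i \<oplus> j = a \<oplus> b" using iff v ij by metis
    with t show "\<Psi> \<in> O' (i \<oplus> j)" by (auto simp: O'_def intro!: exI[of _ a])
  next
    fix \<Psi> assume "\<Psi> \<in> O' (i \<oplus> j)"
    then obtain a u where t: "\<Psi> = bflag a (a \<oplus> (i \<oplus> j)) u" "u \<in> V" by (auto simp: O'_def)
    have 1: "a \<noteq> a \<oplus> (i \<oplus> j)" "a \<oplus> (i \<oplus> j) \<noteq> d \<oplus> a"
      using ij by (cases a; cases i; cases j; cases d; simp)+
    then have "same_orbit V E (bimap d) (bflag i j v) \<Psi>" unfolding t(1)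
      using iff[OF v t(2) ij(1) 1(1)] by simp
    moreover have "\<Psi> \<in> flags (bimap d)" unfolding flags_bimap using 1 t by blast
    ultimately show "\<Psi> \<in> {\<Psi> \<in> flags (bimap d). same_orbit V E (bimap d) (bflag i j v) \<Psi>}"
      by blast
  qed
  have O'inj: "x = y" if "O' x = O' y" "x \<noteq> East" for x y
  proof -
    obtain v where v: "v \<in> V" using V_ne by blast
    then have "bflag East (East \<oplus> x) v \<in> O' x" unfolding O'_def by blast
    with that obtain i u where "bflag East x v = bflag i (i \<oplus> y) u"
      unfolding kadd.simps by (auto simp: O'_def)
    from bflag_inj[OF v _ this] that(2) show ?thesis by auto
  qed
  obtain v where v: "v \<in> V" using V_ne by blast
  obtain j k where jk: "j \<noteq> k" "\<And>l. (l \<noteq> East \<and> l \<noteq> d \<oplus> East) \<longleftrightarrow> l = j \<or> l = k"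
    using that by (rule other_colours[OF d, of East])
  have "flag_orbits V E (bimap d) = {O' j, O' k}"
  proof (intro subset_antisym subsetI)
    fix X assume "X \<in> flag_orbits V E (bimap d)"
    then obtain a b u where t: "u \<in> V" "a \<noteq> b" "b \<noteq> d \<oplus> a"
        "X = {\<Psi> \<in> flags (bimap d). same_orbit V E (bimap d) (bflag a b u) \<Psi>}"
      by (auto simp: flag_orbits_def flags_bimap)
    then have "X = O' (a \<oplus> b)" using O' by simp
    moreover have "a \<oplus> b \<noteq> East" "a \<oplus> b \<noteq> d \<oplus> East"
      using t(2,3) by (cases a; cases b; cases d; simp)+
    ultimately show "X \<in> {O' j, O' k}" using jk(2)[of "a \<oplus> b"] by auto
  next
    fix X assume "X \<in> {O' j, O' k}"
    then obtain l where l: "l = j \<or> l = k" "X = O' l" by blast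
    with jk(2)[of l] have l': "East \<noteq> l" "l \<noteq> d \<oplus> East" by auto
    then have "X = {\<Psi> \<in> flags (bimap d). same_orbit V E (bimap d) (bflag East l v) \<Psi>}"
      using O'[OF v] l(2) by simp
    moreover have "bflag East l v \<in> flags (bimap d)" unfolding flags_bimap using l' v by blast
    ultimately show "X \<in> flag_orbits V E (bimap d)" by (auto simp: flag_orbits_def)
  qed
  moreover have "j \<noteq> East" using jk(2)[of j] by simp
  then have "O' j \<noteq> O' k" using O'inj jk(1) by blast
  ultimately show "card (flag_orbits V E (bimap d)) = 2" by simp
  fix \<Phi> assume "\<Phi> \<in> flags (bimap d)"
  then obtain i j v where t: "\<Phi> = bflag i j v" "v \<in> V" "i \<noteq> j" "j \<noteq> d \<oplus> i"
    by (auto simp: flags_bimap)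
  have f: "bicycle i j v \<in> bimap d" using t by (simp add: bicycle_in_bimap)
  have "flag_adj (bimap d) 0 \<Phi> = bflag i j (s i v)"
    using flag_adj_0[OF P f _ t(2), of i] bicycle_eq[OF orb.left[OF orb.base], of v i j] t
    by (simp add: bflag_def)
  then show "same_orbit V E (bimap d) \<Phi> (flag_adj (bimap d) 0 \<Phi>)"
    using iff t by simp
  have "flag_adj (bimap d) 1 \<Phi> = bflag j i v"
    using flag_adj_1[OF P f, of v i j] t bicycle_commute by (simp add: bflag_def)
  then show "same_orbit V E (bimap d) \<Phi> (flag_adj (bimap d) 1 \<Phi>)"
    using iff[of v v i j j i] t kadd_commute by simp
  have "d \<oplus> j \<noteq> i" using t(4) by (metis kadd_self_left)
  moreover have "i \<oplus> j \<noteq> i \<oplus> (d \<oplus> j)" using d by (simp add: eq_commute[of j])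
  ultimately show "\<not> same_orbit V E (bimap d) \<Phi> (flag_adj (bimap d) 2 \<Phi>)"
    unfolding t(1) flag_adj_2_bimap[OF d t(2-4)] using iff t by auto
qed

lemma bimap_not_iso:
  assumes H1: "\<forall>\<sigma>. graph_aut V E \<sigma> \<longrightarrow> (\<exists>c. colour_aut ((\<oplus>) c) \<sigma>)"
    and "d' \<noteq> East" "d \<noteq> d'"
  shows "\<not> map_iso V E (bimap d) (bimap d')"
  using H1 image_bimap bimap_inj assms(2,3) unfolding map_iso_def by metis

end

section \<open>Faces of maps of class 2_01\<close>

text \<open>Exchanging \<open>East\<close> and \<open>d\<close> leaves open what happens to the
  other two colours. If they were fixed, the corner of \<open>East\<close> and
  \<open>d \<oplus> d0\<close> would go to \<open>d\<close> and \<open>d \<oplus> d0\<close>, a pair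
  omitted by the matching \<open>d0\<close>.\<close>

lemma flip_klein:
  fixes \<pi> :: "colour \<Rightarrow> colour"
  assumes "bij \<pi>" "\<pi> East = d" "\<pi> d = East" "d \<noteq> East" "d0 \<noteq> East" "d \<noteq> d0"
    and "\<And>i j. i \<noteq> j \<Longrightarrow> j \<noteq> d0 \<oplus> i \<Longrightarrow> \<pi> j \<noteq> d0 \<oplus> \<pi> i"
  shows "\<pi> i = d \<oplus> i"
proof -
  have inj: "\<pi> i = \<pi> j \<longleftrightarrow> i = j" for i j
    using assms(1) by (simp add: bij_def inj_eq)
  have 1: "\<pi> (d \<oplus> d0) \<noteq> East" "\<pi> (d \<oplus> d0) \<noteq> d" "\<pi> d0 \<noteq> East" "\<pi> d0 \<noteq> d" "\<pi> d0 \<noteq> \<pi> (d \<oplus> d0)"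
    using inj[of "d \<oplus> d0" d] inj[of "d \<oplus> d0" East] inj[of d0 d] inj[of d0 East]
      inj[of d0 "d \<oplus> d0"] assms(4-6) by (simp_all add: assms(2,3))
  have 2: "\<pi> (d \<oplus> d0) \<noteq> d0 \<oplus> d"
    using assms(7)[of East "d \<oplus> d0"] assms(4-6) by (simp add: assms(2) kadd_commute)
  have rest: "x = d0 \<or> x = d \<oplus> d0" if "x \<noteq> East" "x \<noteq> d" for x
    using that assms(4-6) by (cases x; cases d; cases d0; simp)
  have "\<pi> (d \<oplus> d0) = d0" using rest[OF 1(1,2)] 2 by (simp add: kadd_commute)
  moreover from this have "\<pi> d0 = d \<oplus> d0" using rest[OF 1(3,4)] 1(5) by simp
  moreover have "i = East \<or> i = d \<or> i = d0 \<or> i = d \<oplus> d0" using rest by blast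
  ultimately show ?thesis using assms(2,3) by auto
qed

context four_coloured
begin

text \<open>The corner relation on the four colours at \<open>v\<close> is 2-regular and, by the
  last clause of \<open>polytopal_map\<close>, connected. So it is a 4-cycle, and its complement is
  a perfect matching.\<close>

lemma polytopal_corners:
  assumes P: "polytopal_map V E F" and v: "v \<in> V"
  obtains d where "d \<noteq> East"
    "\<And>i j. (i \<noteq> j \<and> (\<exists>f\<in>F. ed v i \<in> f \<and> ed v j \<in> f)) \<longleftrightarrow> i \<noteq> j \<and> j \<noteq> d \<oplus> i"
proof -
  define C where "C i j \<longleftrightarrow> i \<noteq> j \<and> (\<exists>f\<in>F. ed v i \<in> f \<and> ed v j \<in> f)" for i j
  have sym: "C i j \<longleftrightarrow> C j i" for i j by (auto simp: C_def)
  have conn: "(ed v i, ed v k) \<in> {(x, y). x \<in> E \<and> y \<in> E \<and> v \<in> x \<and> v \<in> y \<and> x \<noteq> y \<and>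
      (\<exists>f\<in>F. x \<in> f \<and> y \<in> f)}\<^sup>*" (is "_ \<in> ?R\<^sup>*") for i k
  proof -
    have "\<forall>v\<in>V. \<forall>e\<in>E. \<forall>e'\<in>E. v \<in> e \<longrightarrow> v \<in> e' \<longrightarrow>
        (e, e') \<in> {(x, y). x \<in> E \<and> y \<in> E \<and> v \<in> x \<and> v \<in> y \<and> x \<noteq> y \<and> (\<exists>f\<in>F. x \<in> f \<and> y \<in> f)}\<^sup>*"
      using P unfolding polytopal_map_def by blast
    from bspec[OF bspec[OF bspec[OF this v] ed_in[OF v]] ed_in[OF v]] show ?thesis by simp
  qed
  have conn': "k \<in> A" if "i \<in> A" "\<And>j l. j \<in> A \<Longrightarrow> C j l \<Longrightarrow> l \<in> A" for A i k
  proof -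
    from conn[of i k] have "\<exists>l\<in>A. ed v k = ed v l"
    proof (induction rule: rtrancl_induct)
      case base
      then show ?case using that(1) by blast
    next
      case (step y z)
      then obtain j where j: "j \<in> A" "y = ed v j" by blast
      from step.hyps have "z \<in> E" "v \<in> z" by auto
      then obtain l where l: "z = ed v l" using edge_at by metis
      have "C j l" using step.hyps(2) unfolding C_def j(2) l by auto
      then show ?case using that(2) j(1) l by blast
    qed
    then show "k \<in> A" using v by auto
  qed
  have two: "\<exists>j k. j \<noteq> k \<and> (\<forall>l. C i l \<longleftrightarrow> l = j \<or> l = k)" for i
  proof -
    have "card {f \<in> F. ed v i \<in> f} = 2" using P v unfolding polytopal_map_def by simp
    then obtain f g where fg: "{f \<in> F. ed v i \<in> f} = {f, g}" "f \<noteq> g" by (meson card_2_iff)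
    then have fF: "f \<in> F" "g \<in> F" "ed v i \<in> f" "ed v i \<in> g" by blast+
    have mem: "h = f \<or> h = g" if "h \<in> F" "ed v i \<in> h" for h using fg(1) that by blast
    obtain j where j: "j \<noteq> i" "\<And>k. ed v k \<in> f \<longleftrightarrow> k = i \<or> k = j"
      using polytopal_corner[OF P fF(1,3) v] by blast
    obtain k where k: "k \<noteq> i" "\<And>l. ed v l \<in> g \<longleftrightarrow> l = i \<or> l = k"
      using polytopal_corner[OF P fF(2,4) v] by blast
    have Ci: "C i l \<longleftrightarrow> l = j \<or> l = k" for l
      unfolding C_def using fF mem j k by metis
    \<comment> \<open>If both faces at the edge of colour \<open>i\<close> turned into the same
      colour, the pair \<open>{i, j}\<close> would be closed under corners, against
      connectedness.\<close>
    have "j \<noteq> k"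
    proof
      assume "j = k"
      have "card {h \<in> F. ed v j \<in> h} = 2" using P v unfolding polytopal_map_def by simp
      then obtain f' g' where fg': "{h \<in> F. ed v j \<in> h} = {f', g'}" by (meson card_2_iff)
      moreover have "f \<in> {h \<in> F. ed v j \<in> h}" "g \<in> {h \<in> F. ed v j \<in> h}"
        using fF j k \<open>j = k\<close> by simp_all
      ultimately have "{h \<in> F. ed v j \<in> h} = {f, g}" using fg(2) by auto
      then have mem': "h = f \<or> h = g" if "h \<in> F" "ed v j \<in> h" for h using that by blast
      have Cj: "C j l \<Longrightarrow> l = i" for l
        unfolding C_def using mem' j k \<open>j = k\<close> by metis
      have "m \<in> {i, j}" for m
        by (rule conn'[of i]) (use Ci Cj \<open>j = k\<close> in auto)
      moreover have "\<exists>m. m \<noteq> i \<and> m \<noteq> j" by (cases i; cases j; simp add: ex_colour)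
      ultimately show False by blast
    qed
    with Ci show ?thesis by blast
  qed
  have "\<exists>e. e \<noteq> East \<and> (\<forall>l. C i l \<longleftrightarrow> l \<noteq> i \<and> l \<noteq> e \<oplus> i)" for i
  proof -
    obtain j k where jk: "j \<noteq> k" "\<forall>l. C i l \<longleftrightarrow> l = j \<or> l = k" using two by blast
    have "\<not> C i i" by (simp add: C_def)
    with jk have "j \<noteq> i" "k \<noteq> i" by auto
    with jk(1) have "\<exists>e. e \<noteq> East \<and> (\<forall>l. (l = j \<or> l = k) \<longleftrightarrow> l \<noteq> i \<and> l \<noteq> e \<oplus> i)"
      by (cases i; cases j; cases k; simp add: all_colour ex_colour)
    with jk(2) show ?thesis by simp
  qed
  then obtain e where e: "\<And>i. e i \<noteq> East" "\<And>i l. C i l \<longleftrightarrow> l \<noteq> i \<and> l \<noteq> e i \<oplus> i" by metis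
  have sym': "k = e i \<oplus> i \<longleftrightarrow> i = e k \<oplus> k" for i k
    using sym[of i k] e(1)[of i] e(1)[of k] unfolding e(2) by auto
  \<comment> \<open>The map sending \<open>i\<close> to \<open>e i \<oplus> i\<close> is a
    fixed-point-free involution, and on four points every such involution is a translation by a
    constant.\<close>
  have "e North = e East \<and> e West = e East \<and> e South = e East"
    using sym'[of East North] sym'[of East West] sym'[of East South]
      sym'[of North West] sym'[of North South] sym'[of West South]
      e(1)[of East] e(1)[of North] e(1)[of West] e(1)[of South]
    by (cases "e East"; cases "e North"; cases "e West"; cases "e South"; simp)
  then have "e i = e East" for i by (cases i) simp_all
  then have "C i j \<longleftrightarrow> i \<noteq> j \<and> j \<noteq> e East \<oplus> i" for i j using e(2) by metis
  with that[of "e East"] e(1) show thesis by (simp add: C_def)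
qed

section \<open>Automorphisms supplied by the class condition\<close>

lemma class_flip:
  assumes C: "class_2_01 V E F" and f: "f \<in> F" "ed v i \<in> f" "ed v j \<in> f" "i \<noteq> j"
    and v: "v \<in> V"
  obtains \<sigma> where "graph_aut V E \<sigma>" "fim \<sigma> ` F = F" "fim \<sigma> f = f" "\<sigma> v = v" "\<sigma> (s i v) = s j v"
proof -
  have P: "polytopal_map V E F" using C by (simp add: class_2_01_def)
  have "(v, ed v i, f) \<in> flags F" using f by (simp add: flags_def)
  then have "same_orbit V E F (v, ed v i, f) (v, ed v j, f)"
    using C flag_adj_1[OF P f v] unfolding class_2_01_def by metis
  then obtain \<sigma> where \<sigma>: "map_aut V E F \<sigma>" "\<sigma> v = v" "\<sigma> ` ed v i = ed v j" "fim \<sigma> f = f"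
    by (auto simp: same_orbit_def flag_act_def)
  moreover have "\<sigma> (s i v) = s j v"
    using \<sigma>(2,3) by (auto simp: ed_def doubleton_eq_iff)
  ultimately show thesis using that[of \<sigma>] unfolding map_aut_def by blast
qed

lemma class_swap:
  assumes C: "class_2_01 V E F" and f: "f \<in> F" "ed v i \<in> f" and v: "v \<in> V"
  obtains \<sigma> where "graph_aut V E \<sigma>" "fim \<sigma> f = f" "\<sigma> v = s i v" "\<sigma> (s i v) = v"
proof -
  have P: "polytopal_map V E F" using C by (simp add: class_2_01_def)
  have "(v, ed v i, f) \<in> flags F" using f by (simp add: flags_def)
  then have "same_orbit V E F (v, ed v i, f) (s i v, ed v i, f)"
    using C flag_adj_0[OF P f v] unfolding class_2_01_def by metis
  then obtain \<sigma> where \<sigma>: "map_aut V E F \<sigma>" "\<sigma> v = s i v" "\<sigma> ` ed v i = ed v i" "fim \<sigma> f = f"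
    by (auto simp: same_orbit_def flag_act_def)
  moreover have "\<sigma> (s i v) = v"
    using \<sigma>(2,3) v by (auto simp: ed_def doubleton_eq_iff)
  ultimately show thesis using that[of \<sigma>] unfolding map_aut_def by blast
qed

text \<open>At least one of \<open>North\<close> and \<open>South\<close> differs from the omitted
  matching, hence forms a corner with \<open>East\<close>, and the automorphism exchanging the two
  edges of that corner is the one sought. The translation by \<open>West\<close> is a half-turn of
  the grid and would not conflict with b^2 = -1; the other two are reflections in diagonals.\<close>

lemma class_local_klein:
  assumes C: "class_2_01 V E F" and v: "v \<in> V"
  obtains d \<sigma> where "d = North \<or> d = South" "graph_aut V E \<sigma>" "\<sigma> v = v"
    "\<And>i. \<sigma> (s i v) = s (d \<oplus> i) v"
proof -
  have P: "polytopal_map V E F" using C by (simp add: class_2_01_def)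
  obtain d0 where d0: "d0 \<noteq> East"
    "\<And>i j. (i \<noteq> j \<and> (\<exists>f\<in>F. ed v i \<in> f \<and> ed v j \<in> f)) \<longleftrightarrow> i \<noteq> j \<and> j \<noteq> d0 \<oplus> i"
    using polytopal_corners[OF P v] by blast
  obtain d where d: "d = North \<or> d = South" "d \<noteq> d0" by (cases d0) auto
  then have dE: "d \<noteq> East" by auto
  obtain f where f: "f \<in> F" "ed v East \<in> f" "ed v d \<in> f"
    using d0(2)[of East d] d dE by auto
  obtain \<sigma> where \<sigma>: "graph_aut V E \<sigma>" "fim \<sigma> ` F = F" "fim \<sigma> f = f" "\<sigma> v = v"
      "\<sigma> (s East v) = s d v"
    using class_flip[OF C f dE[symmetric] v] by blast
  obtain \<pi> where \<pi>: "bij \<pi>" "\<And>i. \<sigma> (s i v) = s (\<pi> i) (\<sigma> v)"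
    using graph_aut_local[OF \<sigma>(1) v] by blast
  have im: "\<sigma> ` ed v i = ed v (\<pi> i)" for i using \<pi>(2) \<sigma>(4) by (simp add: ed_def)
  have inj: "\<pi> i = \<pi> j \<longleftrightarrow> i = j" for i j using \<pi>(1) by (simp add: bij_def inj_eq)
  have piE: "\<pi> East = d" using \<sigma>(4,5) \<pi>(2) v by simp
  have "\<sigma> ` ed v d \<in> fim \<sigma> f" using f(3) by blast
  then have "ed v (\<pi> d) \<in> f" using \<sigma>(3) im by simp
  moreover obtain j where "\<And>k. ed v k \<in> f \<longleftrightarrow> k = East \<or> k = j"
    using polytopal_corner[OF P f(1,2) v] by blast
  ultimately have "\<pi> d = East \<or> \<pi> d = d" using f(3) dE by metis
  then have pid: "\<pi> d = East" using piE inj dE by metis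
  have "\<pi> i = d \<oplus> i" for i
  proof (rule flip_klein[OF \<pi>(1) piE pid dE d0(1) d(2)])
    fix i j assume ij: "i \<noteq> j" "j \<noteq> d0 \<oplus> i"
    then obtain g where g: "g \<in> F" "ed v i \<in> g" "ed v j \<in> g" using d0(2) by blast
    have "fim \<sigma> g \<in> F" using g(1) \<sigma>(2) by blast
    moreover have "ed v (\<pi> i) \<in> fim \<sigma> g" "ed v (\<pi> j) \<in> fim \<sigma> g"
      using g(2,3) im[symmetric] by auto
    ultimately show "\<pi> j \<noteq> d0 \<oplus> \<pi> i" using d0(2) inj ij(1) by metis
  qed
  then show thesis using that d(1) \<sigma>(1,4) \<pi>(2) by simp
qed

lemma class_face_bicycle:
  assumes H1: "\<forall>\<sigma>. graph_aut V E \<sigma> \<longrightarrow> (\<exists>c. colour_aut ((\<oplus>) c) \<sigma>)"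
    and C: "class_2_01 V E F" and f: "f \<in> F" "ed v i \<in> f" "ed v j \<in> f" "i \<noteq> j" and v: "v \<in> V"
  shows "f = bicycle i j v"
proof -
  have P: "polytopal_map V E F" using C by (simp add: class_2_01_def)
  have step: "ed (s i u) j \<in> f" if u: "u \<in> V" "ed u i \<in> f" "ed u j \<in> f" for u i j
  proof -
    obtain \<sigma> where \<sigma>: "graph_aut V E \<sigma>" "fim \<sigma> f = f" "\<sigma> u = s i u" "\<sigma> (s i u) = u"
      using class_swap[OF C f(1) u(2,1)] by blast
    obtain c where c: "colour_aut ((\<oplus>) c) \<sigma>" using H1 \<sigma>(1) by blast
    have "u = s (c \<oplus> i) (s i u)" using colour_aut_s[OF c u(1), of i] \<sigma>(3,4) by simp
    then have "c = East" using u(1) by simp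
    then have "\<sigma> ` ed u j = ed (s i u) j" using image_ed[OF c u(1)] \<sigma>(3) by simp
    moreover have "\<sigma> ` ed u j \<in> fim \<sigma> f" using u(3) by blast
    ultimately show ?thesis using \<sigma>(2) by simp
  qed
  have sub: "ed u i \<in> f \<and> ed u j \<in> f" if "u \<in> orb i j v" for u
    using that
  proof (induction rule: orb.induct)
    case base
    show ?case using f by simp
  next
    case (left u)
    have u: "u \<in> V" using orb_in[OF left.hyps v] .
    with left.IH step[OF u] show ?case by simp
  next
    case (right u)
    have u: "u \<in> V" using orb_in[OF right.hyps v] .
    with right.IH step[OF u] show ?case by simp
  qed
  show ?thesis
  proof (intro subset_antisym subsetI)
    fix e assume "e \<in> bicycle i j v"
    then show "e \<in> f" using sub by (auto simp: bicycle_def)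
  next
    \<comment> \<open>The bicycle already uses both edges of \<open>f\<close> at each of its
      vertices, so the connected set \<open>f\<close> cannot leave it.\<close>
    fix e assume e: "e \<in> f"
    have "is_cycle E f" using P f(1) unfolding polytopal_map_def by blast
    then have "(ed v i, e) \<in> {(x, y). x \<in> f \<and> y \<in> f \<and> x \<inter> y \<noteq> {}}\<^sup>*"
      using e f(2) unfolding is_cycle_def by blast
    then show "e \<in> bicycle i j v"
    proof (induction rule: rtrancl_induct)
      case base
      show ?case using v by simp
    next
      case (step x y)
      then obtain u where u: "u \<in> x" "u \<in> y" "y \<in> f" by auto
      obtain w k where w: "x = ed w k" "w \<in> orb i j v" "k \<in> {i, j}"
        using step.IH by (auto simp: bicycle_def)
      have wV: "w \<in> V" using orb_in[OF w(2) v] .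
      have "u = w \<or> u = s k w" using ed_at[OF wV] u(1) w(1) by blast
      then have uo: "u \<in> orb i j v" using w(2,3) by (auto intro: orb.intros)
      then have uV: "u \<in> V" using orb_in v by blast
      have "y \<in> E" using face_subset[OF P f(1)] u(3) by blast
      then obtain l where l: "y = ed u l" using edge_at u(2) by metis
      obtain m where m: "\<And>k. ed u k \<in> f \<longleftrightarrow> k = i \<or> k = m"
        using polytopal_corner[OF P f(1) conjunct1[OF sub[OF uo]] uV] by blast
      then have "m = j" using sub[OF uo] f(4) by metis
      then have "l \<in> {i, j}" using u(3) l m by simp
      then show ?case unfolding l using uo by (auto simp: bicycle_def)
    qed
  qed
qed

text \<open>A face that is a two-coloured cycle shows the same pair of colours at the next vertex;
  so the omitted matching does not change along an edge.\<close>

theorem class_2_01_bimap: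
  assumes H1: "\<forall>\<sigma>. graph_aut V E \<sigma> \<longrightarrow> (\<exists>c. colour_aut ((\<oplus>) c) \<sigma>)"
    and C: "class_2_01 V E F"
  obtains d where "d \<noteq> East" "F = bimap d"
proof -
  have P: "polytopal_map V E F" using C by (simp add: class_2_01_def)
  define corners where "corners v d \<longleftrightarrow> d \<noteq> East \<and>
    (\<forall>i j. i \<noteq> j \<longrightarrow> ((\<exists>f\<in>F. ed v i \<in> f \<and> ed v j \<in> f) \<longleftrightarrow> j \<noteq> d \<oplus> i))" for v d
  have cornersD: "(\<exists>f\<in>F. ed v i \<in> f \<and> ed v j \<in> f) \<longleftrightarrow> j \<noteq> d \<oplus> i"
    if "corners v d" "i \<noteq> j" for v d i j
    using that unfolding corners_def by blast
  have ex: "\<exists>d. corners v d" if "v \<in> V" for v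
    using polytopal_corners[OF P that] unfolding corners_def by metis
  obtain v0 where v0: "v0 \<in> V" using V_ne by blast
  obtain d where d: "corners v0 d" using ex[OF v0] by blast
  have dE: "d \<noteq> East" using d by (simp add: corners_def)
  have all: "corners v d" if "v \<in> V" for v
    using v0 that
  proof (induction rule: conn_induct)
    case base
    show ?case by (rule d)
  next
    case (step x i)
    obtain e where e: "corners (s i x) e" using ex[OF s_in[OF step.hyps]] by blast
    \<comment> \<open>Only corners containing the colour of the traversed edge are carried over, but
      the partner of one colour already determines the matching.\<close>
    have "j \<noteq> e \<oplus> i" if j: "j \<noteq> i" "j \<noteq> d \<oplus> i" for j
    proof -
      obtain f where f: "f \<in> F" "ed x i \<in> f" "ed x j \<in> f"
        using cornersD[OF step.IH j(1)[symmetric]] j(2) by blast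
      have "f = bicycle i j x" using class_face_bicycle[OF H1 C f _ step.hyps] j by simp
      moreover have "s i x \<in> orb i j x" by (intro orb.intros)
      ultimately have "ed (s i x) i \<in> f" "ed (s i x) j \<in> f"
        by (auto simp: bicycle_def)
      then show ?thesis using cornersD[OF e j(1)[symmetric]] f(1) by blast
    qed
    moreover have "e \<noteq> East" using e by (simp add: corners_def)
    ultimately have "e \<oplus> i = d \<oplus> i" by (metis kadd_eq_right)
    then have "e = d" by (metis kadd_commute kadd_left_cancel)
    with e show ?case by simp
  qed
  have "F = bimap d"
  proof (intro subset_antisym subsetI)
    fix f assume f: "f \<in> F"
    have "is_cycle E f" using P f unfolding polytopal_map_def by blast
    then have "f \<noteq> {}" "f \<subseteq> E" unfolding is_cycle_def by auto
    then obtain e where "e \<in> f" "e \<in> E" by blast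
    then obtain v i where v: "v \<in> V" "ed v i \<in> f" unfolding E_eq by blast
    obtain j where j: "j \<noteq> i" "\<And>k. ed v k \<in> f \<longleftrightarrow> k = i \<or> k = j"
      using polytopal_corner[OF P f v(2,1)] by blast
    then have "f = bicycle i j v" using class_face_bicycle[OF H1 C f v(2) _ _ v(1)] by metis
    moreover have "j \<noteq> d \<oplus> i" using cornersD[OF all[OF v(1)] j(1)[symmetric]] j(2) f v(2) by blast
    ultimately show "f \<in> bimap d" using bicycle_in_bimap[OF v(1) j(1)[symmetric]] by simp
  next
    fix f assume "f \<in> bimap d"
    then obtain i j v where f: "f = bicycle i j v" "v \<in> V" "i \<noteq> j" "j \<noteq> d \<oplus> i"
      by (auto simp: bimap_def)
    then obtain g where g: "g \<in> F" "ed v i \<in> g" "ed v j \<in> g"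
      using cornersD[OF all[OF f(2)] f(3)] by blast
    then have "g = f" using class_face_bicycle[OF H1 C g f(3,2)] f(1) by simp
    with g(1) show "f \<in> F" by simp
  qed
  with that dE show thesis by blast
qed

end

section \<open>Recovering the colouring from short cycles\<close>

lemma opposite_pair:
  assumes "d \<noteq> East" "b \<noteq> a" "c \<noteq> a" "c \<noteq> b" "b \<noteq> d \<oplus> a" "c \<noteq> d \<oplus> a"
  shows "c = d \<oplus> b"
  using assms by (cases a; cases b; cases c; cases d; simp)

lemma bij_eq_from_others:
  fixes \<pi> \<rho> :: "colour \<Rightarrow> colour"
  assumes "bij \<pi>" "bij \<rho>" "\<And>j. j \<noteq> k \<Longrightarrow> \<rho> j = \<pi> j"
  shows "\<rho> = \<pi>"
proof
  fix j
  obtain l where l: "\<pi> l = \<rho> k" using assms(1) by (metis bij_pointE)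
  have "l = k"
    using l assms(3)[of l] assms(2) by (metis bij_def inj_eq)
  with l assms(3) show "\<rho> j = \<pi> j" by metis
qed

context four_coloured
begin

text \<open>The permutations at the two ends of an edge both describe the image of that edge, so
  they agree on its colour. It remains to compare the other three colours across a single edge;
  connectedness does the rest.\<close>

lemma colour_aut_of_local:
  assumes G: "graph_aut V E \<sigma>"
    and loc: "\<And>v i \<pi> \<rho>. \<lbrakk>v \<in> V; bij \<pi>; bij \<rho>; \<And>j. \<sigma> (s j v) = s (\<pi> j) (\<sigma> v);
      \<And>j. \<sigma> (s j (s i v)) = s (\<rho> j) (s (\<pi> i) (\<sigma> v)); \<rho> i = \<pi> i\<rbrakk> \<Longrightarrow> \<rho> = \<pi>"
  obtains \<pi> where "colour_aut \<pi> \<sigma>"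
proof -
  obtain v0 where v0: "v0 \<in> V" using V_ne by blast
  obtain \<pi> where \<pi>: "bij \<pi>" "\<And>i. \<sigma> (s i v0) = s (\<pi> i) (\<sigma> v0)"
    using graph_aut_local[OF G v0] by blast
  have "\<forall>i. \<sigma> (s i v) = s (\<pi> i) (\<sigma> v)" if "v \<in> V" for v
    using v0 that
  proof (induction rule: conn_induct)
    case base
    show ?case using \<pi>(2) by blast
  next
    case (step x i)
    obtain \<rho> where \<rho>: "bij \<rho>" "\<And>j. \<sigma> (s j (s i x)) = s (\<rho> j) (\<sigma> (s i x))"
      using graph_aut_local[OF G s_in[OF step.hyps]] by blast
    have x: "\<sigma> x \<in> V" using graph_aut_in[OF G step.hyps] .
    have "\<sigma> x = s (\<rho> i) (s (\<pi> i) (\<sigma> x))"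
      using \<rho>(2)[of i] step by simp
    then have "\<rho> i = \<pi> i" using x by simp
    moreover have "\<sigma> (s j (s i x)) = s (\<rho> j) (s (\<pi> i) (\<sigma> x))" for j
      using \<rho>(2) step.IH by simp
    ultimately have "\<rho> = \<pi>" using loc[OF step.hyps \<pi>(1) \<rho>(1)] step.IH by blast
    with \<rho>(2) show ?case by simp
  qed
  then have "colour_aut \<pi> \<sigma>" using \<pi>(1) G by (simp add: colour_aut_def graph_aut_def)
  with that show thesis by blast
qed

text \<open>The hypothesis says that the 4-cycles are the squares of a grid whose lines have the
  colours \<open>i\<close> and \<open>d \<oplus> i\<close>. A square on the edge of colour
  \<open>i\<close> ties the colour \<open>j\<close> at one end to \<open>d \<oplus> j\<close> at the
  other. This transports the two colours off the line of \<open>i\<close>; bijectivity gives the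
  fourth.\<close>

lemma colour_aut_of_squares:
  assumes d: "d \<noteq> East"
    and sq: "\<And>v i j k. \<lbrakk>v \<in> V; j \<noteq> i; k \<noteq> i\<rbrakk> \<Longrightarrow>
      {s j v, s k (s i v)} \<in> E \<longleftrightarrow> j \<noteq> d \<oplus> i \<and> k = d \<oplus> j"
    and G: "graph_aut V E \<sigma>"
  obtains \<pi> where "colour_aut \<pi> \<sigma>"
proof (rule colour_aut_of_local[OF G])
  fix v i \<pi> \<rho>
  assume v: "v \<in> V" and bij: "bij \<pi>" "bij \<rho>" and \<pi>: "\<And>j. \<sigma> (s j v) = s (\<pi> j) (\<sigma> v)"
    and \<rho>: "\<And>j. \<sigma> (s j (s i v)) = s (\<rho> j) (s (\<pi> i) (\<sigma> v))" and i: "\<rho> i = \<pi> i"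
  have inj: "\<pi> j = \<pi> k \<longleftrightarrow> j = k" "\<rho> j = \<rho> k \<longleftrightarrow> j = k" for j k
    using bij by (simp_all add: bij_def inj_eq)
  have *: "\<pi> j \<noteq> d \<oplus> \<pi> i \<and> \<rho> (d \<oplus> j) = d \<oplus> \<pi> j" if j: "j \<noteq> i" "j \<noteq> d \<oplus> i" for j
  proof -
    have ki: "d \<oplus> j \<noteq> i" using j(2) by auto
    have "{s j v, s (d \<oplus> j) (s i v)} \<in> E" using sq[OF v j(1) ki] j(2) by simp
    then have "{\<sigma> (s j v), \<sigma> (s (d \<oplus> j) (s i v))} \<in> E"
      using graph_aut_edge[OF G, of "s j v" "s (d \<oplus> j) (s i v)"] v by simp
    then have "{s (\<pi> j) (\<sigma> v), s (\<rho> (d \<oplus> j)) (s (\<pi> i) (\<sigma> v))} \<in> E" by (simp add: \<pi> \<rho>)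
    moreover have "\<pi> j \<noteq> \<pi> i" using inj(1) j(1) by simp
    moreover have "\<rho> (d \<oplus> j) \<noteq> \<pi> i" using inj(2) ki i by metis
    ultimately show ?thesis using sq[OF graph_aut_in[OF G v]] by blast
  qed
  show "\<rho> = \<pi>"
  proof (rule bij_eq_from_others[OF bij, of "d \<oplus> i"])
    fix j assume j: "j \<noteq> d \<oplus> i"
    show "\<rho> j = \<pi> j"
    proof (cases "j = i")
      case False
      have k: "d \<oplus> j \<noteq> i" "d \<oplus> j \<noteq> d \<oplus> i" "d \<oplus> j \<noteq> j" using j False d by auto
      have "\<pi> j = d \<oplus> \<pi> (d \<oplus> j)"
        by (rule opposite_pair[of d _ "\<pi> i"])
          (use *[OF False j] *[OF k(1,2)] inj(1) k False j d in auto)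
      then show ?thesis using *[OF k(1,2)] by simp
    qed (simp add: i)
  qed
qed (rule that)

text \<open>Second walks only reveal whether the outer colours of a path are equal, but that
  suffices. If \<open>\<rho> k = \<pi> j\<close> with \<open>j \<noteq> k\<close>, a second walk
  joins the ends of the path with colours \<open>j\<close>, \<open>i\<close>, \<open>k\<close>,
  whereas its image has equal outer colours and admits none.\<close>

lemma colour_aut_of_hexagons:
  assumes hex: "\<And>v i j k. \<lbrakk>v \<in> V; j \<noteq> i; k \<noteq> i\<rbrakk> \<Longrightarrow>
      (\<exists>p q. {s j v, p} \<in> E \<and> {p, q} \<in> E \<and> {q, s k (s i v)} \<in> E \<and> (p, q) \<noteq> (v, s i v))
        \<longleftrightarrow> j \<noteq> k"
    and G: "graph_aut V E \<sigma>"
  obtains \<pi> where "colour_aut \<pi> \<sigma>"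
proof (rule colour_aut_of_local[OF G])
  fix v i \<pi> \<rho>
  assume v: "v \<in> V" and bij: "bij \<pi>" "bij \<rho>" and \<pi>: "\<And>j. \<sigma> (s j v) = s (\<pi> j) (\<sigma> v)"
    and \<rho>: "\<And>j. \<sigma> (s j (s i v)) = s (\<rho> j) (s (\<pi> i) (\<sigma> v))" and i: "\<rho> i = \<pi> i"
  have inj: "\<pi> j = \<pi> k \<longleftrightarrow> j = k" "\<rho> j = \<rho> k \<longleftrightarrow> j = k" for j k
    using bij by (simp_all add: bij_def inj_eq)
  have "\<rho> k = \<pi> k" if k: "k \<noteq> i" for k
  proof -
    obtain j where j: "\<pi> j = \<rho> k" using bij by (metis bij_pointE)
    have ji: "j \<noteq> i" using inj(2) i j k by metis
    have "\<not> (j \<noteq> k)"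
    proof
      assume "j \<noteq> k"
      then obtain p q where pq: "{s j v, p} \<in> E" "{p, q} \<in> E" "{q, s k (s i v)} \<in> E"
          "(p, q) \<noteq> (v, s i v)"
        using hex[OF v ji k] by blast
      have V: "p \<in> V" "q \<in> V" using pq(1-3) nbr_iff by (metis insert_commute)+
      have "{\<sigma> (s j v), \<sigma> p} \<in> E" "{\<sigma> p, \<sigma> q} \<in> E" "{\<sigma> q, \<sigma> (s k (s i v))} \<in> E"
        using pq(1-3) V v graph_aut_edge[OF G] by simp_all
      then have "{s (\<pi> j) (\<sigma> v), \<sigma> p} \<in> E" "{\<sigma> p, \<sigma> q} \<in> E"
          "{\<sigma> q, s (\<rho> k) (s (\<pi> i) (\<sigma> v))} \<in> E"
        by (simp_all add: \<pi> \<rho>)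
      moreover have "(\<sigma> p, \<sigma> q) \<noteq> (\<sigma> v, s (\<pi> i) (\<sigma> v))"
        using pq(4) V v G graph_aut_inj by (simp flip: \<pi>)
      moreover have "\<pi> j \<noteq> \<pi> i" "\<rho> k \<noteq> \<pi> i" using inj ji k i by metis+
      ultimately show False using hex[OF graph_aut_in[OF G v], of "\<pi> j" "\<pi> i" "\<rho> k"] j by blast
    qed
    with j show ?thesis by simp
  qed
  then show "\<rho> = \<pi>" using bij_eq_from_others[OF bij] by blast
qed (rule that)

text \<open>The exponent makes the order of a word visible: orders distinguish matchings even when
  none of the words closes after one turn.\<close>

definition closes :: "colour \<Rightarrow> colour \<Rightarrow> colour \<Rightarrow> colour \<Rightarrow> nat \<Rightarrow> bool" where
  "closes a b c e n \<longleftrightarrow> (\<forall>v\<in>V. ((\<lambda>u. s e (s c (s b (s a u)))) ^^ n) v = v)"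

lemma closes_colour_aut:
  assumes "colour_aut \<pi> \<sigma>"
  shows "closes (\<pi> a) (\<pi> b) (\<pi> c) (\<pi> e) n \<longleftrightarrow> closes a b c e n"
proof -
  define f where "f u = s e (s c (s b (s a u)))" for u
  define g where "g u = s (\<pi> e) (s (\<pi> c) (s (\<pi> b) (s (\<pi> a) u)))" for u
  have fV: "(f ^^ k) v \<in> V" if "v \<in> V" for v k
    using that by (induction k) (simp_all add: f_def)
  have conj: "\<sigma> ((f ^^ k) v) = (g ^^ k) (\<sigma> v)" if v: "v \<in> V" for v k
  proof (induction k)
    case (Suc k)
    have "\<sigma> (f u) = g (\<sigma> u)" if "u \<in> V" for u
      using that by (simp add: f_def g_def colour_aut_s[OF assms])
    with fV[OF v] Suc show ?case by simp
  qed simp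
  have bij: "bij_betw \<sigma> V V" using assms by (simp add: colour_aut_def)
  then have im: "\<sigma> ` V = V" and inj: "inj_on \<sigma> V" by (simp_all add: bij_betw_def)
  have "(\<forall>v\<in>\<sigma> ` V. (g ^^ n) v = v) \<longleftrightarrow> (\<forall>v\<in>V. (g ^^ n) (\<sigma> v) = \<sigma> v)" by simp
  also have "\<dots> \<longleftrightarrow> (\<forall>v\<in>V. \<sigma> ((f ^^ n) v) = \<sigma> v)" using conj by simp
  also have "\<dots> \<longleftrightarrow> (\<forall>v\<in>V. (f ^^ n) v = v)"
    by (intro ball_cong refl inj_on_eq_iff[OF inj] fV)
  finally show ?thesis unfolding im by (simp add: closes_def f_def[abs_def] g_def[abs_def])
qed

text \<open>\<open>\<pi> East \<oplus> \<pi> d\<close> is the matching that pairs the images of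
  \<open>East\<close> and \<open>d\<close>. The word built on these two pairs is mapped to a word of
  that matching with the same order, so the matching is \<open>d\<close> again.\<close>

lemma colour_perm_klein:
  assumes N: "\<And>a b d n. \<lbrakk>d \<noteq> East; b \<noteq> a; b \<noteq> d \<oplus> a\<rbrakk> \<Longrightarrow> closes a b (d \<oplus> a) (d \<oplus> b) n \<longleftrightarrow> N d n"
    and dist: "\<And>d d'. \<lbrakk>d \<noteq> East; d' \<noteq> East; d \<noteq> d'\<rbrakk> \<Longrightarrow> \<exists>n. N d n \<noteq> N d' n"
    and A: "colour_aut \<pi> \<sigma>"
  shows "\<exists>c. \<pi> = (\<oplus>) c"
proof -
  have inj: "\<pi> j = \<pi> k \<longleftrightarrow> j = k" for j k
    using A by (simp add: colour_aut_def bij_def inj_eq)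
  have "\<pi> d = \<pi> East \<oplus> d" for d
  proof (cases "d = East")
    case False
    obtain b where b: "b \<noteq> East" "b \<noteq> d" by (cases d) auto
    define d' where "d' = \<pi> East \<oplus> \<pi> d"
    have d': "d' \<noteq> East" "\<pi> d = d' \<oplus> \<pi> East"
      using False inj by (auto simp: d'_def kadd_commute)
    have "d \<oplus> b \<noteq> East" "d \<oplus> b \<noteq> d" "d \<oplus> b \<noteq> b" using b False by auto
    then have "\<pi> (d \<oplus> b) = d' \<oplus> \<pi> b"
      by (intro opposite_pair[of d' _ "\<pi> East"]) (use d' b inj in \<open>auto simp flip: d'(2)\<close>)
    then have "closes (\<pi> East) (\<pi> b) (\<pi> d) (\<pi> (d \<oplus> b)) n \<longleftrightarrow> N d' n" for n
      unfolding d'(2) using N[OF d'(1), of "\<pi> b" "\<pi> East"] b inj d'(2) by metis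
    moreover have "closes East b d (d \<oplus> b) n \<longleftrightarrow> N d n" for n
      using N[OF False, of b East] b by simp
    ultimately have "N d' n \<longleftrightarrow> N d n" for n using closes_colour_aut[OF A] by metis
    then have "d' = d" using dist[OF d'(1) False] by blast
    with d'(2) show ?thesis by (simp add: kadd_commute)
  qed simp
  then show ?thesis by blast
qed

end

section \<open>Rose Window graphs as quotients of a lattice\<close>

lemma sum_colour: "(\<Sum>c\<in>UNIV. f c) = f East + f North + f West + f South"
  for f :: "colour \<Rightarrow> 'a::comm_monoid_add"
  by (simp add: UNIV_colour add.assoc)

type_synonym vec = "colour \<Rightarrow> int"

definition unit :: "colour \<Rightarrow> vec" where
  "unit c = (\<lambda>x. of_bool (x = c))"

definition csum :: "vec \<Rightarrow> int" where
  "csum k = k East + k North + k West + k South"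

lemma csum_simps [simp]:
  "csum (k + l) = csum k + csum l"
  "csum (k - l) = csum k - csum l"
  "csum (- k) = - csum k"
  "csum 0 = 0"
  "csum (unit c) = 1"
  "csum (k \<circ> (\<oplus>) d) = csum k"
  by (cases d; cases c; simp add: csum_def unit_def)+

lemma unit_apply [simp]: "unit c x = of_bool (x = c)"
  by (simp add: unit_def)

lemma unit_klein [simp]: "unit c \<circ> (\<oplus>) d = unit (d \<oplus> c)"
proof
  fix x show "(unit c \<circ> (\<oplus>) d) x = unit (d \<oplus> c) x"
    by (cases d; cases x; cases c; simp)
qed

text \<open>The case $r = 1$ is \<open>q = 1\<close>; the case $r = m - 1$ is \<open>q = m + 1\<close>, so that the neighbours of $y_i$ on its
  rim are $y_{i \pm q}$ and \<open>q\<close> is 1 modulo \<open>m\<close> in both cases.\<close>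

locale rose_window =
  fixes m b :: nat and q :: int
  assumes m2: "2 < m" and b0: "0 < b" and bm: "b < m"
    and q: "q = 1 \<or> even m \<and> odd b \<and> q = int m + 1"
begin

definition vt :: "bool \<times> int \<Rightarrow> bool \<times> nat" where
  "vt p = (fst p, nat (snd p mod (2 * int m)))"

text \<open>Place $x_i$ at the grid point $(i,0)$ and $y_i$ at $(i,1)$. At an even grid point \<open>stepZ c\<close> moves in the
  direction \<open>c\<close>, at an odd one in the opposite direction, which makes it an involution.\<close>

fun stepZ :: "colour \<Rightarrow> bool \<times> int \<Rightarrow> bool \<times> int" where
  "stepZ East (c, i) = (c, if even i \<noteq> c then i + (if c then q else 1) else i - (if c then q else 1))"
| "stepZ West (c, i) = (c, if even i \<noteq> c then i - (if c then q else 1) else i + (if c then q else 1))"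
| "stepZ North (c, i) = (\<not> c, if even i \<noteq> c then (if c then i + 2 * int b else i) else (if c then i else i - 2 * int b))"
| "stepZ South (c, i) = (\<not> c, if even i \<noteq> c then (if c then i else i - 2 * int b) else (if c then i + 2 * int b else i))"

definition step :: "colour \<Rightarrow> bool \<times> nat \<Rightarrow> bool \<times> nat" where
  "step c v = vt (stepZ c (fst v, int (snd v)))"

abbreviation V :: "(bool \<times> nat) set" where "V \<equiv> rw_V (2 * m)"

lemma vt_in: "vt p \<in> V"
  using m2 by (simp add: vt_def rw_V_def nat_less_iff)

lemma vt_surj: "v \<in> V \<Longrightarrow> vt (fst v, int (snd v)) = v"
  by (cases v) (auto simp: vt_def rw_V_def)

lemma vt_eq_iff: "vt p = vt p' \<longleftrightarrow> fst p = fst p' \<and> 2 * int m dvd snd p - snd p'"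
proof -
  have "nat (i mod (2 * int m)) = nat (j mod (2 * int m)) \<longleftrightarrow> 2 * int m dvd i - j" for i j
    using m2 by (simp add: eq_nat_nat_iff mod_eq_dvd_iff)
  then show ?thesis by (simp add: vt_def)
qed

lemma qodd: "odd q"
  using q by auto

text \<open>\<open>q - 1\<close> is 0 or \<open>m\<close>, so replacing unit steps by steps of
  length \<open>q\<close> is felt modulo \<open>2 * m\<close> only through the parity of their
  number.\<close>

lemma q_dvd: "2 * int m dvd (q - 1) * 2"
  using q by auto

lemma step_vt: "step c (vt p) = vt (stepZ c p)"
proof -
  obtain d i where p: "p = (d, i)" by (cases p)
  define j where "j = i mod (2 * int m)"
  have "2 * int m dvd i - j" by (simp add: j_def minus_mod_eq_mult_div)
  then obtain z where z: "i = j + 2 * int m * z" by (metis dvdE diff_eq_eq add.commute)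
  have ev: "even i \<longleftrightarrow> even j" by (simp add: z)
  have "vt (stepZ c (d, j)) = vt (stepZ c (d, i))"
    by (cases c; cases d) (auto simp: vt_eq_iff ev; simp add: z)+
  moreover have "int (nat (i mod (2 * int m))) = j" using m2 by (simp add: j_def)
  ultimately show ?thesis by (simp add: step_def p vt_def[of "(d, i)"])
qed

text \<open>A walk from $x_0$ uses the colours alternately with sign $+1$ and $-1$, and only the
  resulting vector of signed colour counts (of total 0 or 1) matters for its end.\<close>

definition posn :: "vec \<Rightarrow> bool \<times> int" where
  "posn k = (odd (k North - k South),
     k East - k West + 2 * int b * ((k North - k South) div 2) + (1 - q) * ((k East + k West) div 2))"

definition at :: "vec \<Rightarrow> bool \<times> nat" where "at k = vt (posn k)"

text \<open>The lattice of closed walks. Evenness of the vertical part says that the walk ends on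
  the rim where it began; the term with \<open>1 - q\<close> accounts for the steps of length
  \<open>q\<close>.\<close>

definition lam :: "vec \<Rightarrow> bool" where
  "lam k \<longleftrightarrow> csum k = 0 \<and> even (k North - k South) \<and>
     2 * int m dvd k East - k West + (k North - k South) * int b + (1 - q) * ((k East + k West) div 2)"

lemma at_in: "at k \<in> V"
  by (simp add: at_def vt_in)

lemma posn_parity: 
  "csum k = 0 \<Longrightarrow> even (snd (posn k)) \<noteq> fst (posn k)"
  "csum k = 1 \<Longrightarrow> even (snd (posn k)) = fst (posn k)"
  unfolding posn_def csum_def using qodd by simp_all presburger+

lemma div_2_pred: "(t * 2 - 1) div 2 = t - 1" for t :: int
  by presburger

lemma step_at_0:
  assumes "csum k = 0"
  shows "step c (at k) = at (k + unit c)"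
proof -
  obtain d i where p: "posn k = (d, i)" by (cases "posn k")
  have ev: "even i \<noteq> d" using posn_parity(1)[OF assms] p by simp
  have "vt (stepZ c (d, i)) = vt (posn (k + unit c))"
  proof (cases "even (k North - k South)")
    case True
    define t where "t = (k North - k South) div 2"
    define u where "u = (k East + k West) div 2"
    have k: "k North = t - u" "k South = - u - t" "k West = 2 * u - k East"
      using True assms unfolding t_def u_def csum_def by presburger+
    have d: "d = False" "i = 2 * k East - 2 * u + 2 * int b * t + (1 - q) * u"
      using p by (auto simp: posn_def k)
    show ?thesis using ev q_dvd unfolding d
      by (cases c) (auto simp: vt_eq_iff posn_def k algebra_simps div_2_pred)
  next
    case False
    \<comment> \<open>On this rim a horizontal step also changes
      \<open>(k East + k West) div 2\<close>, unlike on the other rim. An eastward step thus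
      contributes \<open>1 + (1 - q)\<close>, which agrees with \<open>q\<close> by
      \<open>q_dvd\<close>.\<close>
    define t where "t = (k North - k South) div 2"
    define u where "u = (k East + k West) div 2"
    have k: "k North = t - u" "k South = - u - t - 1" "k West = 2 * u + 1 - k East"
      using False assms unfolding t_def u_def csum_def by presburger+
    have d: "d = True" "i = 2 * k East - 2 * u - 1 + 2 * int b * t + (1 - q) * u"
      using p by (auto simp: posn_def k)
    show ?thesis using ev q_dvd unfolding d
      by (cases c) (auto simp: vt_eq_iff posn_def k algebra_simps div_2_pred)
  qed
  then show ?thesis by (simp add: at_def step_vt p)
qed

lemma step_at_1:
  assumes "csum k = 1"
  shows "step c (at k) = at (k - unit c)"
proof -
  obtain d i where p: "posn k = (d, i)" by (cases "posn k")
  have ev: "even i = d" using posn_parity(2)[OF assms] p by simp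
  have "vt (stepZ c (d, i)) = vt (posn (k - unit c))"
  proof (cases "even (k North - k South)")
    case True
    define t where "t = (k North - k South) div 2"
    define u where "u = (k East + k West) div 2"
    have k: "k North = t - u" "k South = - u - t" "k West = 2 * u + 1 - k East"
      using True assms unfolding t_def u_def csum_def by presburger+
    have d: "d = False" "i = 2 * k East - 2 * u - 1 + 2 * int b * t + (1 - q) * u"
      using p by (auto simp: posn_def k)
    show ?thesis using ev q_dvd unfolding d
      by (cases c) (auto simp: vt_eq_iff posn_def k algebra_simps div_2_pred)
  next
    case False
    define t where "t = (k North - k South) div 2"
    define u where "u = (k East + k West) div 2"
    have k: "k North = t - u + 1" "k South = - u - t" "k West = 2 * u - k East"
      using False assms unfolding t_def u_def csum_def by presburger+
    have d: "d = True" "i = 2 * k East - 2 * u + 2 * int b * t + (1 - q) * u"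
      using p by (auto simp: posn_def k)
    show ?thesis using ev q_dvd unfolding d
      by (cases c) (auto simp: vt_eq_iff posn_def k algebra_simps div_2_pred)
  qed
  then show ?thesis by (simp add: at_def step_vt p)
qed

lemma at_eq_iff:
  assumes "csum k = csum l"
  shows "at k = at l \<longleftrightarrow> lam (k - l)"
proof (cases "even ((k North - k South) - (l North - l South))")
  case True
  then obtain h where h: "k North - k South = l North - l South + 2 * h"
    by (metis add.commute diff_eq_eq dvdE)
  have "even ((k East + k West) - (l East + l West))"
    using assms True unfolding csum_def by presburger
  then obtain g where g: "k East + k West = l East + l West + 2 * g"
    by (metis add.commute diff_eq_eq dvdE)
  have h': "(k North - l North) - (k South - l South) = 2 * h"
    and g': "(k East - l East) + (k West - l West) = 2 * g" using h g by simp_all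
  have h2: "(l North - l South + 2 * h) div 2 = (l North - l South) div 2 + h"
    "(l East + l West + 2 * g) div 2 = (l East + l West) div 2 + g" by simp_all
  have "csum (\<lambda>x. k x - l x) = 0" using assms csum_simps(2)[of k l] by (simp add: fun_diff_def)
  then show ?thesis
    unfolding at_def vt_eq_iff posn_def lam_def h g csum_simps fst_conv snd_conv h2 fun_diff_def h' g'
    by (simp add: algebra_simps)
next
  case False
  then show ?thesis by (auto simp: at_def vt_eq_iff posn_def lam_def)
qed

lemma at_neq:
  assumes "csum k = 0" "csum l = 1"
  shows "at k \<noteq> at l"
proof
  assume "at k = at l"
  then have *: "fst (posn k) = fst (posn l)" "2 * int m dvd snd (posn k) - snd (posn l)"
    by (simp_all add: at_def vt_eq_iff)
  then have "even (snd (posn k) - snd (posn l))" by (meson dvd_mult_left)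
  then show False using * posn_parity assms by auto
qed

lemma at_surj:
  assumes "v \<in> V"
  obtains k where "csum k = 0 \<or> csum k = 1" "v = at k"
proof -
  obtain c i where v: "v = vt (c, i)" using vt_surj[OF assms] by metis
  \<comment> \<open>A vector with at most one vertical step is enough. \<open>w\<close> brings the
    total to 0 or 1. The quotient by 2 in \<open>posn\<close> is then 0, except at an odd point of
    the rim of the \<open>y\<close>, where it is -1; there \<open>j\<close> compensates for the
    extra \<open>q - 1\<close>.\<close>
  define j where "j = (if c \<and> odd i then i + 1 - q else i)"
  define w where "w = (if \<not> c then - (i div 2) else if even i then - (i div 2) else - ((i + 2 - q) div 2))"
  define k :: vec where "k = (\<lambda>x. case x of East \<Rightarrow> j + w | North \<Rightarrow> of_bool c | West \<Rightarrow> w | South \<Rightarrow> 0)"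
  have "posn k = (c, i) \<and> (csum k = 0 \<or> csum k = 1)"
  proof -
    consider "\<not> c" "even i" | "\<not> c" "odd i" | "c" "even i" | "c" "odd i" by blast
    then show ?thesis
    proof cases
      case 4
      with qodd have "even (i + 2 - q)" by simp
      then obtain h where "i + 2 - q = 2 * h" by blast
      then have h: "i = 2 * h - 2 + q" by simp
      then show ?thesis using 4 by (simp add: posn_def k_def csum_def j_def w_def h)
    qed (auto simp: posn_def k_def csum_def j_def w_def elim!: evenE oddE)
  qed
  then show thesis using that[of k] v by (auto simp: at_def)
qed

lemma lam_unit: "\<not> lam (unit c - unit d)" if "c \<noteq> d"
proof -
  have 1: "\<not> 2 * int m dvd 2" "\<not> 2 * int m dvd - 2"
    using m2 zdvd_imp_le[of "2 * int m" 2] by auto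
  have 2: "\<not> 2 * int m dvd 2 * int b" "\<not> 2 * int m dvd - (2 * int b)"
    using b0 bm zdvd_imp_le[of "2 * int m" "2 * int b"] by auto
  show ?thesis using that 1 2 by (cases c; cases d; simp add: lam_def)
qed

lemma lam_0 [simp]: "lam 0"
  by (simp add: lam_def)

lemma lam_even:
  assumes "lam k"
  shows "csum k = 0" "even (k North - k South)" "even (k East - k West)" "even (k East + k West)"
proof -
  show 1: "csum k = 0" "even (k North - k South)" using assms by (simp_all add: lam_def)
  then show "even (k East - k West)" "even (k East + k West)" unfolding csum_def by presburger+
qed

lemma lam_uminus [simp]: "lam (- k) \<longleftrightarrow> lam k"
proof -
  have "lam (- k)" if lk: "lam k" for k
  proof -
    obtain u where u: "k East + k West = 2 * u" using lam_even(4)[OF lk] by blast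
    then have "- k East - k West = 2 * - u" by simp
    then have "(- k East - k West) div 2 = - u" by simp
    moreover have "2 * int m dvd k East - k West + (k North - k South) * int b + (1 - q) * u"
      using lk u by (simp add: lam_def)
    then have "2 * int m dvd - (k East - k West + (k North - k South) * int b + (1 - q) * u)"
      by (simp only: dvd_minus_iff)
    ultimately show ?thesis using lk by (simp add: lam_def algebra_simps)
  qed
  from this[of k] this[of "- k"] show ?thesis by auto
qed

section \<open>The colour steps trace exactly the edges of the Rose Window graph\<close>

lemma edges_int:
  "colour_edges V step = {{vt (False, i), vt (False, i + 1)} | i. True} \<union>
    {{vt (True, i), vt (True, i + q)} | i. True} \<union> {{vt (False, i), vt (True, i)} | i. True} \<union>
    {{vt (False, i), vt (True, i - 2 * int b)} | i. True}" (is "_ = ?A \<union> ?B \<union> ?C \<union> ?D")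
proof (intro subset_antisym subsetI)
  fix e assume "e \<in> colour_edges V step"
  then obtain v k where v: "v \<in> V" "e = {v, step k v}" by (auto simp: colour_edges_def)
  obtain c i where "v = vt (c, i)" using vt_surj[OF v(1)] by metis
  with v(2) have e: "e = {vt (c, i), vt (stepZ k (c, i))}" by (simp add: step_vt)
  have "{vt (False, i), vt (False, i - 1)} \<in> ?A" for i
    by (rule CollectI, rule exI[of _ "i - 1"]) auto
  moreover have "{vt (True, i), vt (True, i - q)} \<in> ?B" for i
    by (rule CollectI, rule exI[of _ "i - q"]) auto
  moreover have "{vt (True, i), vt (False, i)} \<in> ?C" for i by auto
  moreover have "{vt (True, i), vt (False, i + 2 * int b)} \<in> ?D" for i
    by (rule CollectI, rule exI[of _ "i + 2 * int b"]) auto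
  ultimately show "e \<in> ?A \<union> ?B \<union> ?C \<union> ?D"
    unfolding e by (cases k; cases c; cases "even i") auto
next
  have mem: "{vt p, vt (stepZ k p)} \<in> colour_edges V step" for p k
    using vt_in[of p] unfolding colour_edges_def step_vt[symmetric] by blast
  fix e assume "e \<in> ?A \<union> ?B \<union> ?C \<union> ?D"
  then obtain i where "e = {vt (False, i), vt (False, i + 1)} \<or> e = {vt (True, i), vt (True, i + q)}
      \<or> e = {vt (False, i), vt (True, i)} \<or> e = {vt (False, i), vt (True, i - 2 * int b)}" by blast
  then show "e \<in> colour_edges V step"
    using mem[of "(False, i)" East] mem[of "(False, i)" West] mem[of "(False, i)" North]
      mem[of "(False, i)" South] mem[of "(True, i)" East] mem[of "(True, i)" West]
    by (cases "even i") auto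
qed

lemma connected_V: "connected_graph V (colour_edges V step)"
proof -
  let ?R = "{(x, y). {x, y} \<in> colour_edges V step}"
  have sym: "sym (?R\<^sup>*)" by (rule sym_rtrancl) (auto simp: sym_def insert_commute)
  have 1: "(vt (False, 0), vt (False, int i)) \<in> ?R\<^sup>*" for i
  proof (induction i)
    case (Suc i)
    have "(vt (False, int i), vt (False, int (Suc i))) \<in> ?R"
      unfolding edges_int by (auto simp: add.commute)
    with Suc show ?case by (rule rtrancl_into_rtrancl)
  qed simp
  have 2: "(vt (False, int i), vt (True, int i)) \<in> ?R" for i
    unfolding edges_int by auto
  have 3: "(vt (False, 0), v) \<in> ?R\<^sup>*" if "v \<in> V" for v
  proof (cases "fst v")
    case True
    have "(vt (False, 0), vt (True, int (snd v))) \<in> ?R\<^sup>*"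
      by (rule rtrancl_into_rtrancl[OF 1 2])
    then show ?thesis using vt_surj[OF that] True by simp
  next
    case False
    then show ?thesis using 1[of "snd v"] vt_surj[OF that] by simp
  qed
  show ?thesis unfolding connected_graph_def
  proof (intro conjI ballI)
    show "V \<noteq> {}" using vt_in by blast
    fix u v assume "u \<in> V" "v \<in> V"
    with 3 sym show "(u, v) \<in> ?R\<^sup>*" by (meson rtrancl_trans symD)
  qed
qed

sublocale four_coloured V step
proof
  show "finite V" by (rule finite_subset[of _ "UNIV \<times> {..<2 * m}"]) (auto simp: rw_V_def)
  show "connected_graph V (colour_edges V step)" by (rule connected_V)
  fix v i j assume "v \<in> V"
  then obtain k where k: "csum k = 0 \<or> csum k = 1" "v = at k" using at_surj by blast
  show "step i v \<in> V" by (simp add: step_def vt_in)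
  show "step i (step i v) = v" using k by (auto simp: step_at_0 step_at_1)
  show "step i v \<noteq> v"
    using k at_neq[of k "k + unit i"] at_neq[of "k - unit i" k]
    by (auto simp: step_at_0 step_at_1 dest: sym)
  have *: "at (k + unit i) = at (k + unit j) \<longleftrightarrow> i = j" "at (k - unit i) = at (k - unit j) \<longleftrightarrow> i = j"
    using lam_unit[of i j] lam_unit[of j i] by (auto simp: at_eq_iff)
  then show "step i v = step j v \<longleftrightarrow> i = j"
    using k by (auto simp: step_at_0 step_at_1)
qed

lemma rw_E_eq:
  assumes r: "r = 1 \<and> q = 1 \<or> r = m - 1 \<and> q = int m + 1"
  shows "rw_E (2 * m) (2 * b) r = E"
proof -
  let ?n = "2 * m"
  have vt: "(c, i) = vt (c, int i)" if "i < ?n" for c i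
    using that by (simp add: vt_def)
  have vt': "(c, i mod ?n) = vt (c, int i)" for c i
    by (simp add: vt_def nat_mod_as_int)
  have vtr: "vt (c, i) = vt (c, int (nat (i mod (2 * int m))))" for c i
    using m2 by (simp add: vt_eq_iff minus_mod_eq_mult_div)
  have "rw_E ?n (2 * b) r = (\<Union>i\<in>{..<?n}. {{vt (False, int i), vt (False, int i + 1)},
      {vt (True, int i), vt (True, int i + int r)}, {vt (False, int i), vt (True, int i)},
      {vt (False, int i), vt (True, int i - 2 * int b)}})"
  proof -
    have "vt (True, int (i + ?n - 2 * b)) = vt (True, int i - 2 * int b)" for i
      using bm by (simp add: vt_eq_iff of_nat_diff)
    then show ?thesis unfolding rw_E_def vt' by (intro SUP_cong) (auto simp: vt add.commute)
  qed
  also have "\<dots> = (\<Union>i. {{vt (False, i), vt (False, i + 1)},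
      {vt (True, i), vt (True, i + int r)}, {vt (False, i), vt (True, i)},
      {vt (False, i), vt (True, i - 2 * int b)}})" (is "_ = (\<Union>i. ?S i)")
  proof (intro subset_antisym subsetI)
    fix e assume "e \<in> (\<Union>i. ?S i)"
    then obtain i where i: "e \<in> ?S i" by blast
    define j where "j = nat (i mod (2 * int m))"
    have "2 * int m dvd i - int j" using m2 by (simp add: j_def minus_mod_eq_mult_div)
    then have "vt (c, i + x) = vt (c, int j + x)" for c x by (simp add: vt_eq_iff)
    from this[of _ 0] this[of _ 1] this[of _ "int r"] this[of _ "- 2 * int b"]
    have "?S i = ?S (int j)" by simp
    moreover have "j < ?n" using m2 by (simp add: j_def nat_less_iff)
    ultimately show "e \<in> (\<Union>i\<in>{..<?n}. ?S (int i))" using i by blast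
  qed blast
  also have "\<dots> = E"
  proof -
    \<comment> \<open>For \<open>r = m - 1\<close> one has \<open>r + q = 2 * m\<close>, so steps by
      \<open>r\<close> and by \<open>q\<close> are each other's reversals.\<close>
    have "{{vt (True, i), vt (True, i + int r)} | i. True} = {{vt (True, i), vt (True, i + q)} | i. True}"
    proof (cases "r = 1 \<and> q = 1")
      case False
      then have rq: "int r = int m - 1" "q = int m + 1" using r m2 by auto
      have "{vt (True, i), vt (True, i + int r)} = {vt (True, i + int r), vt (True, i + int r + q)}" for i
        using rq by (auto simp: vt_eq_iff)
      moreover have "{vt (True, i), vt (True, i + q)} = {vt (True, i + q), vt (True, i + q + int r)}" for i
        using rq by (auto simp: vt_eq_iff)
      ultimately show ?thesis by blast
    qed simp
    moreover have "(\<Union>i. {f i, g i, h i, k i}) =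
        {f i | i. True} \<union> {g i | i. True} \<union> {h i | i. True} \<union> {k i | i. True}"
      for f g h k :: "int \<Rightarrow> (bool \<times> nat) set" by blast
    ultimately show ?thesis unfolding edges_int by simp
  qed
  finally show ?thesis .
qed

end

section \<open>Automorphisms\<close>

text \<open>Multiplying by \<open>x - t * B\<close> and using B^2 = 1 or -1 gives that
  \<open>h\<close> divides x^2 - t^2 or x^2 + t^2. Absolute values 1 and 1 lead back to
  \<open>B - 1\<close> or \<open>B + 1\<close>; absolute values 1 and 2 leave a divisor of 3 or 5.
  The value 5 really is exceptional: 5 divides 1 + 2 B for B = 2.\<close>

lemma unit_dvd_cases:
  fixes h B x t :: int
  assumes h: "2 < h" and B: "h dvd B\<^sup>2 - 1 \<or> h dvd B\<^sup>2 + 1"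
    and B1: "\<not> h dvd B - 1" "\<not> h dvd B + 1" and xt: "h dvd x + t * B"
    and small: "\<bar>x\<bar> + \<bar>t\<bar> \<le> 2 \<or> 4 \<le> h \<and> h \<noteq> 5 \<and> \<bar>x\<bar> + \<bar>t\<bar> \<le> 3"
  shows "x = 0 \<and> t = 0"
proof -
  have lt: "\<bar>x\<bar> + \<bar>t\<bar> < h" using small h by auto
  have unit: "h dvd y" if "h dvd y * B\<^sup>2" for y
  proof -
    have "y = y * B\<^sup>2 - y * (B\<^sup>2 - 1)" "y = y * (B\<^sup>2 + 1) - y * B\<^sup>2" by (simp_all add: algebra_simps)
    then show ?thesis using B that by (metis dvd_diff dvd_mult)
  qed
  have small0: "y = 0" if "h dvd y" "\<bar>y\<bar> < h" for y
    using that dvd_imp_le_int[of y h] by linarith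
  have t0: "t = 0" if "x = 0"
  proof -
    have "h dvd t * B * B" using xt that by simp
    then have "h dvd t * B\<^sup>2" by (simp add: power2_eq_square mult.assoc)
    then have "h dvd t" by (rule unit)
    then show ?thesis using lt by (intro small0) auto
  qed
  have x0: "x = 0" if "t = 0"
    using xt that lt by (intro small0) auto
  have False if nz: "x \<noteq> 0" "t \<noteq> 0"
  proof -
    have sq: "h dvd x\<^sup>2 - t\<^sup>2 * B\<^sup>2"
      using dvd_mult[OF xt, of "x - t * B"] by (simp add: power2_eq_square algebra_simps)
    have "x\<^sup>2 - t\<^sup>2 = (x\<^sup>2 - t\<^sup>2 * B\<^sup>2) + t\<^sup>2 * (B\<^sup>2 - 1)"
         "x\<^sup>2 + t\<^sup>2 = (x\<^sup>2 - t\<^sup>2 * B\<^sup>2) + t\<^sup>2 * (B\<^sup>2 + 1)"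
      by (simp_all add: algebra_simps)
    then have sq': "h dvd x\<^sup>2 - t\<^sup>2 \<or> h dvd x\<^sup>2 + t\<^sup>2"
      using B sq by (metis dvd_add dvd_mult)
    have "\<bar>x\<bar> = 1 \<and> \<bar>t\<bar> = 1 \<or> (4 \<le> h \<and> h \<noteq> 5 \<and> (\<bar>x\<bar> = 1 \<and> \<bar>t\<bar> = 2 \<or> \<bar>x\<bar> = 2 \<and> \<bar>t\<bar> = 1))"
      using small nz by linarith
    then show False
    proof (elim disjE conjE)
      assume "\<bar>x\<bar> = 1" "\<bar>t\<bar> = 1"
      then have "x + t * B = B + 1 \<or> x + t * B = B - 1 \<or> x + t * B = - (B + 1) \<or> x + t * B = - (B - 1)"
        by (auto simp: abs_if split: if_splits)
      then show False using xt B1 by (metis dvd_minus_iff)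
    next
      assume *: "4 \<le> h" "h \<noteq> 5" "\<bar>x\<bar> = 1" "\<bar>t\<bar> = 2"
      have "x\<^sup>2 = \<bar>x\<bar>\<^sup>2" "t\<^sup>2 = \<bar>t\<bar>\<^sup>2" by simp_all
      then have "x\<^sup>2 = 1" "t\<^sup>2 = 4" unfolding * by simp_all
      with sq' have "h dvd 3 \<or> h dvd 5" by auto
      then show False using * zdvd_imp_le[of h 3] zdvd_imp_le[of h 5] by (cases "h = 4") auto
    next
      assume *: "4 \<le> h" "h \<noteq> 5" "\<bar>x\<bar> = 2" "\<bar>t\<bar> = 1"
      have "x\<^sup>2 = \<bar>x\<bar>\<^sup>2" "t\<^sup>2 = \<bar>t\<bar>\<^sup>2" by simp_all
      then have "x\<^sup>2 = 4" "t\<^sup>2 = 1" unfolding * by simp_all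
      with sq' have "h dvd 3 \<or> h dvd 5" by auto
      then show False using * zdvd_imp_le[of h 3] zdvd_imp_le[of h 5] by (cases "h = 4") auto
    qed
  qed
  with t0 x0 show ?thesis by blast
qed

context four_coloured
begin

text \<open>The image is closed under all steps, so connectedness makes the map surjective, and
  finiteness makes it injective.\<close>

lemma colour_autI:
  assumes \<pi>: "bij \<pi>" and V: "\<And>v. v \<in> V \<Longrightarrow> \<sigma> v \<in> V"
    and s: "\<And>v i. v \<in> V \<Longrightarrow> \<sigma> (s i v) = s (\<pi> i) (\<sigma> v)"
  shows "colour_aut \<pi> \<sigma>"
proof -
  obtain v0 where v0: "v0 \<in> V" using V_ne by blast
  have "v \<in> \<sigma> ` V" if "v \<in> V" for v
    using V[OF v0] that
  proof (induction rule: conn_induct)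
    case base
    show ?case using v0 by blast
  next
    case (step x i)
    then obtain u where u: "u \<in> V" "x = \<sigma> u" by blast
    obtain j where "i = \<pi> j" using \<pi> by (metis bij_pointE)
    then have "s i x = \<sigma> (s j u)" using s u by simp
    then show ?case using s_in[OF u(1)] by blast
  qed
  then have sub: "V \<subseteq> \<sigma> ` V" by blast
  then have "inj_on \<sigma> V" by (rule finite_surj_inj[OF finV])
  then have "bij_betw \<sigma> V V" using sub V by (auto simp: bij_betw_def)
  then show ?thesis using \<pi> s by (simp add: colour_aut_def)
qed

end

text \<open>Up to sign, the vector of every alternating word \<open>a\<close>, \<open>b\<close>,
  \<open>d \<oplus> a\<close>, \<open>d \<oplus> b\<close>; for \<open>West\<close> it is the
  boundary of a unit square of the grid.\<close>

definition klein_sign :: "colour \<Rightarrow> vec" where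
  "klein_sign d = (\<lambda>x. if x = East \<or> x = d then 1 else - 1)"

lemma klein_sign_word:
  assumes "d \<noteq> East" "b \<noteq> a" "b \<noteq> d \<oplus> a"
  shows "unit a - unit b + unit (d \<oplus> a) - unit (d \<oplus> b) = klein_sign d \<or>
    unit a - unit b + unit (d \<oplus> a) - unit (d \<oplus> b) = - klein_sign d"
  using assms
  by (cases d; cases a; cases b; simp add: fun_eq_iff all_colour klein_sign_def)

text \<open>A multiple of \<open>klein_sign d\<close> has equal entries at \<open>x\<close> and
  \<open>d \<oplus> x\<close>. So the negative entries at \<open>i\<close> and \<open>l\<close> are
  partners, and likewise the positive ones at \<open>j\<close> and \<open>k\<close>.\<close>

lemma klein_sign_units:
  assumes "d \<noteq> East" "j \<noteq> i" "k \<noteq> i"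
    and eq: "unit j + unit k - unit i - unit l = (\<lambda>x. g * klein_sign d x)"
  shows "j \<noteq> d \<oplus> i \<and> k = d \<oplus> j"
proof -
  define f :: vec where "f = unit j + unit k - unit i - unit l"
  have f: "f x = of_bool (x = j) + of_bool (x = k) - of_bool (x = i) - of_bool (x = l)" for x
    by (simp add: f_def)
  have "klein_sign d (d \<oplus> x) = klein_sign d x" for x
    by (cases d; cases x; simp add: klein_sign_def)
  then have opp: "f (d \<oplus> x) = f x" for x
    using fun_cong[OF eq] unfolding f_def by metis
  have "f i < 0" using f[of i] assms(2,3) by simp
  then have "f (d \<oplus> i) < 0" using opp by simp
  moreover have "d \<oplus> i \<noteq> i" using assms(1) by simp
  ultimately have l: "d \<oplus> i = l" "d \<oplus> i \<noteq> j"
    using f[of "d \<oplus> i"] by (auto simp: of_bool_def split: if_splits)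
  then have "f j > 0" using f[of j] assms(2,3) by auto
  then have "f (d \<oplus> j) > 0" using opp by simp
  moreover have "d \<oplus> j \<noteq> j" using assms(1) by simp
  ultimately have "d \<oplus> j = k"
    using f[of "d \<oplus> j"] by (auto simp: of_bool_def split: if_splits)
  with l(2) show ?thesis by auto
qed

context rose_window
begin

text \<open>Automorphisms are defined on vectors and then descend to the quotient. The two classes
  of the bipartition are represented by totals 0 and 1, and \<open>wd\<close> makes the choice of a
  representative harmless.\<close>

lemma colour_aut_vec:
  assumes \<pi>: "bij \<pi>" and valid: "\<And>k. csum k = 0 \<or> csum k = 1 \<Longrightarrow> csum (f k) = 0 \<or> csum (f k) = 1"
    and wd: "\<And>k l. \<lbrakk>csum k = csum l; lam (k - l)\<rbrakk> \<Longrightarrow> csum (f k) = csum (f l) \<and> lam (f k - f l)"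
    and st0: "\<And>k c. csum k = 0 \<Longrightarrow> at (f (k + unit c)) = step (\<pi> c) (at (f k))"
    and st1: "\<And>k c. csum k = 1 \<Longrightarrow> at (f (k - unit c)) = step (\<pi> c) (at (f k))"
  obtains \<sigma> where "colour_aut \<pi> \<sigma>" "\<And>k. csum k = 0 \<or> csum k = 1 \<Longrightarrow> \<sigma> (at k) = at (f k)"
proof -
  define \<sigma> where "\<sigma> v = at (f (SOME k. (csum k = 0 \<or> csum k = 1) \<and> at k = v))" for v
  have \<sigma>: "\<sigma> (at k) = at (f k)" if k: "csum k = 0 \<or> csum k = 1" for k
  proof -
    define l where "l = (SOME l. (csum l = 0 \<or> csum l = 1) \<and> at l = at k)"
    have l: "csum l = 0 \<or> csum l = 1" "at l = at k"
      using someI[of "\<lambda>l. (csum l = 0 \<or> csum l = 1) \<and> at l = at k" k] k by (auto simp: l_def)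
    then have "csum l = csum k" using k at_neq by metis
    then have "csum (f l) = csum (f k)" "lam (f l - f k)" using l(2) wd[of l k] at_eq_iff by auto
    then show ?thesis using at_eq_iff by (simp add: \<sigma>_def l_def)
  qed
  have "colour_aut \<pi> \<sigma>"
  proof (rule colour_autI[OF \<pi>])
    fix v assume "v \<in> V"
    then obtain k where k: "csum k = 0 \<or> csum k = 1" "v = at k" using at_surj by blast
    then show "\<sigma> v \<in> V" using \<sigma> at_in by simp
    fix i
    from k(1) show "\<sigma> (step i v) = step (\<pi> i) (\<sigma> v)"
    proof
      assume "csum k = 0"
      then show ?thesis using k(2) \<sigma>[of "k + unit i"] \<sigma>[of k] st0 by (simp add: step_at_0)
    next
      assume "csum k = 1"
      then show ?thesis using k(2) \<sigma>[of "k - unit i"] \<sigma>[of k] st1 by (simp add: step_at_1)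
    qed
  qed
  with \<sigma> that show thesis by blast
qed

lemma kadd_East_fun: "(\<oplus>) East = id"
  by (rule ext) simp

text \<open>Inside a class of the bipartition translations suffice. Between the classes the point
  reflection \<open>k + l - x\<close> is needed: it exchanges totals 0 and 1, and with them the
  signs of the steps.\<close>

lemma colour_preserving_transitive:
  assumes "u \<in> V" "v \<in> V"
  obtains \<sigma> where "colour_aut ((\<oplus>) East) \<sigma>" "\<sigma> u = v"
proof -
  obtain k l where k: "csum k = 0 \<or> csum k = 1" "u = at k" and l: "csum l = 0 \<or> csum l = 1" "v = at l"
    using at_surj assms by metis
  show thesis
  proof (cases "csum k = csum l")
    case True
    obtain \<sigma> where \<sigma>: "colour_aut ((\<oplus>) East) \<sigma>"
        "\<And>x. csum x = 0 \<or> csum x = 1 \<Longrightarrow> \<sigma> (at x) = at (x + (l - k))"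
    proof (rule colour_aut_vec[of "(\<oplus>) East" "\<lambda>x. x + (l - k)"])
      show "at (x + unit c + (l - k)) = step (East \<oplus> c) (at (x + (l - k)))" if "csum x = 0" for x c
        using that True step_at_0[of "x + (l - k)" c] by (simp add: algebra_simps)
      show "at (x - unit c + (l - k)) = step (East \<oplus> c) (at (x + (l - k)))" if "csum x = 1" for x c
        using that True step_at_1[of "x + (l - k)" c] by (simp add: algebra_simps)
    qed (use True bij_kadd in auto)
    then show thesis using that[of \<sigma>] k l by simp
  next
    case False
    then have kl: "csum k + csum l = 1" using k l by auto
    obtain \<sigma> where \<sigma>: "colour_aut ((\<oplus>) East) \<sigma>"
        "\<And>x. csum x = 0 \<or> csum x = 1 \<Longrightarrow> \<sigma> (at x) = at (k + l - x)"
    proof (rule colour_aut_vec[of "(\<oplus>) East" "\<lambda>x. k + l - x"])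
      show "at (k + l - (x + unit c)) = step (East \<oplus> c) (at (k + l - x))" if "csum x = 0" for x c
        using that kl step_at_1[of "k + l - x" c] by (simp add: algebra_simps)
      show "at (k + l - (x - unit c)) = step (East \<oplus> c) (at (k + l - x))" if "csum x = 1" for x c
        using that kl step_at_0[of "k + l - x" c] by (simp add: algebra_simps)
      show "csum (k + l - x) = csum (k + l - y) \<and> lam (k + l - x - (k + l - y))"
        if "csum x = csum y" "lam (x - y)" for x y
        using that lam_uminus[of "x - y"] by (simp add: algebra_simps)
    qed (use kl bij_kadd in auto)
    then show thesis using that[of \<sigma>] k l by simp
  qed
qed

lemma klein_aut_at_0:
  assumes "\<And>k. lam k \<Longrightarrow> lam (k \<circ> (\<oplus>) d)"
  obtains \<sigma> where "colour_aut ((\<oplus>) d) \<sigma>" "\<sigma> (at 0) = at 0"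
proof -
  have add: "(x + y) \<circ> (\<oplus>) d = (x \<circ> (\<oplus>) d) + (y \<circ> (\<oplus>) d)"
    "(x - y) \<circ> (\<oplus>) d = (x \<circ> (\<oplus>) d) - (y \<circ> (\<oplus>) d)"
    for x y :: vec by (simp_all add: fun_eq_iff)
  obtain \<sigma> where \<sigma>: "colour_aut ((\<oplus>) d) \<sigma>"
      "\<And>x. csum x = 0 \<or> csum x = 1 \<Longrightarrow> \<sigma> (at x) = at (x \<circ> (\<oplus>) d)"
  proof (rule colour_aut_vec[of "(\<oplus>) d" "\<lambda>x. x \<circ> (\<oplus>) d"])
    show "csum (k \<circ> (\<oplus>) d) = csum (l \<circ> (\<oplus>) d) \<and> lam ((k \<circ> (\<oplus>) d) - (l \<circ> (\<oplus>) d))"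
      if "csum k = csum l" "lam (k - l)" for k l
      using that assms[of "k - l"] by (simp add: add)
  qed (simp_all add: bij_kadd add step_at_0 step_at_1)
  moreover have "(0 :: vec) \<circ> (\<oplus>) d = 0" by (simp add: fun_eq_iff)
  ultimately show thesis using that[of \<sigma>] by simp
qed

lemma klein_transitive:
  assumes "\<And>d k. lam k \<Longrightarrow> lam (k \<circ> (\<oplus>) d)"
  shows "\<forall>u\<in>V. \<forall>v\<in>V. \<forall>d. \<exists>\<sigma>. colour_aut ((\<oplus>) d) \<sigma> \<and> \<sigma> u = v"
proof (intro ballI allI)
  fix u v d assume uv: "u \<in> V" "v \<in> V"
  obtain \<sigma> where \<sigma>: "colour_aut ((\<oplus>) East) \<sigma>" "\<sigma> u = at 0"
    using colour_preserving_transitive[OF uv(1) at_in] by blast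
  obtain \<tau> where \<tau>: "colour_aut ((\<oplus>) d) \<tau>" "\<tau> (at 0) = at 0"
    using klein_aut_at_0 assms by blast
  obtain \<rho> where \<rho>: "colour_aut ((\<oplus>) East) \<rho>" "\<rho> (at 0) = v"
    using colour_preserving_transitive[OF at_in uv(2)] by blast
  have "colour_aut ((\<oplus>) East \<circ> ((\<oplus>) d \<circ> (\<oplus>) East)) (\<rho> \<circ> (\<tau> \<circ> \<sigma>))"
    by (intro colour_aut_comp \<sigma> \<tau> \<rho>)
  then show "\<exists>\<sigma>. colour_aut ((\<oplus>) d) \<sigma> \<and> \<sigma> u = v"
    using \<sigma>(2) \<tau>(2) \<rho>(2) by (intro exI[of _ "\<rho> \<circ> (\<tau> \<circ> \<sigma>)"]) (simp add: kadd_East_fun)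
qed

text \<open>\<open>North\<close> exchanges horizontal and vertical displacement. For b^2 = 1 this
  multiplies the defining expression by \<open>b\<close>, up to multiples of
  \<open>2 * (b^2 - 1)\<close> and of \<open>(1 - q) * (1 + b)\<close>; both vanish modulo
  \<open>2 * m\<close>, the second because \<open>b\<close> is odd when \<open>q = m + 1\<close>.
  \<open>West\<close> changes the sign, up to an even multiple of \<open>1 - q\<close>.\<close>

lemma lam_klein:
  assumes bsq: "int m dvd (int b)\<^sup>2 - 1" and k: "lam k"
  shows "lam (k \<circ> (\<oplus>) d)"
proof -
  define X where "X k = k East - k West + (k North - k South) * int b + (1 - q) * ((k East + k West) div 2)" for k :: vec
  have q2: "2 * int m dvd (1 - q) * 2" using q_dvd dvd_minus_iff[of "2 * int m" "(q - 1) * 2"] by (simp add: algebra_simps)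
  have qb: "2 * int m dvd (1 - q) * (1 + int b)" using q by (auto simp: mult_dvd_mono elim!: oddE)
  have West: "lam (k \<circ> (\<oplus>) West)" if k: "lam k" for k
  proof -
    obtain u where u: "k East + k West = 2 * u" using lam_even(4)[OF k] by blast
    then have u': "(k East + k West) div 2 = u" "(k West + k East) div 2 = u" by (simp_all add: add.commute)
    have "X (k \<circ> (\<oplus>) West) = - X k + (1 - q) * 2 * u"
      unfolding X_def comp_def kadd.simps u' by (simp add: algebra_simps)
    moreover have "2 * int m dvd X k" using k by (simp add: lam_def X_def)
    ultimately have "2 * int m dvd X (k \<circ> (\<oplus>) West)" using q2 by (metis dvd_add dvd_minus_iff dvd_mult2)
    then show ?thesis using k by (auto simp: lam_def X_def)
  qed
  have North: "lam (k \<circ> (\<oplus>) North)" if k: "lam k" for k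
  proof -
    obtain u where u: "k East + k West = 2 * u" using lam_even(4)[OF k] by blast
    obtain t where t: "k North - k South = 2 * t" using lam_even(2)[OF k] by blast
    have ns: "k North + k South = 2 * - u" using lam_even(1)[OF k] u by (simp add: csum_def)
    then have ns': "(k North + k South) div 2 = - u" by simp
    have u': "(k East + k West) div 2 = u" using u by simp
    have "X (k \<circ> (\<oplus>) North) = int b * X k - 2 * ((int b)\<^sup>2 - 1) * t - (1 - q) * (1 + int b) * u"
      unfolding X_def comp_def kadd.simps u' ns' t
      by (simp add: algebra_simps power2_eq_square)
    moreover have "2 * int m dvd X k" using k by (simp add: lam_def X_def)
    moreover have "2 * int m dvd 2 * ((int b)\<^sup>2 - 1)" using bsq by (intro mult_dvd_mono) auto
    ultimately have "2 * int m dvd X (k \<circ> (\<oplus>) North)" using qb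
      by (metis dvd_diff dvd_mult dvd_mult2)
    moreover have "even ((k \<circ> (\<oplus>) North) North - (k \<circ> (\<oplus>) North) South)" using lam_even(3)[OF k] by simp
    moreover have "csum (k \<circ> (\<oplus>) North) = 0" using lam_even(1)[OF k] by simp
    ultimately show ?thesis unfolding lam_def X_def by blast
  qed
  have S: "k \<circ> (\<oplus>) South = k \<circ> (\<oplus>) North \<circ> (\<oplus>) West"
    by (rule ext) (simp flip: kadd_assoc)
  show ?thesis using k West North by (cases d) (simp_all add: S kadd_East_fun)
qed

section \<open>Orders of the words attached to the matchings\<close>

definition sml :: "nat \<Rightarrow> vec \<Rightarrow> vec" where
  "sml n w = (\<lambda>x. int n * w x)"

lemma sml_simps [simp]: "sml 0 w = 0" "sml (Suc n) w = sml n w + w" "csum (sml n w) = int n * csum w"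
  by (simp_all add: sml_def fun_eq_iff csum_def algebra_simps)

lemma funpow_at_0:
  assumes "csum w = 0" "\<And>k. csum k = 0 \<Longrightarrow> f (at k) = at (k + w)" "csum k = 0"
  shows "(f ^^ n) (at k) = at (k + sml n w)"
  using assms by (induction n) (simp_all add: add.assoc)

lemma funpow_at_1:
  assumes "csum w = 0" "\<And>k. csum k = 1 \<Longrightarrow> f (at k) = at (k - w)" "csum k = 1"
  shows "(f ^^ n) (at k) = at (k - sml n w)"
  using assms by (induction n) (simp_all add: algebra_simps)

text \<open>The word adds to vectors of total 0 what it subtracts from vectors of total 1, so
  whether it closes does not depend on the starting vertex.\<close>

lemma closes_iff: "closes a b' c e n \<longleftrightarrow> lam (sml n (unit a - unit b' + unit c - unit e))"
proof -
  let ?w = "unit a - unit b' + unit c - unit e"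
  let ?f = "\<lambda>u. step e (step c (step b' (step a u)))"
  have w: "csum ?w = 0" by simp
  have 0: "?f (at k) = at (k + ?w)" if "csum k = 0" for k
    using that by (simp add: step_at_0 step_at_1 algebra_simps)
  have 1: "?f (at k) = at (k - ?w)" if "csum k = 1" for k
    using that by (simp add: step_at_0 step_at_1 algebra_simps)
  have eq0: "(?f ^^ n) (at k) = at k \<longleftrightarrow> lam (sml n ?w)" if "csum k = 0" for k
    using funpow_at_0[of ?w ?f k n] w 0 that at_eq_iff[of "k + sml n ?w" k] by simp
  have eq1: "(?f ^^ n) (at k) = at k \<longleftrightarrow> lam (sml n ?w)" if "csum k = 1" for k
    using funpow_at_1[of ?w ?f k n] w 1 that at_eq_iff[of "k - sml n ?w" k] by simp
  show ?thesis unfolding closes_def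
  proof
    assume "\<forall>v\<in>V. (?f ^^ n) v = v"
    then have "(?f ^^ n) (at 0) = at 0" using at_in by blast
    then show "lam (sml n ?w)" using eq0[of 0] by simp
  next
    assume l: "lam (sml n ?w)"
    show "\<forall>v\<in>V. (?f ^^ n) v = v"
    proof
      fix v assume "v \<in> V"
      then obtain k where "csum k = 0 \<or> csum k = 1" "v = at k" using at_surj by blast
      then show "(?f ^^ n) v = v" using eq0[of k] eq1[of k] l by blast
    qed
  qed
qed

lemma closes_klein:
  assumes "d \<noteq> East" "b' \<noteq> a" "b' \<noteq> d \<oplus> a"
  shows "closes a b' (d \<oplus> a) (d \<oplus> b') n \<longleftrightarrow> lam (sml n (klein_sign d))"
proof -
  have "sml n (- w) = - sml n w" for w by (simp add: sml_def fun_eq_iff)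
  then show ?thesis
    using klein_sign_word[OF assms] lam_uminus[of "sml n (klein_sign d)"] unfolding closes_iff by auto
qed

text \<open>These are the orders: 1 or 2 for \<open>West\<close>, according to whether a unit square
  keeps or changes the sheet; \<open>m / gcd(m, b + 1)\<close> for \<open>North\<close>;
  \<open>m / gcd(m, b - 1)\<close> for \<open>South\<close>.\<close>

lemma lam_klein_sign:
  "lam (sml n (klein_sign West)) \<longleftrightarrow> 2 * int m dvd (1 - q) * int n"
  "lam (sml n (klein_sign North)) \<longleftrightarrow> int m dvd int n * (1 + int b)"
  "lam (sml n (klein_sign South)) \<longleftrightarrow> int m dvd int n * (1 - int b)"
proof -
  have 1: "int n + int n = 2 * int n" "- int n - int n = 2 * - int n" by simp_all
  show "lam (sml n (klein_sign West)) \<longleftrightarrow> 2 * int m dvd (1 - q) * int n"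
    by (simp add: lam_def sml_def klein_sign_def csum_def)
  have "2 * int n + 2 * int n * int b = 2 * (int n * (1 + int b))" by (simp add: algebra_simps)
  then show "lam (sml n (klein_sign North)) \<longleftrightarrow> int m dvd int n * (1 + int b)"
    by (simp add: lam_def sml_def klein_sign_def csum_def)
  have "2 * int n - 2 * int n * int b = 2 * (int n * (1 - int b))" by (simp add: algebra_simps)
  then show "lam (sml n (klein_sign South)) \<longleftrightarrow> int m dvd int n * (1 - int b)"
    by (simp add: lam_def sml_def klein_sign_def csum_def)
qed

section \<open>From short lattice vectors to short cycles\<close>

lemma colour_aut_of_square_lattice:
  assumes d: "d \<noteq> East" "lam (klein_sign d)"
    and lat: "\<And>i j k l. lam (unit j + unit k - unit i - unit l) \<Longrightarrow>
      \<exists>g. unit j + unit k - unit i - unit l = (\<lambda>x. g * klein_sign d x)"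
    and G: "graph_aut V E \<sigma>"
  obtains \<pi> where "colour_aut \<pi> \<sigma>"
proof (rule colour_aut_of_squares[OF d(1) _ G])
  fix v and i j k :: colour assume v: "v \<in> V" and ji: "j \<noteq> i" "k \<noteq> i"
  obtain x where x: "csum x = 0 \<or> csum x = 1" "v = at x" using at_surj v by blast
  have "step k (step i v) = step l (step j v) \<longleftrightarrow> lam (unit j + unit k - unit i - unit l)" for l
    using x(1)
  proof
    assume c: "csum x = 0"
    have "step k (step i v) = step l (step j v) \<longleftrightarrow> lam (- (unit j + unit k - unit i - unit l))"
      using c by (simp add: x(2) step_at_0 step_at_1 at_eq_iff algebra_simps)
    then show ?thesis by (simp only: lam_uminus)
  next
    assume c: "csum x = 1"
    show ?thesis
      using c by (simp add: x(2) step_at_0 step_at_1 at_eq_iff algebra_simps)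
  qed
  then have 1: "{step j v, step k (step i v)} \<in> E \<longleftrightarrow> (\<exists>l. lam (unit j + unit k - unit i - unit l))"
    using v by (simp add: nbr_iff)
  show "{step j v, step k (step i v)} \<in> E \<longleftrightarrow> j \<noteq> d \<oplus> i \<and> k = d \<oplus> j"
  proof
    assume "{step j v, step k (step i v)} \<in> E"
    then obtain l where "lam (unit j + unit k - unit i - unit l)" using 1 by blast
    then show "j \<noteq> d \<oplus> i \<and> k = d \<oplus> j" using lat klein_sign_units[OF d(1) ji] by blast
  next
    assume *: "j \<noteq> d \<oplus> i \<and> k = d \<oplus> j"
    then have "i \<noteq> j" "i \<noteq> d \<oplus> j" using ji by auto
    then have "lam (unit j - unit i + unit (d \<oplus> j) - unit (d \<oplus> i))"
      using klein_sign_word[OF d(1), of i j] d(2) by auto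
    then have "lam (unit j + unit k - unit i - unit (d \<oplus> i))" using * by (simp add: algebra_simps)
    then show "{step j v, step k (step i v)} \<in> E" using 1 by blast
  qed
qed (rule that)

lemma walk_eq_iff:
  assumes v: "v \<in> V"
  shows "step k (step i v) = step e (step c (step a (step j v))) \<longleftrightarrow>
      lam (unit j + unit c + unit k - unit a - unit e - unit i)"
proof -
  obtain x where x: "csum x = 0 \<or> csum x = 1" "v = at x" using at_surj v by blast
  from x(1) show ?thesis
  proof
    assume c: "csum x = 0"
    have "step k (step i v) = step e (step c (step a (step j v))) \<longleftrightarrow>
        lam (- (unit j + unit c + unit k - unit a - unit e - unit i))"
      using c by (simp add: x(2) step_at_0 step_at_1 at_eq_iff algebra_simps)
    then show ?thesis by (simp only: lam_uminus)
  next
    assume c: "csum x = 1"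
    show ?thesis
      using c by (simp add: x(2) step_at_0 step_at_1 at_eq_iff algebra_simps)
  qed
qed

lemma three_walk_iff:
  assumes v: "v \<in> V"
  shows "(\<exists>p z. {step j v, p} \<in> E \<and> {p, z} \<in> E \<and> {z, step k (step i v)} \<in> E \<and> (p, z) \<noteq> (v, step i v))
    \<longleftrightarrow> (\<exists>a c e. lam (unit j + unit c + unit k - unit a - unit e - unit i) \<and> \<not> (a = j \<and> c = i))"
proof -
  have ne: "(step a (step j v), step c (step a (step j v))) \<noteq> (v, step i v) \<longleftrightarrow> \<not> (a = j \<and> c = i)" for a c
    using v by auto
  have "(\<exists>p z. {step j v, p} \<in> E \<and> {p, z} \<in> E \<and> {z, step k (step i v)} \<in> E \<and> (p, z) \<noteq> (v, step i v))
     \<longleftrightarrow> (\<exists>a c e. step k (step i v) = step e (step c (step a (step j v))) \<and>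
       (step a (step j v), step c (step a (step j v))) \<noteq> (v, step i v))"
    using v unfolding nbr_iff by (metis s_in)
  then show ?thesis unfolding walk_eq_iff[OF v] ne .
qed

text \<open>Under \<open>lat\<close>, walks of length 3 share their ends only for formal reasons.
  Since \<open>j\<close> and \<open>k\<close> differ from \<open>i\<close>, this forces
  \<open>c = i\<close>, with \<open>a\<close> and \<open>e\<close> being \<open>j\<close> and
  \<open>k\<close> in some order; so a second walk exists just when
  \<open>j \<noteq> k\<close>.\<close>

lemma colour_aut_of_hexagon_lattice:
  assumes lat: "\<And>i j k a c e. lam (unit j + unit c + unit k - unit a - unit e - unit i) \<Longrightarrow>
      unit j + unit c + unit k = unit a + unit e + unit i"
    and G: "graph_aut V E \<sigma>"
  obtains \<pi> where "colour_aut \<pi> \<sigma>"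
proof (rule colour_aut_of_hexagons[OF _ G])
  fix v and i j k :: colour assume v: "v \<in> V" and ji: "j \<noteq> i" "k \<noteq> i"
  show "(\<exists>p z. {step j v, p} \<in> E \<and> {p, z} \<in> E \<and> {z, step k (step i v)} \<in> E \<and> (p, z) \<noteq> (v, step i v)) \<longleftrightarrow> j \<noteq> k"
    unfolding three_walk_iff[OF v]
  proof
    assume "\<exists>a c e. lam (unit j + unit c + unit k - unit a - unit e - unit i) \<and> \<not> (a = j \<and> c = i)"
    then obtain a c e where *: "unit j + unit c + unit k = unit a + unit e + unit i" "\<not> (a = j \<and> c = i)"
      using lat by blast
    have "c = i" using fun_cong[OF *(1), of i] ji by (auto split: if_splits simp: of_bool_def)
    then show "j \<noteq> k" using fun_cong[OF *(1), of j] ji *(2) by (auto split: if_splits simp: of_bool_def)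
  next
    assume "j \<noteq> k"
    then have "lam (unit j + unit i + unit k - unit k - unit j - unit i) \<and> \<not> (k = j \<and> i = i)" by simp
    then show "\<exists>a c e. lam (unit j + unit c + unit k - unit a - unit e - unit i) \<and> \<not> (a = j \<and> c = i)"
      by blast
  qed
qed (rule that)

end

section \<open>Short vectors of the lattice\<close>

lemma unit_combination_bound:
  assumes "\<And>x. 0 \<le> p x" "\<And>x. 0 \<le> n x" "csum p = s" "csum n = s"
  shows "\<bar>(p - n) East\<bar> + \<bar>(p - n) North\<bar> + \<bar>(p - n) West\<bar> + \<bar>(p - n) South\<bar> \<le> 2 * s"
proof -
  have "\<bar>(p - n) x\<bar> \<le> p x + n x" for x using assms(1,2)[of x] by simp
  from this[of East] this[of North] this[of West] this[of South] assms(3,4)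
  show ?thesis unfolding csum_def by linarith
qed

context rose_window
begin

lemma lam_halves:
  assumes "lam k"
  obtains x t u where "k East - k West = 2 * x" "k North - k South = 2 * t" "k East + k West = 2 * u"
    "k North + k South = - 2 * u" "2 * int m dvd 2 * (x + t * int b) + (1 - q) * u"
proof -
  note e = lam_even[OF assms]
  from e(3) obtain x where x: "k East - k West = 2 * x" by blast
  from e(2) obtain t where t: "k North - k South = 2 * t" by blast
  from e(4) obtain u where u: "k East + k West = 2 * u" by blast
  have "k North + k South = - 2 * u" using e(1) u by (simp add: csum_def)
  moreover have "2 * int m dvd 2 * (x + t * int b) + (1 - q) * u"
    using assms unfolding lam_def x t u by (simp add: algebra_simps)
  ultimately show thesis using that x t u by blast
qed

text \<open>The displacement \<open>(x, t)\<close> is too small to vanish modulo the lattice without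
  being zero, and a vector without displacement is a multiple of the unit square.\<close>

lemma short_square_1:
  assumes q1: "q = 1" and B: "int m dvd (int b)\<^sup>2 - 1 \<or> int m dvd (int b)\<^sup>2 + 1"
    and B1: "\<not> int m dvd int b - 1" "\<not> int m dvd int b + 1"
    and k: "lam k" "\<bar>k East\<bar> + \<bar>k North\<bar> + \<bar>k West\<bar> + \<bar>k South\<bar> \<le> 4"
  shows "\<exists>g. k = (\<lambda>x. g * klein_sign West x)"
proof -
  obtain x t u where h: "k East - k West = 2 * x" "k North - k South = 2 * t" "k East + k West = 2 * u"
    "k North + k South = - 2 * u" "2 * int m dvd 2 * (x + t * int b) + (1 - q) * u"
    using lam_halves[OF k(1)] by blast
  have "2 * int m dvd 2 * (x + t * int b)" using h(5) by (simp add: q1)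
  then have "int m dvd x + t * int b" by (simp only: dvd_mult_cancel_left) simp
  moreover have "\<bar>x\<bar> + \<bar>t\<bar> \<le> 2" using h(1-2) k(2) by linarith
  ultimately have "x = 0 \<and> t = 0" using unit_dvd_cases[of "int m" "int b" x t] m2 B B1 by simp
  then have "k West = k East" "k North = - k East" "k South = - k East" using h(1-4) by linarith+
  then show ?thesis
    by (intro exI[of _ "k East"]) (simp add: fun_eq_iff all_colour klein_sign_def)
qed

text \<open>Unit squares do not close here, which shows in the parity of \<open>u\<close>. Instead,
  as \<open>b\<close> is 1 or -1 modulo \<open>m\<close>, horizontal and vertical displacements
  cancel each other, and this yields the 4-cycles of the matching \<open>South\<close> or
  \<open>North\<close>.\<close>

lemma short_square_2:
  assumes qm: "q = int m + 1" and em: "even m" "4 < m" and b1: "b = 1 \<or> b = m - 1"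
    and k: "lam k" "\<bar>k East\<bar> + \<bar>k North\<bar> + \<bar>k West\<bar> + \<bar>k South\<bar> \<le> 4"
  shows "\<exists>g. k = (\<lambda>x. g * klein_sign (if b = 1 then South else North) x)"
proof -
  obtain x t u where h: "k East - k West = 2 * x" "k North - k South = 2 * t" "k East + k West = 2 * u"
    "k North + k South = - 2 * u" "2 * int m dvd 2 * (x + t * int b) + (1 - q) * u"
    using lam_halves[OF k(1)] by blast
  obtain h' where "m = 2 * h'" using em(1) by blast
  define H where "H = int h'"
  have H: "int m = 2 * H" "2 < H" using em(2) \<open>m = 2 * h'\<close> by (auto simp: H_def)
  define \<epsilon> :: int where "\<epsilon> = (if b = 1 then 1 else - 1)"
  have Be: "\<exists>z. int b = \<epsilon> + 2 * H * z"
    using b1 H m2 by (cases "b = 1") (auto simp: \<epsilon>_def of_nat_diff intro!: exI[of _ 1])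
  then obtain z where z: "int b = \<epsilon> + 2 * H * z" by blast
  have "4 * H dvd 2 * (x + t * int b) - 2 * H * u" using h(5) by (simp add: qm H(1))
  then have "4 * H dvd 2 * (x + t * \<epsilon>) - 2 * H * u + 4 * H * (t * z)"
    unfolding z by (simp add: algebra_simps)
  then have d: "4 * H dvd 2 * (x + t * \<epsilon>) - 2 * H * u" by (simp add: dvd_add_left_iff)
  then have "2 * H dvd x + t * \<epsilon> - H * u"
    by (metis (no_types, lifting) mult.assoc mult_2 numeral_Bit0 right_diff_distrib' dvd_mult_cancel_left distrib_right zero_neq_numeral)
  then have "H dvd x + t * \<epsilon> - H * u" by (rule dvd_mult_right)
  then have "H dvd x + t * \<epsilon>" by (simp add: dvd_diff_left_iff)
  moreover have "\<bar>x + t * \<epsilon>\<bar> \<le> 2" using h(1-2) k(2) by (auto simp: \<epsilon>_def)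
  ultimately have xt: "x + t * \<epsilon> = 0" using H(2) dvd_imp_le_int[of "x + t * \<epsilon>" H] by fastforce
  with d have "2 * H * 2 dvd 2 * H * u" by (simp add: dvd_minus_iff)
  then have "2 * H = 0 \<or> even u" by (simp only: dvd_mult_cancel_left)
  then have "even u" using H(2) by simp
  moreover have "\<bar>u\<bar> \<le> 1" using h(1-4) k(2) by linarith
  ultimately have "u = 0" by presburger
  then have *: "k East = x" "k West = - x" "k North = t" "k South = - t" using h(1-4) by linarith+
  show ?thesis
  proof (cases "b = 1")
    case True
    then have "t = - x" using xt by (simp add: \<epsilon>_def)
    with * True show ?thesis
      by (intro exI[of _ x]) (simp add: fun_eq_iff all_colour klein_sign_def)
  next
    case False
    then have "t = x" using xt by (simp add: \<epsilon>_def)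
    with * False show ?thesis
      by (intro exI[of _ x]) (simp add: fun_eq_iff all_colour klein_sign_def)
  qed
qed

text \<open>Modulo \<open>H\<close> the sheet term drops out, so the displacement vanishes by
  \<open>unit_dvd_cases\<close> with \<open>H\<close> for \<open>h\<close>. What is left is
  \<open>u\<close> times the unit square, with \<open>u\<close> even because of the sheets and at
  most 1 in absolute value because of the length.\<close>

lemma short_hexagon:
  assumes qm: "q = int m + 1" and H: "int m = 2 * H" "4 \<le> H" "H \<noteq> 5"
    and B: "int m dvd (int b)\<^sup>2 - 1 \<or> int m dvd (int b)\<^sup>2 + 1"
    and B1: "\<not> H dvd int b - 1" "\<not> H dvd int b + 1"
    and k: "lam k" "\<bar>k East\<bar> + \<bar>k North\<bar> + \<bar>k West\<bar> + \<bar>k South\<bar> \<le> 6"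
  shows "k = 0"
proof -
  obtain x t u where h: "k East - k West = 2 * x" "k North - k South = 2 * t" "k East + k West = 2 * u"
    "k North + k South = - 2 * u" "2 * int m dvd 2 * (x + t * int b) + (1 - q) * u"
    using lam_halves[OF k(1)] by blast
  have d: "2 * (2 * H) dvd 2 * (x + t * int b - H * u)"
    using h(5) by (simp add: qm H(1) algebra_simps)
  then have "2 * H dvd x + t * int b - H * u" by (simp only: dvd_mult_cancel_left) simp
  then have "H dvd x + t * int b - H * u" by (rule dvd_mult_right)
  then have "H dvd x + t * int b" by (simp add: dvd_diff_left_iff)
  moreover have "\<bar>x\<bar> + \<bar>t\<bar> \<le> 3" using h(1-2) k(2) by linarith
  moreover have "H dvd (int b)\<^sup>2 - 1 \<or> H dvd (int b)\<^sup>2 + 1"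
    using B unfolding H(1) by (metis dvd_mult_right)
  ultimately have xt: "x = 0 \<and> t = 0" using unit_dvd_cases[of H "int b" x t] H B1 by simp
  with d have "2 * H * 2 dvd 2 * H * u" by (simp add: dvd_minus_iff)
  then have "2 * H = 0 \<or> even u" by (simp only: dvd_mult_cancel_left)
  then have "even u" using H(2) by simp
  moreover have "\<bar>u\<bar> \<le> 1" using h(1-4) k(2) xt by linarith
  ultimately have "u = 0" by presburger
  then have "k East = 0" "k West = 0" "k North = 0" "k South = 0" using h(1-4) xt by linarith+
  then show ?thesis by (simp add: fun_eq_iff all_colour)
qed

lemma square_vector_bounded: "lam (unit j + unit k - unit i - unit l) \<Longrightarrow>
    (\<And>w. lam w \<Longrightarrow> \<bar>w East\<bar> + \<bar>w North\<bar> + \<bar>w West\<bar> + \<bar>w South\<bar> \<le> 4 \<Longrightarrow> Q w) \<Longrightarrow>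
    Q (unit j + unit k - unit i - unit l)"
  using unit_combination_bound[of "unit j + unit k" "unit i + unit l" 2] by (simp add: diff_diff_eq)

text \<open>The last two clauses are what the two excluded families amount to.\<close>

definition regular :: bool where
  "regular \<longleftrightarrow> (int m dvd (int b)\<^sup>2 - 1 \<or> int m dvd (int b)\<^sup>2 + 1) \<and>
    (q = 1 \<longrightarrow> b \<noteq> 1 \<and> b \<noteq> m - 1) \<and> (q \<noteq> 1 \<longrightarrow> 2 * b + 2 \<noteq> m \<and> 2 * b \<noteq> m + 2)"

text \<open>The only multiple of m/2 strictly between 0 and \<open>m\<close> is m/2 itself, and
  \<open>b - 1\<close> and \<open>b + 1\<close> cannot equal it by the last clause of
  \<open>regular\<close>.\<close>

lemma half_not_dvd:
  assumes "regular" "q \<noteq> 1" "int m = 2 * H" 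
  shows "b \<noteq> 1 \<Longrightarrow> \<not> H dvd int b - 1" "b \<noteq> m - 1 \<Longrightarrow> \<not> H dvd int b + 1"
proof -
  have *: "y = H" if y: "H dvd y" "0 < y" "y < 2 * H" for y
  proof -
    obtain z where z: "y = H * z" using y(1) by blast
    have "0 < H" using assms(3) m2 by linarith
    with z y have "0 < z" "z < 2" by (auto simp: zero_less_mult_iff mult.commute)
    with z show ?thesis by simp
  qed
  show "\<not> H dvd int b - 1" if "b \<noteq> 1"
    using *[of "int b - 1"] that assms b0 bm by (auto simp: regular_def)
  show "\<not> H dvd int b + 1" if "b \<noteq> m - 1"
  proof -
    have "b + 1 < m" using that bm by linarith
    then have "int b + 1 < 2 * H" using assms(3) by linarith
    then show ?thesis using *[of "int b + 1"] assms by (auto simp: regular_def)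
  qed
qed

text \<open>Modulo 4 the square of 2 is neither 1 nor -1, while 1 and 3 are excluded by
  \<open>regular\<close> for both values of \<open>q\<close>.\<close>

lemma not_four:
  assumes "regular"
  shows "m \<noteq> 4"
proof
  assume m4: "m = 4"
  note r = assms[unfolded regular_def]
  have "b = 1 \<or> b = 2 \<or> b = 3" using b0 bm m4 by auto
  then show False using r m4 by (elim disjE) simp_all
qed

lemma regular_colour_aut:
  assumes r: "regular" and ex: "\<not> (q \<noteq> 1 \<and> m = 10 \<and> (b = 3 \<or> b = 7))"
    and G: "graph_aut V E \<sigma>"
  obtains \<pi> where "colour_aut \<pi> \<sigma>"
proof (cases "q = 1")
  case True
  have B1: "\<not> int m dvd int b - 1" "\<not> int m dvd int b + 1"
    using r[unfolded regular_def] True b0 bm zdvd_imp_le[of "int m" "int b - 1"]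
      zdvd_imp_le[of "int m" "int b + 1"] by auto
  have lat: "\<exists>g. unit j + unit k - unit i - unit l = (\<lambda>x. g * klein_sign West x)"
    if "lam (unit j + unit k - unit i - unit l)" for i j k l
    using that by (rule square_vector_bounded) (use short_square_1[OF True _ B1] r in \<open>auto simp: regular_def\<close>)
  have "lam (klein_sign West)" using lam_klein_sign(1)[of 1] True by simp
  then show thesis using colour_aut_of_square_lattice[OF _ _ lat G] that by blast
next
  case False
  then have q': "q = int m + 1" "even m" "odd b" using q by auto
  obtain h where h: "m = 2 * h" using q'(2) by blast
  define H where "H = int h"
  have H: "int m = 2 * H" using h by (simp add: H_def)
  have m4: "4 < m" using not_four[OF r] m2 q'(2) by presburger
  show thesis
  proof (cases "b = 1 \<or> b = m - 1")
    case True
    define d where "d = (if b = 1 then South else North)"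
    have lat: "\<exists>g. unit j + unit k - unit i - unit l = (\<lambda>x. g * klein_sign d x)"
      if "lam (unit j + unit k - unit i - unit l)" for i j k l
      using that unfolding d_def by (rule square_vector_bounded) (use short_square_2[OF q'(1,2) m4 True] in auto)
    have "lam (klein_sign d)" using lam_klein_sign(2,3)[of 1] True m2
      by (auto simp: d_def of_nat_diff)
    moreover have "d \<noteq> East" by (simp add: d_def)
    ultimately show thesis using colour_aut_of_square_lattice[OF _ _ lat G] that by blast
  next
    case nb: False
    have B1: "\<not> H dvd int b - 1" "\<not> H dvd int b + 1" using half_not_dvd[OF r False H] nb by auto
    \<comment> \<open>For \<open>m = 6\<close> the only candidate left is 3, whose square is neither
      1 nor -1; for \<open>m = 10\<close>, besides the exceptions 3 and 7, it is 5, which fails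
      likewise.\<close>
    have "h \<noteq> 3"
    proof
      assume h3: "h = 3"
      have "b = 3" using h3 h b0 bm nb q'(3) by presburger
      then show False using r[unfolded regular_def] h3 h by simp
    qed
    moreover have "h \<noteq> 5"
    proof
      assume h5: "h = 5"
      have "b = 3 \<or> b = 5 \<or> b = 7" using h5 h b0 bm nb q'(3) by presburger
      then show False using r[unfolded regular_def] h5 h ex False by auto
    qed
    ultimately have H': "4 \<le> H" "H \<noteq> 5" using m4 h by (auto simp: H_def)
    have lat: "unit j + unit c + unit k = unit a + unit e + unit i"
      if l: "lam (unit j + unit c + unit k - unit a - unit e - unit i)" for i j k a c e
    proof -
      have "\<bar>w East\<bar> + \<bar>w North\<bar> + \<bar>w West\<bar> + \<bar>w South\<bar> \<le> 6"
        if "w = unit j + unit c + unit k - unit a - unit e - unit i" for w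
        using unit_combination_bound[of "unit j + unit c + unit k" "unit a + unit e + unit i" 3] that
        by (simp add: diff_diff_eq)
      then have "unit j + unit c + unit k - unit a - unit e - unit i = 0"
        using short_hexagon[OF q'(1) H H' _ B1 l] r unfolding regular_def by blast
      then show ?thesis by (simp add: algebra_simps)
    qed
    show thesis using colour_aut_of_hexagon_lattice[OF lat G] that by blast
  qed
qed

lemma klein_lattice_distinct:
  assumes r: "regular" and bsq: "int m dvd (int b)\<^sup>2 - 1"
    and d: "d \<noteq> East" "d' \<noteq> East" "d \<noteq> d'"
  shows "\<exists>n. lam (sml n (klein_sign d)) \<noteq> lam (sml n (klein_sign d'))"
proof -
  \<comment> \<open>The word of \<open>West\<close> has order 1 if \<open>q = 1\<close> and 2
    otherwise. The assumptions on \<open>y\<close> keep \<open>m / gcd(m, y)\<close> from being that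
    order, so \<open>n = 1\<close> or \<open>n = 2\<close> separates the two.\<close>
  have WX: "\<exists>n. lam (sml n (klein_sign West)) \<noteq> (int m dvd int n * y)"
    if y: "q = 1 \<Longrightarrow> \<not> int m dvd y"
      "\<And>H. q \<noteq> 1 \<Longrightarrow> int m = 2 * H \<Longrightarrow> \<not> int m dvd y \<Longrightarrow> \<not> H dvd y" for y
  proof (cases "q = 1")
    case True
    have "2 * int m dvd (1 - q) * int 1" using True by simp
    then have "lam (sml 1 (klein_sign West))" by (simp only: lam_klein_sign)
    moreover have "\<not> int m dvd int 1 * y" using y(1) True by simp
    ultimately show ?thesis by blast
  next
    case False
    then have qm: "q = int m + 1" "even m" using q by auto
    then obtain h where h: "m = 2 * h" by blast
    then have H: "int m = 2 * int h" by simp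
    have hp: "h > 0" using h m2 by simp
    show ?thesis
    proof (cases "int m dvd y")
      case True
      have "\<not> 2 * int m dvd (1 - q) * int 1"
        using m2 zdvd_imp_le[of "2 * int m" "int m"] by (auto simp: qm)
      then have "\<not> lam (sml 1 (klein_sign West))" by (simp only: lam_klein_sign not_False_eq_True)
      with True show ?thesis by (metis dvd_mult)
    next
      case nd: False
      then have "\<not> int h dvd y" using y(2)[OF False H] by blast
      then have "\<not> int m dvd int 2 * y" unfolding H by simp
      moreover have "2 * int m dvd (1 - q) * int 2" by (simp add: qm)
      then have "lam (sml 2 (klein_sign West))" by (simp only: lam_klein_sign)
      ultimately show ?thesis by blast
    qed
  qed
  have m_dvd: "int m dvd 1 + int b \<longleftrightarrow> b = m - 1" "int m dvd 1 - int b \<longleftrightarrow> b = 1"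
  proof -
    show "int m dvd 1 + int b \<longleftrightarrow> b = m - 1"
      using b0 bm zdvd_imp_le[of "int m" "1 + int b"] by (auto simp: of_nat_diff)
    have "int m dvd 1 - int b \<longleftrightarrow> int m dvd int b - 1" by (metis dvd_minus_iff minus_diff_eq)
    also have "\<dots> \<longleftrightarrow> b = 1"
    proof
      assume "int m dvd int b - 1"
      then have "\<not> 0 < int b - 1" using bm zdvd_imp_le[of "int m" "int b - 1"] by linarith
      with b0 show "b = 1" by linarith
    qed simp
    finally show "int m dvd 1 - int b \<longleftrightarrow> b = 1" .
  qed
  have WN: "\<exists>n. lam (sml n (klein_sign West)) \<noteq> lam (sml n (klein_sign North))"
    unfolding lam_klein_sign(2)
  proof (rule WX)
    show "\<not> int m dvd 1 + int b" if "q = 1" using that r unfolding regular_def m_dvd by blast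
    show "\<not> H dvd 1 + int b" if "q \<noteq> 1" "int m = 2 * H" "\<not> int m dvd 1 + int b" for H
      using half_not_dvd(2)[OF r that(1,2)] that(3) m_dvd by (simp add: add.commute)
  qed
  have WS: "\<exists>n. lam (sml n (klein_sign West)) \<noteq> lam (sml n (klein_sign South))"
    unfolding lam_klein_sign(3)
  proof (rule WX)
    show "\<not> int m dvd 1 - int b" if "q = 1" using that r unfolding regular_def m_dvd by blast
    show "\<not> H dvd 1 - int b" if "q \<noteq> 1" "int m = 2 * H" "\<not> int m dvd 1 - int b" for H
      using half_not_dvd(1)[OF r that(1,2)] that(3) m_dvd by (metis dvd_minus_iff minus_diff_eq)
  qed
  have NS: "\<exists>n. lam (sml n (klein_sign North)) \<noteq> lam (sml n (klein_sign South))"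
  proof (rule ccontr)
    assume "\<not> ?thesis"
    then have eq: "int m dvd int n * (1 + int b) \<longleftrightarrow> int m dvd int n * (1 - int b)" for n
      by (simp add: lam_klein_sign)
    \<comment> \<open>Equal orders are refuted at \<open>n = 1 + b\<close> and
      \<open>n = b - 1\<close>, where b^2 = 1 makes one side true. Hence \<open>m\<close> divides
      both (b + 1)^2 and (b - 1)^2, so also 4 b, and therefore 4, as \<open>b\<close> is
      invertible.\<close>
    have "(1 + int b) * (1 - int b) = - ((int b)\<^sup>2 - 1)" by (simp add: algebra_simps power2_eq_square)
    then have "int m dvd (1 + int b) * (1 - int b)" using bsq by (metis dvd_minus_iff)
    then have 1: "int m dvd (1 + int b) * (1 + int b)" using eq[of "1 + b"] by simp
    have "(int b - 1) * (1 + int b) = (int b)\<^sup>2 - 1" by (simp add: algebra_simps power2_eq_square)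
    then have "int m dvd (int b - 1) * (1 + int b)" using bsq by simp
    then have 2: "int m dvd (int b - 1) * (1 - int b)" using eq[of "b - 1"] b0 by (simp add: of_nat_diff)
    have "int m dvd ((1 + int b) * (1 + int b) + (int b - 1) * (1 - int b)) * int b - 4 * ((int b)\<^sup>2 - 1)"
      by (rule dvd_diff[OF dvd_mult2[OF dvd_add[OF 1 2]] dvd_mult[OF bsq]])
    also have "\<dots> = 4" by (simp add: algebra_simps power2_eq_square)
    finally have "int m dvd 4" .
    then have "m dvd 4" by (metis of_nat_dvd_iff of_nat_numeral)
    then have "m \<le> 4" by (simp add: dvd_imp_le)
    with \<open>m dvd 4\<close> m2 have "m = 4 \<or> m = 3" by auto
    with \<open>m dvd 4\<close> not_four[OF r] show False by auto
  qed
  show ?thesis using WN WS NS d by (cases d; cases d') metis+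
qed

theorem graph_aut_klein:
  assumes r: "regular" and bsq: "int m dvd (int b)\<^sup>2 - 1"
  shows "\<forall>\<sigma>. graph_aut V E \<sigma> \<longrightarrow> (\<exists>c. colour_aut ((\<oplus>) c) \<sigma>)"
proof (intro allI impI)
  fix \<sigma> assume G: "graph_aut V E \<sigma>"
  have ex: "\<not> (q \<noteq> 1 \<and> m = 10 \<and> (b = 3 \<or> b = 7))" using bsq by auto
  obtain \<pi> where \<pi>: "colour_aut \<pi> \<sigma>" using regular_colour_aut[OF r ex G] by blast
  have "\<exists>c. \<pi> = (\<oplus>) c"
    by (rule colour_perm_klein[OF closes_klein klein_lattice_distinct[OF r bsq] \<pi>])
  with \<pi> show "\<exists>c. colour_aut ((\<oplus>) c) \<sigma>" by blast
qed

section \<open>Nonexistence when b^2 is not 1\<close>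

lemma no_class_of_colour_aut:
  assumes bsq: "\<not> int m dvd (int b)\<^sup>2 - 1" and d: "d = North \<or> d = South"
    and A: "colour_aut \<pi> \<sigma>" and fix0: "\<sigma> (at 0) = at 0"
    and d': "\<And>i. \<sigma> (step i (at 0)) = step (d \<oplus> i) (at 0)"
  shows False
proof -
  have \<pi>: "\<pi> i = d \<oplus> i" for i
    using colour_aut_s[OF A at_in, of i 0] d'[of i] at_in by (simp add: fix0)
  define g where "g u = step West (step East u)" for u
  define g' where "g' u = step (d \<oplus> West) (step (d \<oplus> East) u)" for u
  have gV: "(g ^^ n) v \<in> V" if "v \<in> V" for v n
    using that by (induction n) (simp_all add: g_def)
  have conj: "\<sigma> ((g ^^ n) v) = (g' ^^ n) (\<sigma> v)" if v: "v \<in> V" for v n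
  proof (induction n)
    case (Suc n)
    have "\<sigma> (g u) = g' (\<sigma> u)" if "u \<in> V" for u
      using that by (simp add: g_def g'_def colour_aut_s[OF A] \<pi>)
    from this[OF gV[OF v]] Suc.IH show ?case by simp
  qed simp
  have gb: "(g ^^ n) (at 0) = at (sml n (unit East - unit West))" for n
    using funpow_at_0[of "unit East - unit West" g 0 n]
    by (simp add: g_def step_at_0 step_at_1 algebra_simps)
  have g'b: "(g' ^^ n) (at 0) = at (sml n (unit (d \<oplus> East) - unit (d \<oplus> West)))" for n
    using funpow_at_0[of "unit (d \<oplus> East) - unit (d \<oplus> West)" g' 0 n]
    by (simp add: g'_def step_at_0 step_at_1 algebra_simps)
  \<comment> \<open>A \<open>North\<close> step followed by a \<open>South\<close> step from x_0
    leads to x_{2b}, and so do \<open>b\<close> pairs of \<open>East\<close> and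
    \<open>West\<close>. The diagonal reflection turns this relation into one that forces b^2 =
    1.\<close>
  have L: "lam (unit North - unit South - sml b (unit East - unit West))"
    unfolding lam_def by (intro conjI; (simp; fail)?; simp add: sml_def)
  have "step South (step North (at 0)) = at (unit North - unit South)"
    by (simp add: step_at_0 step_at_1)
  also have "\<dots> = (g ^^ b) (at 0)"
    using L at_eq_iff[of "unit North - unit South" "sml b (unit East - unit West)"]
    by (simp add: gb)
  finally have "\<sigma> (step South (step North (at 0))) = (g' ^^ b) (at 0)"
    using conj[OF at_in, of b 0] fix0 by simp
  then have "step (d \<oplus> South) (step (d \<oplus> North) (at 0)) = (g' ^^ b) (at 0)"
    using colour_aut_s[OF A] \<pi> fix0 at_in by simp
  then have "at (unit (d \<oplus> North) - unit (d \<oplus> South)) = at (sml b (unit (d \<oplus> East) - unit (d \<oplus> West)))"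
    unfolding g'b by (simp add: step_at_0 step_at_1)
  then have "lam (unit (d \<oplus> North) - unit (d \<oplus> South) - sml b (unit (d \<oplus> East) - unit (d \<oplus> West)))"
    by (subst (asm) at_eq_iff) simp_all
  then have "2 * int m dvd 2 * ((int b)\<^sup>2 - 1) \<or> 2 * int m dvd - (2 * ((int b)\<^sup>2 - 1))"
    using d by (auto simp: lam_def sml_def power2_eq_square algebra_simps)
  then have "2 * int m dvd 2 * ((int b)\<^sup>2 - 1)" by (simp only: dvd_minus_iff simp_thms)
  then show False using bsq by (simp only: dvd_mult_cancel_left) simp
qed

text \<open>The count includes the given path itself. Two walks already arise from commuting
  translations whenever the outer colours differ; a third is what singles out a path.\<close>

definition three_walks :: "bool \<times> nat \<Rightarrow> bool \<times> nat \<Rightarrow> bool \<times> nat \<Rightarrow> bool \<times> nat \<Rightarrow> bool" where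
  "three_walks u v v' w \<longleftrightarrow> (\<exists>p z p' z'. {u, p} \<in> E \<and> {p, z} \<in> E \<and> {z, w} \<in> E \<and>
     {u, p'} \<in> E \<and> {p', z'} \<in> E \<and> {z', w} \<in> E \<and>
     (p, z) \<noteq> (v, v') \<and> (p', z') \<noteq> (v, v') \<and> (p, z) \<noteq> (p', z'))"

lemma three_walks_image:
  assumes G: "graph_aut V E \<sigma>" and V: "u \<in> V" "v \<in> V" "v' \<in> V" "w \<in> V"
    and t: "three_walks u v v' w"
  shows "three_walks (\<sigma> u) (\<sigma> v) (\<sigma> v') (\<sigma> w)"
proof -
  obtain p z p' z' where pz: "{u, p} \<in> E" "{p, z} \<in> E" "{z, w} \<in> E" "{u, p'} \<in> E" "{p', z'} \<in> E"
     "{z', w} \<in> E" "(p, z) \<noteq> (v, v')" "(p', z') \<noteq> (v, v')" "(p, z) \<noteq> (p', z')"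
    using t unfolding three_walks_def by blast
  have pV: "p \<in> V" "z \<in> V" "p' \<in> V" "z' \<in> V"
    using pz(2,3,5,6) nbr_iff by blast+
  have "{\<sigma> u, \<sigma> p} \<in> E \<and> {\<sigma> p, \<sigma> z} \<in> E \<and> {\<sigma> z, \<sigma> w} \<in> E \<and>
     {\<sigma> u, \<sigma> p'} \<in> E \<and> {\<sigma> p', \<sigma> z'} \<in> E \<and> {\<sigma> z', \<sigma> w} \<in> E"
    using pz(1-6) pV V graph_aut_edge[OF G] by simp
  moreover have "(\<sigma> p, \<sigma> z) \<noteq> (\<sigma> v, \<sigma> v')" "(\<sigma> p', \<sigma> z') \<noteq> (\<sigma> v, \<sigma> v')" "(\<sigma> p, \<sigma> z) \<noteq> (\<sigma> p', \<sigma> z')"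
    using pz(7-9) pV V graph_aut_inj[OF G] by simp_all
  ultimately show ?thesis unfolding three_walks_def by blast
qed

end

text \<open>For \<open>m = 10\<close>, \<open>q = 11\<close>, \<open>b = 3\<close> and total 0, the
  sheet term of \<open>lam\<close> is \<open>5 * (k North + k South)\<close>. Subtracting the total,
  which makes the coefficient of \<open>East\<close> zero, leaves these coefficients modulo
  20.\<close>

fun weight :: "colour \<Rightarrow> int" where
  "weight East = 0" | "weight North = 7" | "weight West = 18" | "weight South = 1"

text \<open>Up to sign, the additional lattice vectors of length 6 are
  \<open>3 j - 2 i - (j \<oplus> West)\<close>, where \<open>j\<close> follows \<open>i\<close> in
  the cyclic order of the four directions. They give the path with colours \<open>j\<close>,
  \<open>i\<close>, \<open>k\<close> a third walk exactly for
  \<open>k = partner i j\<close>.\<close>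

fun partner :: "colour \<Rightarrow> colour \<Rightarrow> colour" where
  "partner East West = South" | "partner East South = West"
| "partner North South = East" | "partner North East = South"
| "partner West East = North" | "partner West North = East"
| "partner South North = West" | "partner South West = North"
| "partner i j = j"

lemma partner_partner: "j \<noteq> i \<Longrightarrow> partner i j \<noteq> i \<and> partner i (partner i j) = j"
  by (cases i; cases j) simp_all

text \<open>For \<open>j\<close> with \<open>partner i j \<noteq> j\<close>: the first two colours
  of the only other walk joining the ends of the path with colours \<open>j\<close>,
  \<open>i\<close>, \<open>j\<close>.\<close>

fun other_walk :: "colour \<Rightarrow> colour \<Rightarrow> colour \<times> colour" where
  "other_walk East West = (North, West)" | "other_walk East South = (East, West)"
| "other_walk North South = (West, South)" | "other_walk North East = (North, South)"
| "other_walk West East = (South, East)" | "other_walk West North = (West, East)"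
| "other_walk South North = (East, North)" | "other_walk South West = (South, North)"
| "other_walk i j = (i, j)"

lemma weight_walks_le_2:
  assumes "j \<noteq> i" "k \<noteq> i" "k \<noteq> partner i j"
    and "20 dvd weight j + weight c + weight k - weight a - weight e - weight i"
  shows "(a, c) = (j, i) \<or> (a, c) = (if j = k then other_walk i j else (k, i))"
proof -
  have "\<forall>i j k c a e. j \<noteq> i \<longrightarrow> k \<noteq> i \<longrightarrow> k \<noteq> partner i j \<longrightarrow>
      20 dvd weight j + weight c + weight k - weight a - weight e - weight i \<longrightarrow>
      (a, c) = (j, i) \<or> (a, c) = (if j = k then other_walk i j else (k, i))"
    by (simp add: all_colour)
  from this[rule_format, OF assms] show ?thesis .
qed

lemma weight_walks_3:
  assumes "j \<noteq> i"
  obtains a c e a' c' e' where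
    "20 dvd weight j + weight c + weight (partner i j) - weight a - weight e - weight i"
    "20 dvd weight j + weight c' + weight (partner i j) - weight a' - weight e' - weight i"
    "(a, c) \<noteq> (j, i)" "(a', c') \<noteq> (j, i)" "(a, c) \<noteq> (a', c')"
proof (cases "partner i j = j")
  case True
  \<comment> \<open>Here \<open>j\<close> follows \<open>i\<close> in the cyclic order, and the
    vector \<open>3 j - 2 i - (j \<oplus> West)\<close> is used in two arrangements.\<close>
  with assms have "20 dvd weight j + weight j + weight (partner i j) - weight i - weight (j \<oplus> West) - weight i"
      "20 dvd weight j + weight j + weight (partner i j) - weight (j \<oplus> West) - weight i - weight i"
    by (cases i; cases j; simp)+
  moreover have "(i, j) \<noteq> (j, i)" "(j \<oplus> West, j) \<noteq> (j, i)" "(i, j) \<noteq> (j \<oplus> West, j)"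
    using True assms by (cases i; cases j; simp)+
  ultimately show thesis using that by blast
next
  case False
  \<comment> \<open>One further walk comes from commuting translations; the other uses an additional
    vector containing \<open>i\<close> three times.\<close>
  have "20 dvd weight j + weight i + weight (partner i j) - weight (partner i j) - weight j - weight i"
    by simp
  moreover obtain c where "20 dvd weight j + weight c + weight (partner i j) - weight i - weight i - weight i"
      "(i, c) \<noteq> (j, i)" "(i, c) \<noteq> (partner i j, i)"
  proof -
    have "\<exists>c. 20 dvd weight j + weight c + weight (partner i j) - weight i - weight i - weight i \<and>
      (i, c) \<noteq> (j, i) \<and> (i, c) \<noteq> (partner i j, i)"
      unfolding ex_colour using False assms by (cases i; cases j; simp)
    then show thesis using that by blast
  qed
  moreover have "(partner i j, i) \<noteq> (j, i)" using False by simp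
  ultimately show thesis using that[of i "partner i j" j] by blast
qed

context rose_window
begin

text \<open>For \<open>m = 10\<close>, \<open>q = 11\<close> there are additional hexagons. Here the graph is the Haar graph
  of the cyclic group of order 20 with difference set {0, 7, 18, 1}, and the paths of length 3
  whose ends are joined by at least three walks of length 3 give another way of transporting
  colours along edges, with nontrivial holonomy.\<close>

definition relabel :: "colour \<Rightarrow> colour" where
  "relabel i = (if b = 3 \<or> i = East \<or> i = West then i else if i = North then South else North)"

definition stp :: "colour \<Rightarrow> bool \<times> nat \<Rightarrow> bool \<times> nat" where
  "stp i = step (relabel i)"

lemma relabel_relabel [simp]: "relabel (relabel i) = i"
  by (cases i) (auto simp: relabel_def)

lemma relabel_eq_iff [simp]: "relabel i = relabel j \<longleftrightarrow> i = j"
  by (metis relabel_relabel)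

lemma relabel_kadd: "relabel (i \<oplus> j) = relabel i \<oplus> relabel j"
  by (cases i; cases j; simp add: relabel_def)

lemma nbr_stp: "{u, v} \<in> E \<longleftrightarrow> u \<in> V \<and> (\<exists>i. v = stp i u)"
  unfolding nbr_iff stp_def by (metis relabel_relabel)

lemma stp_simps [simp]:
  "v \<in> V \<Longrightarrow> stp i v \<in> V" "v \<in> V \<Longrightarrow> stp i (stp i v) = v" "v \<in> V \<Longrightarrow> stp i v = stp j v \<longleftrightarrow> i = j"
  "v \<in> V \<Longrightarrow> stp j (stp i v) = v \<longleftrightarrow> i = j"
  by (simp_all add: stp_def)

text \<open>\<open>b = 7\<close> is -3 modulo 10, the mirror image of \<open>b = 3\<close>;
  \<open>relabel\<close> therefore exchanges \<open>North\<close> and \<open>South\<close>. These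
  are the two colours of odd weight, which accounts for the parity condition in
  \<open>lam\<close>.\<close>

lemma lam_weight:
  assumes m10: "m = 10" "q = 11" "b = 3 \<or> b = 7" and k: "csum k = 0"
  shows "lam k \<longleftrightarrow> 20 dvd (\<Sum>i\<in>UNIV. weight i * k (relabel i))"
proof (cases "even (k North - k South)")
  case True
  then obtain h where h: "k North = k South + 2 * h" by (metis add.commute diff_eq_eq dvdE)
  have e: "k East = - 2 * k South - 2 * h - k West" using k h by (simp add: csum_def)
  have d: "(k East + k West) div 2 = - k South - h" unfolding e by simp
  have lam: "lam k \<longleftrightarrow> 2 * int m dvd k East - k West + (k North - k South) * int b + (1 - q) * (- k South - h)"
    unfolding lam_def d using k True by simp
  have shift: "20 dvd y + 20 * z \<longleftrightarrow> 20 dvd y" for y z :: int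
    by (simp add: dvd_add_left_iff)
  from m10(3) show ?thesis
  proof
    assume b: "b = 3"
    have r: "relabel East = East" "relabel West = West" "relabel North = North" "relabel South = South"
      unfolding relabel_def using b by simp_all
    have eq: "(\<Sum>i\<in>UNIV. weight i * k (relabel i)) =
        k East - k West + (k North - k South) * int b + (1 - q) * (- k South - h) + 20 * k West"
      unfolding sum_colour r by (simp add: b m10 e h algebra_simps)
    show ?thesis unfolding lam eq shift using m10(1) by simp
  next
    assume b: "b = 7"
    have r: "relabel East = East" "relabel West = West" "relabel North = South" "relabel South = North"
      unfolding relabel_def using b by simp_all
    have eq: "(\<Sum>i\<in>UNIV. weight i * k (relabel i)) =
        k East - k West + (k North - k South) * int b + (1 - q) * (- k South - h) + 20 * (k West - h)"
      unfolding sum_colour r by (simp add: b m10 e h algebra_simps)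
    show ?thesis unfolding lam eq shift using m10(1) by simp
  qed
next
  case False
  then have "\<not> lam k" by (simp add: lam_def)
  moreover have "odd (\<Sum>i\<in>UNIV. weight i * k (relabel i))"
    unfolding sum_colour using False by (auto simp: relabel_def)
  then have "\<not> 20 dvd (\<Sum>i\<in>UNIV. weight i * k (relabel i))"
    by (metis dvd_trans even_numeral)
  ultimately show ?thesis by simp
qed

lemma walk_eq_weight:
  assumes m10: "m = 10" "q = 11" "b = 3 \<or> b = 7" and v: "v \<in> V"
  shows "stp k (stp i v) = stp e (stp c (stp a (stp j v))) \<longleftrightarrow>
    20 dvd weight j + weight c + weight k - weight a - weight e - weight i"
proof -
  have "weight l = (\<Sum>i\<in>UNIV. weight i * unit (relabel l) (relabel i))" for l
    unfolding sum_colour by (cases l) simp_all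
  note w = this[symmetric]
  have "(\<Sum>x\<in>UNIV. weight x * (unit (relabel j) + unit (relabel c) + unit (relabel k) -
      unit (relabel a) - unit (relabel e) - unit (relabel i)) (relabel x)) =
      weight j + weight c + weight k - weight a - weight e - weight i"
    unfolding w[of j] w[of c] w[of k] w[of a] w[of e] w[of i]
    by (simp only: minus_apply plus_fun_apply right_diff_distrib distrib_left sum.distrib sum_subtractf w)
  then show ?thesis unfolding stp_def walk_eq_iff[OF v] by (subst lam_weight[OF m10]) simp_all
qed

lemma three_walks_partner:
  assumes m10: "m = 10" "q = 11" "b = 3 \<or> b = 7" and v: "v \<in> V" and ji: "j \<noteq> i" "k \<noteq> i"
  shows "three_walks (stp j v) v (stp i v) (stp k (stp i v)) \<longleftrightarrow> k = partner i j"
proof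
  assume "three_walks (stp j v) v (stp i v) (stp k (stp i v))"
  then obtain a c e a' c' e' where
    w: "stp k (stp i v) = stp e (stp c (stp a (stp j v)))" "stp k (stp i v) = stp e' (stp c' (stp a' (stp j v)))"
    "(stp a (stp j v), stp c (stp a (stp j v))) \<noteq> (v, stp i v)"
    "(stp a' (stp j v), stp c' (stp a' (stp j v))) \<noteq> (v, stp i v)"
    "(stp a (stp j v), stp c (stp a (stp j v))) \<noteq> (stp a' (stp j v), stp c' (stp a' (stp j v)))"
    unfolding three_walks_def nbr_stp by blast
  have "(a, c) \<noteq> (j, i)" "(a', c') \<noteq> (j, i)" "(a, c) \<noteq> (a', c')" using w(3-5) v by auto
  note ne = this
  note w12 = w(1,2)[unfolded walk_eq_weight[OF m10 v]]
  show "k = partner i j"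
  proof (rule ccontr)
    assume k: "k \<noteq> partner i j"
    have "(a, c) = (a', c')"
      using weight_walks_le_2[OF ji k w12(1), unfolded disj_imp, THEN mp, OF ne(1)]
        weight_walks_le_2[OF ji k w12(2), unfolded disj_imp, THEN mp, OF ne(2)]
      by (rule trans[OF _ sym])
    with ne(3) show False by (rule notE)
  qed
next
  assume k: "k = partner i j"
  obtain a c e a' c' e' where w:
    "20 dvd weight j + weight c + weight k - weight a - weight e - weight i"
    "20 dvd weight j + weight c' + weight k - weight a' - weight e' - weight i"
    "(a, c) \<noteq> (j, i)" "(a', c') \<noteq> (j, i)" "(a, c) \<noteq> (a', c')"
    by (rule weight_walks_3[OF ji(1), folded k]) (rule that)
  let ?p = "stp a (stp j v)" and ?p' = "stp a' (stp j v)"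
  have "(?p, stp c ?p) \<noteq> (v, stp i v)" using w(3) v by auto
  moreover have "(?p', stp c' ?p') \<noteq> (v, stp i v)" using w(4) v by auto
  moreover have "(?p, stp c ?p) \<noteq> (?p', stp c' ?p')" using w(5) v by auto
  moreover have eq: "stp k (stp i v) = stp e (stp c ?p)" "stp k (stp i v) = stp e' (stp c' ?p')"
    using w(1,2) unfolding walk_eq_weight[OF m10 v] by simp_all
  have edge: "{x, stp l x} \<in> E" if "x \<in> V" for x l using that by (auto simp: nbr_stp)
  have jv: "stp j v \<in> V" using v by simp
  note pV = stp_simps(1)[OF jv] stp_simps(1)[OF stp_simps(1)[OF jv]]
  have "{stp j v, ?p} \<in> E" "{?p, stp c ?p} \<in> E" "{stp c ?p, stp k (stp i v)} \<in> E"
    unfolding eq(1) by (intro edge jv pV)+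
  moreover have "{stp j v, ?p'} \<in> E" "{?p', stp c' ?p'} \<in> E" "{stp c' ?p', stp k (stp i v)} \<in> E"
    unfolding eq(2) by (intro edge jv pV)+
  ultimately show "three_walks (stp j v) v (stp i v) (stp k (stp i v))"
    unfolding three_walks_def by blast
qed

text \<open>A substitute for a globally constant colour permutation: the path with colours
  \<open>partner i k\<close>, \<open>i\<close>, \<open>k\<close> has three walks, hence so does its
  image, and \<open>partner\<close> then determines the last colour of the image from the first
  two.\<close>

lemma partner_transport:
  assumes m10: "m = 10" "q = 11" "b = 3 \<or> b = 7" and G: "graph_aut V E \<sigma>" and u: "u \<in> V"
    and \<pi>: "\<And>x. \<sigma> (stp x u) = stp (\<pi> x) (\<sigma> u)" and k: "k \<noteq> i" "\<pi> (partner i k) \<noteq> \<pi> i"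
  shows "\<sigma> (stp k (stp i u)) = stp (partner (\<pi> i) (\<pi> (partner i k))) (stp (\<pi> i) (\<sigma> u))"
proof -
  define j where "j = partner i k"
  have j: "j \<noteq> i" "partner i j = k" using partner_partner[OF k(1)] by (simp_all add: j_def)
  let ?w = "stp k (stp i u)"
  have su: "\<sigma> u \<in> V" using graph_aut_in[OF G u] .
  have "three_walks (stp j u) u (stp i u) ?w"
    using three_walks_partner[OF m10 u j(1) k(1)] j(2) by simp
  then have t: "three_walks (stp (\<pi> j) (\<sigma> u)) (\<sigma> u) (stp (\<pi> i) (\<sigma> u)) (\<sigma> ?w)"
    using three_walks_image[OF G, of "stp j u" u "stp i u" ?w] u by (simp add: \<pi>)
  have "{stp i u, ?w} \<in> E" unfolding nbr_stp using u by auto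
  then have "{\<sigma> (stp i u), \<sigma> ?w} \<in> E" using graph_aut_edge[OF G] u by simp
  then obtain k' where k': "\<sigma> ?w = stp k' (stp (\<pi> i) (\<sigma> u))" unfolding \<pi> nbr_stp by blast
  have "\<sigma> ?w \<noteq> \<sigma> u" using graph_aut_inj[OF G, of ?w u] u k(1) by simp
  then have "k' \<noteq> \<pi> i" using k' su by auto
  then have "k' = partner (\<pi> i) (\<pi> j)"
    using three_walks_partner[OF m10 su, of "\<pi> j" "\<pi> i" k'] t k' k(2) by (simp add: j_def)
  then show ?thesis using k' by (simp add: j_def)
qed

lemma no_local_klein_10:
  assumes m10: "m = 10" "q = 11" "b = 3 \<or> b = 7" and d: "d = North \<or> d = South"
    and G: "graph_aut V E \<sigma>" and v: "v \<in> V" and fix0: "\<sigma> v = v"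
    and d': "\<And>i. \<sigma> (step i v) = step (d \<oplus> i) v"
  shows False
proof -
  define d0 where "d0 = relabel d"
  have d0: "d0 = North \<or> d0 = South" using d by (auto simp: d0_def relabel_def)
  have \<pi>: "\<sigma> (stp x v) = stp (d0 \<oplus> x) (\<sigma> v)" for x
    using d'[of "relabel x"] by (simp add: stp_def fix0 d0_def relabel_kadd)
  note transport = partner_transport[OF m10 G]
  define \<pi>1 where "\<pi>1 i k = (if k = i then d0 \<oplus> i else partner (d0 \<oplus> i) (d0 \<oplus> partner i k))" for i k
  have \<pi>1: "\<sigma> (stp k (stp i v)) = stp (\<pi>1 i k) (\<sigma> (stp i v))" for i k
  proof (cases "k = i")
    case True
    then show ?thesis using v by (simp add: \<pi> \<pi>1_def fix0)
  next
    case False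
    have "d0 \<oplus> partner i k \<noteq> d0 \<oplus> i" using partner_partner[OF False] by simp
    then show ?thesis
      using transport[OF v, of "(\<oplus>) d0" k i, OF \<pi> False] False by (simp add: \<pi> \<pi>1_def)
  qed
  have 1: "\<sigma> (stp k (stp i (stp x v))) =
      stp (partner (\<pi>1 x i) (\<pi>1 x (partner i k))) (stp (\<pi>1 x i) (stp (d0 \<oplus> x) v))"
    if "k \<noteq> i" "\<pi>1 x (partner i k) \<noteq> \<pi>1 x i" for k i x
    using transport[of "stp x v" "\<pi>1 x" k i, OF _ \<pi>1 that] v by (simp add: \<pi> fix0)
  \<comment> \<open>Two walks from \<open>v\<close> to one vertex, again by commuting translations.
    Transported along them, a diagonal reflection at \<open>v\<close> would give this vertex two
    different images.\<close>
  have "stp North (stp South (stp East v)) = stp East (stp South (stp North v))"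
    using walk_eq_weight[OF m10, of "stp East v" North South East South North East] v by simp
  then have eq: "\<sigma> (stp North (stp South (stp East v))) = \<sigma> (stp East (stp South (stp North v)))" by simp
  from d0 show False
  proof
    assume d0: "d0 = North"
    have "stp South (stp East (stp North v)) = stp East (stp North (stp East v))"
      using eq 1[of North South East] 1[of East South North] by (simp add: \<pi>1_def d0)
    then show False
      using walk_eq_weight[OF m10, of "stp North v" South East East North East North] v by simp
  next
    assume d0: "d0 = South"
    have "stp North (stp West (stp South v)) = stp West (stp South (stp West v))"
      using eq 1[of North South East] 1[of East South North] by (simp add: \<pi>1_def d0)
    then show False
      using walk_eq_weight[OF m10, of "stp South v" North West West South West South] v by simp
  qed
qed

theorem not_class_2_01:
  assumes r: "regular" and bsq: "\<not> int m dvd (int b)\<^sup>2 - 1"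
  shows "\<not> class_2_01 V E F"
proof
  assume C: "class_2_01 V E F"
  obtain d \<sigma> where d: "d = North \<or> d = South" and G: "graph_aut V E \<sigma>" and f: "\<sigma> (at 0) = at 0"
    and d': "\<And>i. \<sigma> (step i (at 0)) = step (d \<oplus> i) (at 0)"
    using class_local_klein[OF C at_in] by blast
  show False
  proof (cases "q \<noteq> 1 \<and> m = 10 \<and> (b = 3 \<or> b = 7)")
    case True
    with no_local_klein_10[OF _ _ _ d G at_in f d'] q show False by auto
  next
    case False
    then obtain \<pi> where "colour_aut \<pi> \<sigma>" using regular_colour_aut[OF r _ G] by blast
    then show False using no_class_of_colour_aut[OF bsq d _ f d'] by blast
  qed
qed

end

lemma graph_iso_refl: "graph_iso V E V E"
  unfolding graph_iso_def by (intro exI[of _ id]) simp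

context rose_window
begin

definition reflect :: "bool \<times> nat \<Rightarrow> bool \<times> nat" where
  "reflect v = vt (fst v, - int (snd v))"

lemma reflect_vt: "reflect (vt (c, i)) = vt (c, - i)"
proof -
  have "vt (c, i) = vt (c, int (snd (vt (c, i))))"
    using vt_surj[OF vt_in[of "(c, i)"]] by (simp add: vt_def)
  then have "2 * int m dvd i - int (snd (vt (c, i)))" by (simp add: vt_eq_iff)
  then have "2 * int m dvd - (i - int (snd (vt (c, i))))" by (simp only: dvd_minus_iff)
  then show ?thesis using m2 by (simp add: reflect_def vt_eq_iff vt_def[of "(c, i)"])
qed

lemma reflect_edge:
  assumes R: "rose_window m (m - b) q" and e: "{u, v} \<in> E"
  shows "{reflect u, reflect v} \<in> colour_edges V (rose_window.step m (m - b) q)"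
proof -
  interpret R: rose_window m "m - b" q by (rule R)
  have "{u, v} \<in> {{vt (False, i), vt (False, i + 1)} | i. True} \<union>
    {{vt (True, i), vt (True, i + q)} | i. True} \<union> {{vt (False, i), vt (True, i)} | i. True} \<union>
    {{vt (False, i), vt (True, i - 2 * int b)} | i. True}" using e unfolding edges_int .
  then obtain i where i: "{u, v} = {vt (False, i), vt (False, i + 1)} \<or> {u, v} = {vt (True, i), vt (True, i + q)}
      \<or> {u, v} = {vt (False, i), vt (True, i)} \<or> {u, v} = {vt (False, i), vt (True, i - 2 * int b)}" by blast
  have im: "{reflect u, reflect v} = {reflect x, reflect y}" if "{u, v} = {x, y}" for x y
    using arg_cong[OF that, of "\<lambda>S. reflect ` S"] by simp
  have *: "{vt (False, - i), vt (True, - i + 2 * int b)} = {vt (False, - i), vt (True, - i - 2 * int (m - b))}"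
    using bm by (auto simp: vt_eq_iff of_nat_diff doubleton_eq_iff)
  from i show ?thesis
  proof (elim disjE)
    assume "{u, v} = {vt (False, i), vt (False, i + 1)}"
    then have "{reflect u, reflect v} = {vt (False, - i - 1), vt (False, - i - 1 + 1)}"
      using im by (simp add: reflect_vt insert_commute)
    then show ?thesis unfolding R.edges_int by blast
  next
    assume "{u, v} = {vt (True, i), vt (True, i + q)}"
    then have "{reflect u, reflect v} = {vt (True, - i - q), vt (True, - i - q + q)}"
      using im by (simp add: reflect_vt insert_commute)
    then show ?thesis unfolding R.edges_int by blast
  next
    assume "{u, v} = {vt (False, i), vt (True, i)}"
    then have "{reflect u, reflect v} = {vt (False, - i), vt (True, - i)}"
      using im by (simp add: reflect_vt)
    then show ?thesis unfolding R.edges_int by blast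
  next
    assume "{u, v} = {vt (False, i), vt (True, i - 2 * int b)}"
    then have "{reflect u, reflect v} = {vt (False, - i), vt (True, - i - 2 * int (m - b))}"
      using im * by (simp add: reflect_vt)
    then show ?thesis unfolding R.edges_int by blast
  qed
qed

text \<open>Reversing all indices turns the spoke from x_i to y_{i - 2b} into the one from x_{-i} to
  y_{-i + 2b}. The excluded families are meant up to isomorphism, so with a parameter
  \<open>b\<close> they also contain \<open>m - b\<close>.\<close>

lemma reflect_iso:
  assumes r: "r = 1 \<and> q = 1 \<or> r = m - 1 \<and> q = int m + 1"
  shows "graph_iso V (rw_E (2 * m) (2 * b) r) V (rw_E (2 * m) (2 * (m - b)) r)"
proof -
  have R: "rose_window m (m - b) q"
    using m2 b0 bm q by unfold_locales auto
  interpret R: rose_window m "m - b" q by (rule R)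
  have mb: "m - (m - b) = b" using bm by simp
  have rr: "reflect (reflect v) = v" if "v \<in> V" for v
  proof -
    have "reflect v = vt (fst v, - int (snd v))" by (simp add: reflect_def)
    then show ?thesis using vt_surj[OF that] by (simp add: reflect_vt)
  qed
  have rV: "reflect v \<in> V" for v by (simp add: reflect_def vt_in)
  have "bij_betw reflect V V"
    by (rule bij_betw_byWitness[of _ reflect]) (use rr rV in auto)
  moreover have "{u, v} \<in> E \<longleftrightarrow> {reflect u, reflect v} \<in> R.E" if "u \<in> V" "v \<in> V" for u v
  proof
    assume "{u, v} \<in> E"
    then show "{reflect u, reflect v} \<in> R.E" by (rule reflect_edge[OF R])
  next
    assume "{reflect u, reflect v} \<in> R.E"
    from R.reflect_edge[unfolded mb, OF rose_window_axioms this]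
    have "{R.reflect (reflect u), R.reflect (reflect v)} \<in> E" .
    moreover have "R.reflect = reflect"
      by (rule ext) (simp add: reflect_def R.reflect_def)
    ultimately show "{u, v} \<in> E" using rr that by simp
  qed
  ultimately show ?thesis unfolding rw_E_eq[OF r] R.rw_E_eq[OF r] graph_iso_def by blast
qed

end

theorem theorem3p7:
  fixes m b r :: nat
  assumes m2: "2 \<le> m"
    and bm: "b < m"
    and bsq: "b\<^sup>2 mod m = 1 mod m \<or> (b\<^sup>2 + 1) mod m = 0"
    and r: "r = 1 \<or> (r = m - 1 \<and> even m)"
    and not1: "\<not> graph_iso (rw_V (2*m)) (rw_E (2*m) (2*b) r) (rw_V (2*m)) (rw_E (2*m) 2 1)"
    and not2: "\<not> graph_iso (rw_V (2*m)) (rw_E (2*m) (2*b) r) (rw_V (2*m)) (rw_E (2*m) (m - 2) (m - 1))"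
  shows "((\<exists>F. class_2_01 (rw_V (2*m)) (rw_E (2*m) (2*b) r) F) \<longleftrightarrow> b\<^sup>2 mod m = 1 mod m)
    \<and> (b\<^sup>2 mod m = 1 mod m \<longrightarrow>
        (\<exists>F1 F2 F3.
           class_2_01 (rw_V (2*m)) (rw_E (2*m) (2*b) r) F1 \<and>
           class_2_01 (rw_V (2*m)) (rw_E (2*m) (2*b) r) F2 \<and>
           class_2_01 (rw_V (2*m)) (rw_E (2*m) (2*b) r) F3 \<and>
           \<not> map_iso (rw_V (2*m)) (rw_E (2*m) (2*b) r) F1 F2 \<and>
           \<not> map_iso (rw_V (2*m)) (rw_E (2*m) (2*b) r) F1 F3 \<and>
           \<not> map_iso (rw_V (2*m)) (rw_E (2*m) (2*b) r) F2 F3 \<and>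
           (\<forall>F. class_2_01 (rw_V (2*m)) (rw_E (2*m) (2*b) r) F \<longrightarrow>
                map_iso (rw_V (2*m)) (rw_E (2*m) (2*b) r) F F1 \<or>
                map_iso (rw_V (2*m)) (rw_E (2*m) (2*b) r) F F2 \<or>
                map_iso (rw_V (2*m)) (rw_E (2*m) (2*b) r) F F3)))"
proof -
  have b0: "0 < b" using bsq m2 by (cases "b = 0") auto
  have "m \<noteq> 2"
  proof
    assume "m = 2"
    with b0 bm r have "b = 1" "r = 1" by auto
    with not1 show False by (simp add: graph_iso_refl)
  qed
  with m2 have m3: "2 < m" by simp
  define q where "q = (if r = 1 then 1 else int m + 1)"
  have rq: "r = 1 \<and> q = 1 \<or> r = m - 1 \<and> q = int m + 1" using r by (auto simp: q_def)
  have sq: "b\<^sup>2 mod m = 1 mod m \<longleftrightarrow> int m dvd (int b)\<^sup>2 - 1"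
  proof -
    have "b\<^sup>2 mod m = 1 mod m \<longleftrightarrow> int (b\<^sup>2 mod m) = int (1 mod m)" by (simp only: of_nat_eq_iff)
    also have "\<dots> \<longleftrightarrow> (int b)\<^sup>2 mod int m = 1 mod int m" by (simp only: zmod_int of_nat_power of_nat_1)
    finally show ?thesis by (simp add: mod_eq_dvd_iff)
  qed
  have sq': "(b\<^sup>2 + 1) mod m = 0 \<longleftrightarrow> int m dvd (int b)\<^sup>2 + 1"
  proof -
    have "(b\<^sup>2 + 1) mod m = 0 \<longleftrightarrow> m dvd b\<^sup>2 + 1" by (rule dvd_eq_mod_eq_0[symmetric])
    also have "\<dots> \<longleftrightarrow> int m dvd int (b\<^sup>2 + 1)" by (simp only: of_nat_dvd_iff)
    finally show ?thesis by (simp add: add.commute)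
  qed
  have odd: "odd b" if "even m"
  proof -
    have "even (int m)" using that by simp
    then have "even ((int b)\<^sup>2 - 1) \<or> even ((int b)\<^sup>2 + 1)"
      using bsq unfolding sq sq' by (meson dvd_trans)
    then show ?thesis by auto
  qed
  interpret rose_window m b q
    using m3 b0 bm r odd by unfold_locales (auto simp: q_def)
  have mb: "2 * (m - b) = 2 * m - 2 * b" by simp
  have reg: "regular" unfolding regular_def
  proof (intro conjI impI)
    show "int m dvd (int b)\<^sup>2 - 1 \<or> int m dvd (int b)\<^sup>2 + 1" using bsq by (simp only: sq sq')
    show "b \<noteq> 1" if "q = 1"
    proof
      assume "b = 1"
      moreover have "r = 1" using that rq m3 by auto
      ultimately show False using not1 by (simp add: graph_iso_refl)
    qed
    show "b \<noteq> m - 1" if "q = 1"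
    proof
      assume "b = m - 1"
      then have "2 * (m - b) = 2" using m3 by simp
      moreover have "r = 1" using that rq m3 by auto
      ultimately show False using not1 reflect_iso[OF rq] by simp
    qed
    show "2 * b + 2 \<noteq> m" if "q \<noteq> 1"
    proof
      assume "2 * b + 2 = m"
      then have "m - 2 = 2 * b" by simp
      moreover have "r = m - 1" using that rq by auto
      ultimately show False using not2 by (simp add: graph_iso_refl)
    qed
    show "2 * b \<noteq> m + 2" if "q \<noteq> 1"
    proof
      assume "2 * b = m + 2"
      then have "2 * (m - b) = m - 2" by simp
      moreover have "r = m - 1" using that rq by auto
      ultimately show False using not2 reflect_iso[OF rq] by simp
    qed
  qed
  show ?thesis
  proof (cases "int m dvd (int b)\<^sup>2 - 1")
    case False
    then show ?thesis using not_class_2_01[OF reg] unfolding sq rw_E_eq[OF rq] by blast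
  next
    case True
    note H1 = graph_aut_klein[OF reg True] and H2 = klein_transitive[OF lam_klein[OF True]]
    have cls: "class_2_01 V E (bimap d)" if "d \<noteq> East" for d
      using class_bimap[OF H1 H2 that] .
    have refl: "map_iso V E F F" for F
      unfolding map_iso_def graph_aut_def by (intro exI[of _ id]) simp
    have all: "map_iso V E F (bimap North) \<or> map_iso V E F (bimap West) \<or> map_iso V E F (bimap South)"
      if C: "class_2_01 V E F" for F
    proof -
      obtain d where "d \<noteq> East" "F = bimap d" using class_2_01_bimap[OF H1 C] by blast
      then show ?thesis using refl by (cases d) auto
    qed
    have "\<not> map_iso V E (bimap North) (bimap West)" "\<not> map_iso V E (bimap North) (bimap South)"
        "\<not> map_iso V E (bimap West) (bimap South)"
      using bimap_not_iso[OF H1] by simp_all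
    with cls[of North] cls[of West] cls[of South] all show ?thesis
      unfolding rw_E_eq[OF rq] sq using True by blast
  qed
qed

end
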